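(* Consider a generalized Lawrence matrix $C=\mathrm{GLM}(\varepsilon_1,\mathbf a'_1,\ldots,\mathbf a'_s\mid\mathbf c'_0,\mathbf c'_1,\ldots,\mathbf c'_s)$ with $n$ columns, where $\varepsilon_1=(1,0,\ldots,0)\in\mathbb Z^d$, $\mathbf c'_0\in\mathbb Z^k$ with $k\ge 1$ and $c'_{01}=1$, each $\mathbf a'_i\in\mathbb Z^d$ ($1\le i\le s$) has first component $0$, and $\sum_j c'_{ij}=0$ for all $i=1,\ldots,s$. If the configuration $\{\mathbf a'_1,\ldots,\mathbf a'_s\}\subset\mathbb Z^d$ is non-pyramidal, then for any multiset configuration $A$ with $n+k$ elements (counted with multiplicity) whose ground set is the set of columns of $C$, the variety $X_A$ is a self-dual projective toric variety.
   Context: A configuration is a finite list of vectors in some $\mathbb Z^m$, identified with the integer matrix having these columns. A multiset configuration $A$ with ground set a set $S$ of vectors is a multiset in which each element of $S$ occurs at least once and nothing else occurs; it is identified with the matrix whose columns are its elements, listed with multiplicity. Non-pyramidal: for a configuration $\mathbf a_1,\dots,\mathbf a_n$ forming the columns of a matrix $A$, the vector $\mathbf a_i$ is called free if every $\mathbf u\in\ker_{\mathbb Z}(A)$ has $u_i=0$. The configuration is non-pyramidal if it has no free vectors. Generalized Lawrence matrices: let $\mathbf b_0,\ldots,\mathbf b_s\in\mathbb Z^d$ be a configuration and let $\mathbf c'_i=(c'_{i1},\ldots,c'_{im_i})\in\mathbb Z^{m_i}$, $m_i\ge 1$ ($i=0,\ldots,s$) be primitive vectors (gcd of the components is $1$),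 each having full support (all components nonzero) and positive first component. Let $C_i\in\mathbb Z^{(m_i-1)\times m_i}$ be the matrix whose $r$-th row ($1\le r\le m_i-1$) has first entry $-c'_{i,r+1}$, $(r+1)$-st entry $c'_{i1}$, and all other entries $0$. Choose integers $\lambda_{i1},\ldots,\lambda_{im_i}$ with $\lambda_{i1}c'_{i1}+\cdots+\lambda_{im_i}c'_{im_i}=1$ and put $A_i=[\lambda_{i1}\mathbf b_i,\ldots,\lambda_{im_i}\mathbf b_i]\in\mathbb Z^{d\times m_i}$. Then $\mathrm{GLM}(\mathbf b_0,\ldots,\mathbf b_s\mid\mathbf c'_0,\ldots,\mathbf c'_s)$ is the block matrix with first block row $(A_0\ A_1\ \cdots\ A_s)$ and, below it, the block diagonal matrix $\mathrm{diag}(C_0,\ldots,C_s)$; it has $m_0+\cdots+m_s$ columns and $d+\sum_i(m_i-1)$ rows. Different choices of the $\lambda_{ij}$ give matrices with the same kernel. (In the claim $\mathbf b_0=\varepsilon_1$, $\mathbf b_i=\mathbf a'_i$ for $i\ge1$, and $m_0=k$.) Toric varieties: $K$ is an algebraically closed field of characteristic zero. For an integer matrix $A$ with $N$ columns, $I_A\subset K[x_1,\ldots,x_N]$ is the toric ideal generated by all binomials $x^{\mathbf u^+}-x^{\mathbf u^-}$, $\mathbf u\in\ker_{\mathbb Z}(A)$, where $\mathbf u=\mathbf u^+-\mathbf u^-$ with $\mathbf u^+,\mathbf u^-\in\mathbb N^N$ of disjoint support. $X_A$ is a projective toric variety if $(1,\ldots,1)$ lies in the (rational) row span of $A$; then $I_A$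 is homogeneous and $X_A=V(I_A)\subset\mathbb P_K^{N-1}$. The dual variety $X_A^*$ is the closure, in the dual projective space, of the set of hyperplanes that intersect the regular points of $X_A$ non-transversally. $X_A$ is self-dual if it is isomorphic to $X_A^*$ as embedded projective varieties, i.e. some linear isomorphism of the ambient projective spaces carries $X_A$ onto $X_A^*$. *)

theory Defs
  imports
    "HOL-Analysis.Analysis"
    "HOL-Library.Poly_Mapping"
    "HOL-Library.Multiset"
    "HOL-Computational_Algebra.Polynomial"
    "Jordan_Normal_Form.Matrix_Kernel"
begin

text \<open>
  Integer vectors and matrices, whose sizes vary within the statement, are the vectors and matrices of
  \<^theory>\<open>Jordan_Normal_Form.Matrix\<close>, and \<open>$\<close> denotes their indexing (from 0). Points of
  the ambient projective space are given by homogeneous coordinates in \<open>'k ^ 'n\<close>, where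
  \<open>'n\<close> indexes the columns of the configuration; their components are written \<open>vec_nth x j\<close>.
\<close>

unbundle no vec_syntax
notation Matrix.vec_index (infixl "$" 100)


section \<open>Integer configurations\<close>

definition free_vector :: "int mat \<Rightarrow> nat \<Rightarrow> bool" where
  "free_vector A i \<longleftrightarrow> (\<forall>u\<in>mat_kernel A. u $ i = 0)"

definition non_pyramidal :: "int mat \<Rightarrow> bool" where
  "non_pyramidal A \<longleftrightarrow> (\<forall>i<dim_col A. \<not> free_vector A i)"

definition primitive_vec :: "int vec \<Rightarrow> bool" where
  "primitive_vec c \<longleftrightarrow> Gcd {c $ j |j. j < dim_vec c} = 1"

definition full_support :: "int vec \<Rightarrow> bool" where
  "full_support c \<longleftrightarrow> (\<forall>j<dim_vec c. c $ j \<noteq> 0)"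

definition lawrence_block :: "int vec \<Rightarrow> int mat" where
  "lawrence_block c = mat (dim_vec c - 1) (dim_vec c)
     (\<lambda>(r, j). if j = 0 then - (c $ (r + 1)) else if j = r + 1 then c $ 0 else 0)"

definition multiples_block :: "int vec \<Rightarrow> int vec \<Rightarrow> int vec list" where
  "multiples_block b l = map (\<lambda>j. l $ j \<cdot>\<^sub>v b) [0..<dim_vec l]"

definition GLM :: "nat \<Rightarrow> int vec list \<Rightarrow> int vec list \<Rightarrow> int vec list \<Rightarrow> int mat" where
  "GLM d bs cs ls =
     mat_of_cols d (concat (map2 multiples_block bs ls)) @\<^sub>r diag_block_mat (map lawrence_block cs)"

text \<open>\<open>C\<close> is a matrix \<open>GLM(b\<^sub>0, \<dots>, b\<^sub>s | c\<^sub>0, \<dots>, c\<^sub>s)\<close>, for some choice \<open>ls\<close> of the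
  multipliers \<open>\<lambda>\<^sub>i\<close>.\<close>

definition generalized_lawrence_matrix ::
    "nat \<Rightarrow> int vec list \<Rightarrow> int vec list \<Rightarrow> int mat \<Rightarrow> bool" where
  "generalized_lawrence_matrix d bs cs C \<longleftrightarrow>
     length bs = length cs \<and> set bs \<subseteq> carrier_vec d \<and>
     (\<forall>c\<in>set cs. dim_vec c \<ge> 1 \<and> primitive_vec c \<and> full_support c \<and> c $ 0 > 0) \<and>
     (\<exists>ls. length ls = length cs \<and>
       (\<forall>i<length cs. dim_vec (ls ! i) = dim_vec (cs ! i) \<and> ls ! i \<bullet> cs ! i = 1) \<and>
       C = GLM d bs cs ls)"

text \<open>From here on a configuration in \<open>\<int>\<^sup>m\<close> is a family \<open>a :: 'n \<Rightarrow> int vec\<close> of columns.\<close>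

definition int_relations :: "nat \<Rightarrow> ('n::finite \<Rightarrow> int vec) \<Rightarrow> ('n \<Rightarrow> int) set" where
  "int_relations m a = {u. \<forall>r<m. (\<Sum>j\<in>UNIV. u j * (a j $ r)) = 0}"

definition projective_configuration :: "nat \<Rightarrow> ('n::finite \<Rightarrow> int vec) \<Rightarrow> bool" where
  "projective_configuration m a \<longleftrightarrow>
     (\<exists>w :: nat \<Rightarrow> rat. \<forall>j. (\<Sum>r<m. w r * of_int (a j $ r)) = 1)"


section \<open>Polynomials in the variables \<open>x\<^sub>j\<close>, \<open>j :: 'n\<close>\<close>

type_synonym ('n, 'k) mpoly = "('n \<Rightarrow>\<^sub>0 nat) \<Rightarrow>\<^sub>0 'k"

definition mpoly_eval :: "('n::finite, 'k::field) mpoly \<Rightarrow> 'k ^ 'n \<Rightarrow> 'k" where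
  "mpoly_eval f x = (\<Sum>\<alpha>\<in>Poly_Mapping.keys f.
     Poly_Mapping.lookup f \<alpha> * (\<Prod>j\<in>UNIV. vec_nth x j ^ Poly_Mapping.lookup \<alpha> j))"

text \<open>When \<open>x\<^sub>j\<close> does not divide \<open>x\<^sup>\<alpha>\<close>, the exponent difference truncates but the coefficient is 0.\<close>

definition mpoly_pderiv :: "'n \<Rightarrow> ('n::finite, 'k::field) mpoly \<Rightarrow> ('n, 'k) mpoly" where
  "mpoly_pderiv j f = (\<Sum>\<alpha>\<in>Poly_Mapping.keys f.
     Poly_Mapping.single (\<alpha> - Poly_Mapping.single j 1)
       (of_nat (Poly_Mapping.lookup \<alpha> j) * Poly_Mapping.lookup f \<alpha>))"

definition homogeneous :: "('n::finite, 'k::field) mpoly \<Rightarrow> bool" where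
  "homogeneous f \<longleftrightarrow>
     (\<exists>n. \<forall>\<alpha>\<in>Poly_Mapping.keys f. (\<Sum>j\<in>UNIV. Poly_Mapping.lookup \<alpha> j) = n)"

definition mpoly_ideal :: "('n, 'k::field) mpoly set \<Rightarrow> ('n, 'k) mpoly set" where
  "mpoly_ideal B = Modules.module.span (*) B"


section \<open>Projective varieties\<close>

text \<open>
  A subset of \<open>P(K\<^sup>n)\<close> is represented by the set of all homogeneous coordinate vectors of its points,
  a subset of \<open>K\<^sup>n - {0}\<close> stable under multiplication by nonzero scalars. The Zariski topology is pulled back
  along \<open>K\<^sup>n - {0} \<rightarrow> P(K\<^sup>n)\<close>, so that its closed sets are exactly the representatives of
  the projective algebraic sets.
\<close>

definition zariski :: "('k::field ^ 'n::finite) topology" where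
  "zariski = topology_generated_by {{x. x \<noteq> 0 \<and> mpoly_eval f x \<noteq> 0} |f. homogeneous f}"

definition irreducible_closed :: "'a topology \<Rightarrow> 'a set \<Rightarrow> bool" where
  "irreducible_closed T Z \<longleftrightarrow> closedin T Z \<and> Z \<noteq> {} \<and>
     (\<forall>F G. closedin T F \<longrightarrow> closedin T G \<longrightarrow> Z = F \<union> G \<longrightarrow> Z = F \<or> Z = G)"

definition krull_dim :: "'a topology \<Rightarrow> enat" where
  "krull_dim T = Sup {enat l |l. \<exists>Z :: nat \<Rightarrow> 'a set.
     (\<forall>i\<le>l. irreducible_closed T (Z i)) \<and> (\<forall>i<l. Z i \<subset> Z (Suc i))}"

text \<open>The linear subspace of \<open>K\<^sup>n\<close> whose projectivization is the embedded projective tangent space of \<open>X\<close>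
  at \<open>x\<close>.\<close>

definition tangent_space :: "('k::field ^ 'n::finite) set \<Rightarrow> 'k ^ 'n \<Rightarrow> ('k ^ 'n) set" where
  "tangent_space X x = {y. \<forall>f. homogeneous f \<and> (\<forall>z\<in>X. mpoly_eval f z = 0) \<longrightarrow>
     (\<Sum>j\<in>UNIV. mpoly_eval (mpoly_pderiv j f) x * vec_nth y j) = 0}"

text \<open>For an irreducible variety \<open>X\<close>, whose local dimension at every point is \<open>dim X\<close>.\<close>

definition regular_points :: "('k::field ^ 'n::finite) set \<Rightarrow> ('k ^ 'n) set" where
  "regular_points X = {x\<in>X. enat (vec.dim (tangent_space X x)) = krull_dim (subtopology zariski X) + 1}"

definition hyperplane :: "'k::field ^ 'n::finite \<Rightarrow> ('k ^ 'n) set" where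
  "hyperplane h = {y. (\<Sum>j\<in>UNIV. vec_nth h j * vec_nth y j) = 0}"

text \<open>The dual projective space is coordinatized by the coefficients of the equations of hyperplanes.\<close>

definition dual_variety :: "('k::field ^ 'n::finite) set \<Rightarrow> ('k ^ 'n) set" where
  "dual_variety X = zariski closure_of
     {h. h \<noteq> 0 \<and> (\<exists>x\<in>regular_points X. x \<in> hyperplane h \<and> tangent_space X x \<subseteq> hyperplane h)}"

definition self_dual :: "('k::field ^ 'n::finite) set \<Rightarrow> bool" where
  "self_dual X \<longleftrightarrow> (\<exists>P :: 'k ^ 'n ^ 'n. invertible P \<and> (\<lambda>x. P *v x) ` X = dual_variety X)"


section \<open>Toric varieties\<close>

definition monomial_of :: "('n::finite \<Rightarrow> nat) \<Rightarrow> ('n, 'k::field) mpoly" where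
  "monomial_of e = Poly_Mapping.single (Abs_poly_mapping e) 1"

text \<open>\<open>nat\<close> is 0 on negative integers, so the exponents below are \<open>u\<^sup>+\<close> and \<open>u\<^sup>-\<close>.\<close>

definition toric_ideal :: "nat \<Rightarrow> ('n::finite \<Rightarrow> int vec) \<Rightarrow> ('n, 'k::field) mpoly set" where
  "toric_ideal m a = mpoly_ideal
     {monomial_of (\<lambda>j. nat (u j)) - monomial_of (\<lambda>j. nat (- u j)) |u. u \<in> int_relations m a}"

definition toric_variety :: "nat \<Rightarrow> ('n::finite \<Rightarrow> int vec) \<Rightarrow> ('k::field ^ 'n) set" where
  "toric_variety m a = {x. x \<noteq> 0 \<and> (\<forall>f\<in>toric_ideal m a. mpoly_eval f x = 0)}"

end

theory Submission
  imports Defs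
begin

text \<open>
  The relations of the columns of \<open>C\<close> are the vectors \<open>(t\<^sub>i c'\<^sub>i)\<close> with \<open>\<Sum>\<^sub>i t\<^sub>i b\<^sub>i = 0\<close>. Since \<open>b\<^sub>0 = \<epsilon>\<^sub>1\<close> is the only
  \<open>b\<^sub>i\<close> with a nonzero first entry, \<open>t\<^sub>0 = 0\<close>, and as the entries of \<open>c'\<^sub>i\<close> sum to zero for \<open>i \<ge> 1\<close>, the
  variety is stable under scaling all coordinates of one block. A conormal vector at a torus point \<open>y\<close> has
  coordinates \<open>t\<^sub>i c'\<^sub>i\<^sub>j / y\<^sub>i\<^sub>j\<close>, that is, up to the constants \<open>c'\<^sub>i\<^sub>j\<close> it is a block scaling of the torus point
  \<open>1 / y\<close>. So for a non-pyramidal configuration without repetitions the dual variety is the image of the variety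
  under the diagonal matrix of the \<open>c'\<^sub>i\<^sub>j\<close>. In general, the free columns are coned over by the variety and cut
  out by linear equations from the dual, while repeated columns do the opposite, and the size \<open>n + k\<close> makes both
  numbers equal. Columns of \<open>C\<close> coincide only inside a block \<open>c'\<^sub>i = (c, - c)\<close> with \<open>b\<^sub>i = 0\<close>, whose single
  distinct column is free, which preserves the balance.

  The variety is the Zariski closure of its torus points, because a polynomial vanishing on the torus vanishes
  along generic monomial curves, so that its coefficients sum to zero over each class of monomials modulo
  the relations. Its dimension is bounded above by comparing the growth of the Hilbert function along a chain of
  irreducible closed subsets with the number of these classes, and below by a chain of toric subvarieties.
\<close>


section \<open>Polynomial functions and homogeneity\<close>

text \<open>All toric data enter through the lattice of relations, so the argument runs over sets
  \<open>rel V\<close>. These are integer orthogonal complements, hence closed under division by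
  nonzero integers, which is what makes the binomial varieties irreducible. The obstacle is that the
  dual variety is defined through regular points, and the regular points outside the torus are hard
  to describe. Two facts avoid describing them. Torus points are regular, and this is what the Krull
  dimension is computed for. Conormal vectors at any point of the variety satisfy every homogeneous
  equation that holds for the conormal vectors at torus points. Self-duality therefore becomes a
  comparison over the torus, where logarithmic coordinates \<open>v / y\<close> make all tangent
  spaces equal to one linear space, the row space.\<close>

lemma mpoly_eval_superset:
  assumes "finite S" "Poly_Mapping.keys f \<subseteq> S"
  shows "mpoly_eval f x = (\<Sum>\<alpha>\<in>S. Poly_Mapping.lookup f \<alpha> * (\<Prod>j\<in>UNIV. vec_nth x j ^ Poly_Mapping.lookup \<alpha> j))"
  unfolding mpoly_eval_def
  by (rule sum.mono_neutral_left) (use assms in \<open>auto simp: in_keys_iff\<close>)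

lemma mpoly_eval_0 [simp]: "mpoly_eval 0 x = 0"
  by (simp add: mpoly_eval_def)

lemma mpoly_eval_add [simp]: "mpoly_eval (f + g) x = mpoly_eval f x + mpoly_eval g x"
proof -
  let ?S = "Poly_Mapping.keys f \<union> Poly_Mapping.keys g"
  have "mpoly_eval (f + g) x = (\<Sum>\<alpha>\<in>?S. Poly_Mapping.lookup (f + g) \<alpha> * (\<Prod>j\<in>UNIV. vec_nth x j ^ Poly_Mapping.lookup \<alpha> j))"
    by (rule mpoly_eval_superset) (auto dest: subsetD[OF keys_add])
  moreover have "mpoly_eval f x = (\<Sum>\<alpha>\<in>?S. Poly_Mapping.lookup f \<alpha> * (\<Prod>j\<in>UNIV. vec_nth x j ^ Poly_Mapping.lookup \<alpha> j))"
    by (rule mpoly_eval_superset) auto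
  moreover have "mpoly_eval g x = (\<Sum>\<alpha>\<in>?S. Poly_Mapping.lookup g \<alpha> * (\<Prod>j\<in>UNIV. vec_nth x j ^ Poly_Mapping.lookup \<alpha> j))"
    by (rule mpoly_eval_superset) auto
  ultimately show ?thesis
    by (simp add: lookup_add distrib_right sum.distrib)
qed

lemma mpoly_eval_single [simp]:
  "mpoly_eval (Poly_Mapping.single \<alpha> c) x = c * (\<Prod>j\<in>UNIV. vec_nth x j ^ Poly_Mapping.lookup \<alpha> j)"
  by (simp add: mpoly_eval_def)

lemma mpoly_eval_1 [simp]: "mpoly_eval 1 x = 1"
  by (simp flip: single_one)

lemma mpoly_eval_uminus [simp]: "mpoly_eval (- f) x = - mpoly_eval f x"
  by (simp add: mpoly_eval_def sum_negf)

lemma mpoly_eval_diff [simp]: "mpoly_eval (f - g) x = mpoly_eval f x - mpoly_eval g x"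
  using mpoly_eval_add[of f "- g" x] by (simp del: mpoly_eval_add)

lemma mpoly_eval_sum [simp]: "mpoly_eval (\<Sum>i\<in>I. f i) x = (\<Sum>i\<in>I. mpoly_eval (f i) x)"
  by (induction I rule: infinite_finite_induct) auto

lemma mpoly_as_sum:
  "f = (\<Sum>\<alpha>\<in>Poly_Mapping.keys f. Poly_Mapping.single \<alpha> (Poly_Mapping.lookup f \<alpha>))"
  by (rule poly_mapping_eqI)
    (auto simp: lookup_sum lookup_single when_def in_keys_iff)

lemma mpoly_eval_mult [simp]: "mpoly_eval (f * g) x = mpoly_eval f x * mpoly_eval g x"
proof -
  let ?l = Poly_Mapping.lookup
  have "f * g = (\<Sum>\<alpha>\<in>Poly_Mapping.keys f. Poly_Mapping.single \<alpha> (?l f \<alpha>)) * (\<Sum>\<beta>\<in>Poly_Mapping.keys g. Poly_Mapping.single \<beta> (?l g \<beta>))"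
    by (simp flip: mpoly_as_sum)
  then have "f * g = (\<Sum>\<alpha>\<in>Poly_Mapping.keys f. \<Sum>\<beta>\<in>Poly_Mapping.keys g.
      Poly_Mapping.single (\<alpha> + \<beta>) (?l f \<alpha> * ?l g \<beta>))"
    by (simp add: sum_product mult_single)
  then show ?thesis
    by (simp add: mpoly_eval_def[of f] mpoly_eval_def[of g] sum_product lookup_add power_add prod.distrib mult_ac)
qed

lemma mpoly_eval_power [simp]: "mpoly_eval (f ^ n) x = mpoly_eval f x ^ n"
  by (induction n) auto

lemma mpoly_eval_prod [simp]: "mpoly_eval (\<Prod>i\<in>I. f i) x = (\<Prod>i\<in>I. mpoly_eval (f i) x)"
  by (induction I rule: infinite_finite_induct) auto

text \<open>Names the degree that \<open>homogeneous\<close> leaves existential, as is needed for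
  adding forms and for the Hilbert function. The zero polynomial has every degree.\<close>

definition hom_of_degree :: "nat \<Rightarrow> ('n::finite, 'k::field) mpoly \<Rightarrow> bool" where
  "hom_of_degree n f \<longleftrightarrow> (\<forall>\<alpha>\<in>Poly_Mapping.keys f. (\<Sum>j\<in>UNIV. Poly_Mapping.lookup \<alpha> j) = n)"

lemma homogeneous_iff: "homogeneous f \<longleftrightarrow> (\<exists>n. hom_of_degree n f)"
  by (simp add: homogeneous_def hom_of_degree_def)

lemma hom_of_degree_0 [simp]: "hom_of_degree n 0"
  by (simp add: hom_of_degree_def)

lemma hom_of_degree_add: "hom_of_degree n f \<Longrightarrow> hom_of_degree n g \<Longrightarrow> hom_of_degree n (f + g)"
  using keys_add[of f g] by (auto simp: hom_of_degree_def)

lemma hom_of_degree_sum: "(\<And>i. i \<in> I \<Longrightarrow> hom_of_degree n (f i)) \<Longrightarrow> hom_of_degree n (\<Sum>i\<in>I. f i)"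
  by (induction I rule: infinite_finite_induct) (auto intro: hom_of_degree_add)

lemma hom_of_degree_single:
  "(\<Sum>j\<in>UNIV. Poly_Mapping.lookup \<alpha> j) = n \<Longrightarrow> hom_of_degree n (Poly_Mapping.single \<alpha> c)"
  by (simp add: hom_of_degree_def)

lemma hom_of_degree_1 [simp]: "hom_of_degree 0 1"
  by (simp add: hom_of_degree_single flip: single_one)

lemma hom_of_degree_mult:
  "hom_of_degree m f \<Longrightarrow> hom_of_degree n g \<Longrightarrow> hom_of_degree (m + n) (f * g)"
  using keys_mult[of f g] by (fastforce simp: hom_of_degree_def lookup_add sum.distrib)

lemma hom_of_degree_power: "hom_of_degree m f \<Longrightarrow> hom_of_degree (n * m) (f ^ n)"
  by (induction n) (auto intro: hom_of_degree_mult)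

lemma hom_of_degree_prod:
  "(\<And>i. i \<in> I \<Longrightarrow> hom_of_degree (m i) (f i)) \<Longrightarrow> hom_of_degree (\<Sum>i\<in>I. m i) (\<Prod>i\<in>I. f i)"
  by (induction I rule: infinite_finite_induct) (auto intro: hom_of_degree_mult)

lemma homogeneous_mult: "homogeneous f \<Longrightarrow> homogeneous g \<Longrightarrow> homogeneous (f * g)"
  by (auto simp: homogeneous_iff intro: hom_of_degree_mult)

lemma homogeneous_1 [simp]: "homogeneous 1"
  unfolding homogeneous_iff by (rule exI, rule hom_of_degree_1)

lemma hom_of_degree_scale: "hom_of_degree n f \<Longrightarrow> hom_of_degree n (Poly_Mapping.single 0 c * f)"
  using hom_of_degree_mult[of 0 "Poly_Mapping.single 0 c" n f] by (simp add: hom_of_degree_single)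

text \<open>Composition of \<open>f\<close> with the \<open>G j\<close>. It serves for linear
  coordinate changes and for pulling a form on the dual space back along a combination of gradients,
  whose components need not be forms of one degree.\<close>

definition mpoly_subst :: "('n::finite, 'k::field) mpoly \<Rightarrow> ('n \<Rightarrow> ('n, 'k) mpoly) \<Rightarrow> ('n, 'k) mpoly" where
  "mpoly_subst f G = (\<Sum>\<alpha>\<in>Poly_Mapping.keys f. Poly_Mapping.single 0 (Poly_Mapping.lookup f \<alpha>) *
     (\<Prod>j\<in>UNIV. G j ^ Poly_Mapping.lookup \<alpha> j))"

lemma mpoly_eval_subst: "mpoly_eval (mpoly_subst f G) x = mpoly_eval f (vec_lambda (\<lambda>j. mpoly_eval (G j) x))"
  by (simp add: mpoly_subst_def mpoly_eval_def[of f])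

lemma hom_of_degree_subst:
  assumes "hom_of_degree n f" "\<And>j. hom_of_degree m (G j)"
  shows "hom_of_degree (n * m) (mpoly_subst f G)"
  unfolding mpoly_subst_def
proof (intro hom_of_degree_sum hom_of_degree_scale)
  fix \<alpha> assume "\<alpha> \<in> Poly_Mapping.keys f"
  then have "(\<Sum>j\<in>UNIV. Poly_Mapping.lookup \<alpha> j) = n"
    using assms(1) by (simp add: hom_of_degree_def)
  then show "hom_of_degree (n * m) (\<Prod>j\<in>UNIV. G j ^ Poly_Mapping.lookup \<alpha> j)"
    using hom_of_degree_prod[of UNIV "\<lambda>j. Poly_Mapping.lookup \<alpha> j * m" "\<lambda>j. G j ^ Poly_Mapping.lookup \<alpha> j"]
    by (auto simp: assms(2) hom_of_degree_power simp flip: sum_distrib_right)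
qed

definition coord :: "'n::finite \<Rightarrow> ('n, 'k::field) mpoly" where
  "coord j = Poly_Mapping.single (Poly_Mapping.single j 1) 1"

lemma mpoly_eval_coord [simp]: "mpoly_eval (coord j) x = vec_nth x j"
proof -
  have "(\<Prod>i\<in>UNIV. vec_nth x i ^ Poly_Mapping.lookup (Poly_Mapping.single j 1) i) =
      (\<Prod>i\<in>UNIV. if i = j then vec_nth x j else 1)"
    by (intro prod.cong) (auto simp: lookup_single when_def)
  then show ?thesis
    by (simp add: coord_def)
qed

lemma hom_of_degree_coord: "hom_of_degree 1 (coord j)"
  by (simp add: coord_def hom_of_degree_def lookup_single when_def)

lemma homogeneous_linear_subst:
  fixes P :: "'k::field ^ 'n::finite ^ 'n"
  assumes "homogeneous f"
  obtains g where "homogeneous g" "\<And>x. mpoly_eval g x = mpoly_eval f (P *v x)"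
proof -
  define G where "G i = (\<Sum>j\<in>UNIV. Poly_Mapping.single 0 (vec_nth (vec_nth P i) j) * coord j)" for i
  have "hom_of_degree 1 (G i)" for i
    unfolding G_def by (intro hom_of_degree_sum hom_of_degree_scale hom_of_degree_coord)
  then have "homogeneous (mpoly_subst f G)"
    using assms hom_of_degree_subst[of _ f 1 G] by (fastforce simp: homogeneous_iff)
  moreover have "mpoly_eval (mpoly_subst f G) x = mpoly_eval f (P *v x)" for x
    by (simp add: mpoly_eval_subst G_def matrix_vector_mult_def)
  ultimately show ?thesis
    by (rule that)
qed


section \<open>The Zariski topology and binomial varieties\<close>

lemma topspace_zariski [simp]: "topspace zariski = {x :: 'k::field ^ 'n::finite. x \<noteq> 0}"
proof -
  have "\<exists>f. homogeneous f \<and> mpoly_eval f x \<noteq> 0" for x :: "'k ^ 'n"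
    by (rule exI[of _ 1]) simp
  then show ?thesis
    unfolding zariski_def topology_generated_by_topspace by blast
qed

lemma closedin_zariski_hypersurface:
  assumes "homogeneous f"
  shows "closedin zariski {x. x \<noteq> 0 \<and> mpoly_eval f x = 0}"
proof -
  have "openin zariski {x. x \<noteq> 0 \<and> mpoly_eval f x \<noteq> 0}"
    unfolding zariski_def by (rule topology_generated_by_Basis) (use assms in blast)
  moreover have "topspace zariski - {x. x \<noteq> 0 \<and> mpoly_eval f x = 0} = {x. x \<noteq> 0 \<and> mpoly_eval f x \<noteq> 0}"
    by auto
  ultimately show ?thesis
    by (auto simp: closedin_def)
qed

text \<open>Products of forms take care of finite intersections, so the generating sets are a base
  of the topology and not only a subbase.\<close>

lemma openin_zariski_basis:
  fixes x :: "'k::field ^ 'n::finite"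
  assumes "openin zariski U" "x \<in> U"
  shows "\<exists>f. homogeneous f \<and> mpoly_eval f x \<noteq> 0 \<and> (\<forall>y. y \<noteq> 0 \<and> mpoly_eval f y \<noteq> 0 \<longrightarrow> y \<in> U)"
proof -
  have "generate_topology_on {{x. x \<noteq> 0 \<and> mpoly_eval f x \<noteq> 0} |f. homogeneous f} U"
    using assms(1) unfolding zariski_def openin_topology_generated_by_iff .
  then show ?thesis
    using assms(2)
  proof (induction rule: generate_topology_on.induct)
    case (Int U V)
    then obtain f g where "homogeneous f" "mpoly_eval f x \<noteq> 0" "\<forall>y. y \<noteq> 0 \<and> mpoly_eval f y \<noteq> 0 \<longrightarrow> y \<in> U"
      "homogeneous g" "mpoly_eval g x \<noteq> 0" "\<forall>y. y \<noteq> 0 \<and> mpoly_eval g y \<noteq> 0 \<longrightarrow> y \<in> V"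
      by auto
    then show ?case
      by (intro exI[of _ "f * g"]) (auto simp: homogeneous_mult)
  next
    case (UN K)
    then obtain k where "k \<in> K" "x \<in> k"
      by blast
    then show ?case
      using UN.IH[of k] by blast
  qed auto
qed

definition vanishes_on :: "('n::finite, 'k::field) mpoly \<Rightarrow> ('k ^ 'n) set \<Rightarrow> bool" where
  "vanishes_on f Z \<longleftrightarrow> (\<forall>z\<in>Z. mpoly_eval f z = 0)"

lemma closure_of_zariski:
  fixes S :: "('k::field ^ 'n::finite) set"
  assumes "0 \<notin> S"
  shows "zariski closure_of S = {x. x \<noteq> 0 \<and> (\<forall>f. homogeneous f \<and> vanishes_on f S \<longrightarrow> mpoly_eval f x = 0)}"
proof (intro Set.set_eqI iffI)
  fix x assume x: "x \<in> zariski closure_of S"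
  show "x \<in> {x. x \<noteq> 0 \<and> (\<forall>f. homogeneous f \<and> vanishes_on f S \<longrightarrow> mpoly_eval f x = 0)}"
  proof (intro CollectI conjI allI impI)
    show "x \<noteq> 0"
      using x by (auto simp: in_closure_of)
    fix f assume f: "homogeneous f \<and> vanishes_on f S"
    then have "S \<subseteq> {x. x \<noteq> 0 \<and> mpoly_eval f x = 0}"
      using assms by (auto simp: vanishes_on_def)
    then have "zariski closure_of S \<subseteq> {x. x \<noteq> 0 \<and> mpoly_eval f x = 0}"
      using f by (intro closure_of_minimal closedin_zariski_hypersurface) auto
    then show "mpoly_eval f x = 0"
      using x by blast
  qed
next
  fix x assume x: "x \<in> {x. x \<noteq> 0 \<and> (\<forall>f. homogeneous f \<and> vanishes_on f S \<longrightarrow> mpoly_eval f x = 0)}"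
  show "x \<in> zariski closure_of S"
    unfolding in_closure_of
  proof (intro conjI allI impI)
    fix U assume "x \<in> U \<and> openin zariski U"
    then obtain f where f: "homogeneous f" "mpoly_eval f x \<noteq> 0" "\<forall>y. y \<noteq> 0 \<and> mpoly_eval f y \<noteq> 0 \<longrightarrow> y \<in> U"
      using openin_zariski_basis[of U x] by auto
    then have "\<not> vanishes_on f S"
      using x by blast
    then obtain y where "y \<in> S" "mpoly_eval f y \<noteq> 0"
      by (auto simp: vanishes_on_def)
    then show "\<exists>y. y \<in> S \<and> y \<in> U"
      using f(3) assms by metis
  qed (use x in simp)
qed

lemma closedin_zariski_nonzero: "closedin zariski Z \<Longrightarrow> 0 \<notin> Z"
  using closedin_subset[of zariski Z] by auto

lemma closedin_zariski_iff:
  "closedin zariski Z \<longleftrightarrow> 0 \<notin> Z \<and>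
    (\<forall>x. x \<noteq> 0 \<and> (\<forall>f. homogeneous f \<and> vanishes_on f Z \<longrightarrow> mpoly_eval f x = 0) \<longrightarrow> x \<in> Z)"
proof (cases "0 \<in> Z")
  case False
  then have "closedin zariski Z \<longleftrightarrow> zariski closure_of Z \<subseteq> Z"
    using closure_of_subset_eq[of Z zariski] by auto
  then show ?thesis
    using closure_of_zariski[OF False] False by blast
qed (auto dest: closedin_zariski_nonzero)

text \<open>The zero sets of \<open>f\<close> and \<open>g\<close> inside \<open>Z\<close> decompose
  \<open>Z\<close> when \<open>f * g\<close> vanishes on it. Conversely, a proper closed part
  satisfies an equation that fails somewhere on \<open>Z\<close>, and the product of two such
  equations vanishes on the union of the parts.\<close>

lemma irreducible_closed_zariski_iff:
  fixes X :: "('k::field ^ 'n::finite) set"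
  assumes "closedin zariski X"
  shows "irreducible_closed (subtopology zariski X) Z \<longleftrightarrow>
    closedin zariski Z \<and> Z \<subseteq> X \<and> Z \<noteq> {} \<and>
    (\<forall>f g. homogeneous f \<longrightarrow> homogeneous g \<longrightarrow> vanishes_on (f * g) Z \<longrightarrow> vanishes_on f Z \<or> vanishes_on g Z)"
    (is "_ \<longleftrightarrow> ?C \<and> ?P Z")
proof -
  have "?P Z" if Z: "closedin zariski Z" "Z \<subseteq> X" and irr: "\<forall>F G. closedin zariski F \<and> F \<subseteq> X \<longrightarrow>
    closedin zariski G \<and> G \<subseteq> X \<longrightarrow> Z = F \<union> G \<longrightarrow> Z = F \<or> Z = G" and ne: "Z \<noteq> {}"
  proof (intro conjI allI impI ne Z(2))
    fix f g :: "('n, 'k) mpoly"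
    assume f: "homogeneous f" and g: "homogeneous g" and fg: "vanishes_on (f * g) Z"
    let ?F = "Z \<inter> {x. x \<noteq> 0 \<and> mpoly_eval f x = 0}" and ?G = "Z \<inter> {x. x \<noteq> 0 \<and> mpoly_eval g x = 0}"
    have F: "closedin zariski ?F \<and> ?F \<subseteq> X" and G: "closedin zariski ?G \<and> ?G \<subseteq> X"
      using Z f g by (auto intro!: closedin_Int closedin_zariski_hypersurface)
    have "Z = ?F \<union> ?G"
      using fg closedin_zariski_nonzero[OF Z(1)] by (auto simp: vanishes_on_def)
    then have "Z = ?F \<or> Z = ?G"
      by (rule irr[rule_format, OF F G])
    then show "vanishes_on f Z \<or> vanishes_on g Z"
      by (auto simp: vanishes_on_def)
  qed
  moreover have "Z = F \<or> Z = G"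
    if P: "?P Z" and FG: "closedin zariski F" "closedin zariski G" "Z = F \<union> G" for F G
  proof (rule ccontr)
    assume "\<not> (Z = F \<or> Z = G)"
    then obtain x y where "x \<in> Z" "x \<notin> F" "y \<in> Z" "y \<notin> G"
      using FG(3) by blast
    moreover from this have "x \<noteq> 0" "y \<noteq> 0"
      using FG closedin_zariski_nonzero by blast+
    ultimately obtain f g where "homogeneous f" "vanishes_on f F" "mpoly_eval f x \<noteq> 0"
      "homogeneous g" "vanishes_on g G" "mpoly_eval g y \<noteq> 0"
      using FG(1,2) unfolding closedin_zariski_iff by meson
    moreover from this have "vanishes_on (f * g) Z"
      by (auto simp: vanishes_on_def FG(3))
    ultimately have "vanishes_on f Z \<or> vanishes_on g Z"
      using P by blast
    then show False
      using \<open>x \<in> Z\<close> \<open>y \<in> Z\<close> \<open>mpoly_eval f x \<noteq> 0\<close> \<open>mpoly_eval g y \<noteq> 0\<close> by (auto simp: vanishes_on_def)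
  qed
  ultimately have *: "Z \<noteq> {} \<and> (\<forall>F G. closedin zariski F \<and> F \<subseteq> X \<longrightarrow>
      closedin zariski G \<and> G \<subseteq> X \<longrightarrow> Z = F \<union> G \<longrightarrow> Z = F \<or> Z = G) \<longleftrightarrow> ?P Z"
    if "closedin zariski Z" "Z \<subseteq> X"
    using that by (intro iffI) metis+
  show ?thesis
    unfolding irreducible_closed_def closedin_closed_subtopology[OF assms] using * by argo
qed

section \<open>Binomial varieties attached to relation lattices\<close>

definition rel :: "('n::finite \<Rightarrow> int) set \<Rightarrow> ('n \<Rightarrow> int) set" where
  "rel V = {u. \<forall>v\<in>V. (\<Sum>j\<in>UNIV. u j * v j) = 0}"

definition xpow :: "('n::finite \<Rightarrow> nat) \<Rightarrow> 'k::field ^ 'n \<Rightarrow> 'k" where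
  "xpow e x = (\<Prod>j\<in>UNIV. vec_nth x j ^ e j)"

definition binomial_variety :: "('n::finite \<Rightarrow> int) set \<Rightarrow> ('k::field ^ 'n) set" where
  "binomial_variety R = {x. x \<noteq> 0 \<and> (\<forall>u\<in>R. xpow (\<lambda>j. nat (u j)) x = xpow (\<lambda>j. nat (- u j)) x)}"

definition binomial_torus :: "('n::finite \<Rightarrow> int) set \<Rightarrow> ('k::field ^ 'n) set" where
  "binomial_torus R = {x. (\<forall>j. vec_nth x j \<noteq> 0) \<and> (\<forall>u\<in>R. xpow (\<lambda>j. nat (u j)) x = xpow (\<lambda>j. nat (- u j)) x)}"

lemma mpoly_eval_xpow: "mpoly_eval f x = (\<Sum>\<alpha>\<in>Poly_Mapping.keys f. Poly_Mapping.lookup f \<alpha> * xpow (Poly_Mapping.lookup \<alpha>) x)"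
  by (simp add: mpoly_eval_def xpow_def)

lemma mpoly_eval_monomial_of [simp]: "mpoly_eval (monomial_of e) x = xpow e x"
  by (simp add: monomial_of_def xpow_def)

lemma xpow_add: "xpow (\<lambda>j. e j + e' j) x = xpow e x * xpow e' x"
  by (simp add: xpow_def power_add prod.distrib)

lemma xpow_nonzero: "(\<And>j. vec_nth x j \<noteq> 0) \<Longrightarrow> xpow e x \<noteq> 0"
  by (simp add: xpow_def)

text \<open>The polynomials that vanish at a fixed point form an ideal, so the generating binomials
  decide.\<close>

lemma toric_variety_eq:
  fixes a :: "'n::finite \<Rightarrow> int vec"
  shows "(toric_variety m a :: ('k::field ^ 'n) set) = binomial_variety (int_relations m a)"
proof -
  let ?B = "{monomial_of (\<lambda>j. nat (u j)) - monomial_of (\<lambda>j. nat (- u j)) |u. u \<in> int_relations m a} :: ('n, 'k) mpoly set"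
  interpret ring: Modules.module "(*) :: ('n, 'k) mpoly \<Rightarrow> _"
    by unfold_locales (auto simp: algebra_simps)
  have "(\<forall>f\<in>toric_ideal m a. mpoly_eval f x = 0) \<longleftrightarrow>
      (\<forall>u\<in>int_relations m a. xpow (\<lambda>j. nat (u j)) x = xpow (\<lambda>j. nat (- u j)) x)" for x :: "'k ^ 'n"
  proof
    assume *: "\<forall>f\<in>toric_ideal m a. mpoly_eval f x = 0"
    show "\<forall>u\<in>int_relations m a. xpow (\<lambda>j. nat (u j)) x = xpow (\<lambda>j. nat (- u j)) x"
    proof
      fix u assume "u \<in> int_relations m a"
      then have "monomial_of (\<lambda>j. nat (u j)) - monomial_of (\<lambda>j. nat (- u j)) \<in> (toric_ideal m a :: ('n, 'k) mpoly set)"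
        unfolding toric_ideal_def mpoly_ideal_def by (intro ring.span_base) blast
      then have "mpoly_eval (monomial_of (\<lambda>j. nat (u j)) - monomial_of (\<lambda>j. nat (- u j))) x = 0"
        using * by blast
      then show "xpow (\<lambda>j. nat (u j)) x = xpow (\<lambda>j. nat (- u j)) x"
        by simp
    qed
  next
    assume *: "\<forall>u\<in>int_relations m a. xpow (\<lambda>j. nat (u j)) x = xpow (\<lambda>j. nat (- u j)) x"
    have "ring.subspace {f. mpoly_eval f x = 0}"
      by (simp add: ring.subspace_def)
    moreover have "?B \<subseteq> {f. mpoly_eval f x = 0}"
      using * by auto
    ultimately show "\<forall>f\<in>toric_ideal m a. mpoly_eval f x = 0"
      unfolding toric_ideal_def mpoly_ideal_def using ring.span_minimal[of ?B] by blast
  qed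
  then show ?thesis
    by (simp add: toric_variety_def binomial_variety_def)
qed

lemma int_relations_eq: "int_relations m a = rel ((\<lambda>r j. a j $ r) ` {..<m})"
  by (auto simp: int_relations_def rel_def)

text \<open>Both monomials contain the factor with exponents \<open>min (p j) (q j)\<close>, and the
  cofactors are the two sides of the binomial of \<open>p - q\<close>. Nothing is divided, so points
  with zero coordinates are covered.\<close>

lemma xpow_eq_of_rel:
  assumes "\<And>u. u \<in> R \<Longrightarrow> xpow (\<lambda>j. nat (u j)) x = xpow (\<lambda>j. nat (- u j)) x"
    and "(\<lambda>j. int (p j) - int (q j)) \<in> R"
  shows "xpow p x = xpow q x"
proof -
  let ?u = "\<lambda>j. int (p j) - int (q j)"
  have p: "p = (\<lambda>j. min (p j) (q j) + nat (?u j))" and q: "q = (\<lambda>j. min (p j) (q j) + nat (- ?u j))"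
    by auto
  have "xpow p x = xpow (\<lambda>j. min (p j) (q j)) x * xpow (\<lambda>j. nat (?u j)) x"
    using arg_cong[OF p, of "\<lambda>e. xpow e x"] by (simp only: xpow_add)
  moreover have "xpow q x = xpow (\<lambda>j. min (p j) (q j)) x * xpow (\<lambda>j. nat (- ?u j)) x"
    using arg_cong[OF q, of "\<lambda>e. xpow e x"] by (simp only: xpow_add)
  ultimately show ?thesis
    using assms(1)[OF assms(2)] by simp
qed

lemma xpow_eq_variety:
  "x \<in> binomial_variety R \<Longrightarrow> (\<lambda>j. int (p j) - int (q j)) \<in> R \<Longrightarrow> xpow p x = xpow q x"
  by (rule xpow_eq_of_rel[of R]) (auto simp: binomial_variety_def)

lemma torus_subset_variety: "binomial_torus R \<subseteq> binomial_variety R"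
  by (auto simp: binomial_torus_def binomial_variety_def vec_eq_iff)

lemma homogeneous_binomial:
  assumes "(\<Sum>j\<in>UNIV. u j) = 0"
  shows "homogeneous (monomial_of (\<lambda>j. nat (u j)) - monomial_of (\<lambda>j. nat (- u j)))"
proof -
  have "(\<Sum>j\<in>UNIV. int (nat (u j)) - int (nat (- u j))) = 0"
    using assms by (intro trans[OF sum.cong assms]) auto
  then have "int (\<Sum>j\<in>UNIV. nat (u j)) = int (\<Sum>j\<in>UNIV. nat (- u j))"
    by (simp add: sum_subtractf)
  then have eq: "(\<Sum>j\<in>UNIV. nat (u j)) = (\<Sum>j\<in>UNIV. nat (- u j))"
    by (simp only: of_nat_eq_iff)
  have "hom_of_degree (\<Sum>j\<in>UNIV. nat (u j)) (monomial_of (\<lambda>j. nat (u j)))"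
    by (auto simp: monomial_of_def intro!: hom_of_degree_single)
  moreover have "hom_of_degree (\<Sum>j\<in>UNIV. nat (u j)) (- monomial_of (\<lambda>j. nat (- u j)))"
    unfolding eq monomial_of_def single_uminus[symmetric] by (auto intro!: hom_of_degree_single)
  ultimately show ?thesis
    unfolding homogeneous_iff diff_conv_add_uminus by (blast intro: hom_of_degree_add)
qed

lemma closedin_binomial_variety:
  fixes R :: "('n::finite \<Rightarrow> int) set"
  assumes "\<And>u. u \<in> R \<Longrightarrow> (\<Sum>j\<in>UNIV. u j) = 0"
  shows "closedin zariski (binomial_variety R :: ('k::field ^ 'n) set)"
proof -
  have "x \<in> binomial_variety R" if x: "x \<noteq> 0"
    "\<forall>f. homogeneous f \<and> vanishes_on f (binomial_variety R) \<longrightarrow> mpoly_eval f x = 0" for x :: "'k ^ 'n"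
    unfolding binomial_variety_def
  proof (intro CollectI conjI x(1) ballI)
    fix u assume u: "u \<in> R"
    let ?f = "monomial_of (\<lambda>j. nat (u j)) - monomial_of (\<lambda>j. nat (- u j)) :: ('n, 'k) mpoly"
    have "vanishes_on ?f (binomial_variety R)"
      using u by (auto simp: vanishes_on_def binomial_variety_def)
    then have "mpoly_eval ?f x = 0"
      using x(2) homogeneous_binomial[OF assms[OF u]] by blast
    then show "xpow (\<lambda>j. nat (u j)) x = xpow (\<lambda>j. nat (- u j)) x"
      by simp
  qed
  then show ?thesis
    by (auto simp: closedin_zariski_iff binomial_variety_def)
qed


section \<open>Density of the torus and irreducibility\<close>

text \<open>If \<open>g i\<close> is nonzero, \<open>int N * g i\<close> has absolute value at least
  \<open>N\<close>, and \<open>N\<close> is taken larger than every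
  \<open>\<bar>f i\<bar>\<close>.\<close>

lemma eventually_nonzero_combination:
  fixes f g :: "'i \<Rightarrow> int"
  assumes "finite I"
  obtains N0 :: nat where "\<And>N i. N \<ge> N0 \<Longrightarrow> i \<in> I \<Longrightarrow> f i \<noteq> 0 \<or> g i \<noteq> 0 \<Longrightarrow> f i + int N * g i \<noteq> 0"
proof
  fix N i assume N: "N \<ge> nat (1 + (\<Sum>i\<in>I. \<bar>f i\<bar>))" and i: "i \<in> I" and fg: "f i \<noteq> 0 \<or> g i \<noteq> 0"
  have "\<bar>f i\<bar> \<le> (\<Sum>i\<in>I. \<bar>f i\<bar>)"
    using assms i by (intro member_le_sum) auto
  with N have lt: "\<bar>f i\<bar> < int N"
    by linarith
  show "f i + int N * g i \<noteq> 0"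
  proof
    assume 0: "f i + int N * g i = 0"
    with fg have "g i \<noteq> 0"
      by auto
    then have "int N * 1 \<le> int N * \<bar>g i\<bar>"
      by (intro mult_left_mono) auto
    moreover have "\<bar>f i\<bar> = int N * \<bar>g i\<bar>"
      using 0 by (metis abs_minus_cancel abs_mult abs_of_nat add_eq_0_iff)
    ultimately show False
      using lt by linarith
  qed
qed

text \<open>A lattice is not a finite union of proper hyperplane sections: a large multiple of a
  vector good for the new functional is added without spoiling the earlier ones. It is used for
  generic weights and for a relation with no zero entry.\<close>

lemma common_nonzero:
  fixes \<phi> :: "'i \<Rightarrow> 'v \<Rightarrow> int"
  assumes "finite I" "L \<noteq> {}"
    and nz: "\<And>i. i \<in> I \<Longrightarrow> \<exists>t\<in>L. \<phi> i t \<noteq> 0"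
    and comb: "\<And>t t' N. t \<in> L \<Longrightarrow> t' \<in> L \<Longrightarrow> \<exists>t''\<in>L. \<forall>i\<in>I. \<phi> i t'' = \<phi> i t + int N * \<phi> i t'"
  shows "\<exists>t\<in>L. \<forall>i\<in>I. \<phi> i t \<noteq> 0"
proof -
  have "\<exists>t\<in>L. \<forall>i\<in>J. \<phi> i t \<noteq> 0" if "J \<subseteq> I" for J
    using finite_subset[OF that assms(1)] that
  proof (induction J rule: finite_induct)
    case (insert i J)
    then obtain t t' where t: "t \<in> L" "\<forall>i\<in>J. \<phi> i t \<noteq> 0" "t' \<in> L" "\<phi> i t' \<noteq> 0"
      using nz[of i] by auto
    obtain N0 where N0: "\<And>N k. N \<ge> N0 \<Longrightarrow> k \<in> insert i J \<Longrightarrow> \<phi> k t \<noteq> 0 \<or> \<phi> k t' \<noteq> 0 \<Longrightarrow> \<phi> k t + int N * \<phi> k t' \<noteq> 0"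
      using eventually_nonzero_combination[of "insert i J" "\<lambda>k. \<phi> k t" "\<lambda>k. \<phi> k t'"] insert.hyps(1) by blast
    obtain t'' where "t'' \<in> L" "\<forall>k\<in>I. \<phi> k t'' = \<phi> k t + int N0 * \<phi> k t'"
      using comb[OF t(1,3)] by blast
    moreover from this have "\<forall>k\<in>insert i J. \<phi> k t'' \<noteq> 0"
      using N0[of N0] t insert.prems by auto
    ultimately show ?case
      by blast
  qed (use assms(2) in auto)
  then show ?thesis
    by blast
qed

text \<open>A one-parameter subgroup of the torus that is nontrivial on finitely many given
  characters. Weights are sought in the orthogonal complement \<open>L\<close> of
  \<open>rel V\<close>. It contains \<open>V\<close>, so each element of \<open>E\<close> pairs
  nontrivially with some member, and it contains the all-ones vector by homogeneity.\<close>

lemma generic_weight: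
  fixes V :: "('n::finite \<Rightarrow> int) set"
  assumes hom: "\<And>u. u \<in> rel V \<Longrightarrow> (\<Sum>j\<in>UNIV. u j) = 0"
    and E: "finite E" "E \<inter> rel V = {}"
  obtains e :: "'n \<Rightarrow> nat" where "\<forall>u\<in>rel V. (\<Sum>j\<in>UNIV. u j * int (e j)) = 0"
    "\<forall>u\<in>E. (\<Sum>j\<in>UNIV. u j * int (e j)) \<noteq> 0"
proof -
  define L where "L = {e. \<forall>u\<in>rel V. (\<Sum>j\<in>UNIV. u j * e j) = (0::int)}"
  have comb: "\<exists>t''\<in>L. \<forall>i\<in>E. (\<Sum>j\<in>UNIV. i j * t'' j) = (\<Sum>j\<in>UNIV. i j * t j) + int N * (\<Sum>j\<in>UNIV. i j * t' j)"
    if "t \<in> L" "t' \<in> L" for t t' N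
  proof (rule bexI[where x = "\<lambda>j. t j + int N * t' j"])
    have *: "(\<Sum>j\<in>UNIV. i j * (t j + int N * t' j)) = (\<Sum>j\<in>UNIV. i j * t j) + int N * (\<Sum>j\<in>UNIV. i j * t' j)" for i :: "'n \<Rightarrow> int"
      by (simp add: distrib_left sum.distrib sum_distrib_left mult_ac)
    then show "\<forall>i\<in>E. (\<Sum>j\<in>UNIV. i j * (t j + int N * t' j)) = (\<Sum>j\<in>UNIV. i j * t j) + int N * (\<Sum>j\<in>UNIV. i j * t' j)"
      by blast
    show "(\<lambda>j. t j + int N * t' j) \<in> L"
      using that by (simp add: L_def *)
  qed
  have 1: "(\<lambda>_. 1) \<in> L"
    using hom by (simp add: L_def)
  have "\<exists>t\<in>L. \<forall>i\<in>E. (\<Sum>j\<in>UNIV. i j * t j) \<noteq> 0"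
  proof (rule common_nonzero[OF E(1) _ _ comb])
    show "\<exists>t\<in>L. (\<Sum>j\<in>UNIV. i j * t j) \<noteq> 0" if "i \<in> E" for i
    proof -
      have "i \<notin> rel V"
        using that E(2) by blast
      then obtain v where v: "v \<in> V" "(\<Sum>j\<in>UNIV. i j * v j) \<noteq> 0"
        by (auto simp: rel_def)
      then have "v \<in> L"
        by (auto simp: L_def rel_def)
      with v(2) show ?thesis
        by blast
    qed
  qed (use 1 in auto)
  then obtain t where t: "t \<in> L" "\<forall>i\<in>E. (\<Sum>j\<in>UNIV. i j * t j) \<noteq> 0"
    by blast
  obtain N0 where N0: "\<And>N u. N \<ge> N0 \<Longrightarrow> u \<in> E \<Longrightarrow> (\<Sum>j\<in>UNIV. u j * t j) \<noteq> 0 \<or> (\<Sum>j\<in>UNIV. u j) \<noteq> 0 \<Longrightarrow>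
      (\<Sum>j\<in>UNIV. u j * t j) + int N * (\<Sum>j\<in>UNIV. u j) \<noteq> 0"
    using eventually_nonzero_combination[OF E(1), of "\<lambda>u. (\<Sum>j\<in>UNIV. u j * t j)" "\<lambda>u. (\<Sum>j\<in>UNIV. u j)"] by blast
  \<comment> \<open>The first summand keeps the pairings with \<open>E\<close> nonzero, the second
    makes all exponents nonnegative.\<close>
  define N where "N = N0 + nat (\<Sum>j\<in>UNIV. \<bar>t j\<bar>)"
  have nonneg: "t j + int N \<ge> 0" for j
  proof -
    have "\<bar>t j\<bar> \<le> (\<Sum>j\<in>UNIV. \<bar>t j\<bar>)"
      by (intro member_le_sum) auto
    then show ?thesis
      unfolding N_def by linarith
  qed
  have eq: "(\<Sum>j\<in>UNIV. u j * int (nat (t j + int N))) = (\<Sum>j\<in>UNIV. u j * t j) + int N * (\<Sum>j\<in>UNIV. u j)" for u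
    using nonneg by (simp add: distrib_left sum.distrib sum_distrib_left mult_ac)
  show ?thesis
  proof (rule that[of "\<lambda>j. nat (t j + int N)"])
    show "\<forall>u\<in>rel V. (\<Sum>j\<in>UNIV. u j * int (nat (t j + int N))) = 0"
      unfolding eq using t(1) hom by (simp add: L_def)
    show "\<forall>u\<in>E. (\<Sum>j\<in>UNIV. u j * int (nat (t j + int N))) \<noteq> 0"
      unfolding eq using N0[of N] t(2) by (auto simp: N_def)
  qed
qed

definition curve :: "('n::finite \<Rightarrow> nat) \<Rightarrow> 'k::field \<Rightarrow> 'k ^ 'n" where
  "curve e s = vec_lambda (\<lambda>j. s ^ e j)"

definition weight :: "('n::finite \<Rightarrow> nat) \<Rightarrow> ('n \<Rightarrow>\<^sub>0 nat) \<Rightarrow> nat" where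
  "weight e \<alpha> = (\<Sum>j\<in>UNIV. Poly_Mapping.lookup \<alpha> j * e j)"

definition curve_poly :: "('n::finite \<Rightarrow> nat) \<Rightarrow> ('n, 'k::field) mpoly \<Rightarrow> 'k poly" where
  "curve_poly e f = (\<Sum>\<alpha>\<in>Poly_Mapping.keys f. Polynomial.monom (Poly_Mapping.lookup f \<alpha>) (weight e \<alpha>))"

lemma xpow_curve: "xpow p (curve e s) = s ^ (\<Sum>j\<in>UNIV. p j * e j)"
  by (simp add: xpow_def curve_def power_sum mult.commute flip: power_mult)

lemma poly_curve_poly: "poly (curve_poly e f) s = mpoly_eval f (curve e s)"
  by (simp add: curve_poly_def poly_sum poly_monom mpoly_eval_xpow xpow_curve weight_def)

lemma curve_in_torus:
  assumes "\<And>u. u \<in> R \<Longrightarrow> (\<Sum>j\<in>UNIV. u j * int (e j)) = 0" "s \<noteq> 0"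
  shows "curve e s \<in> binomial_torus R"
  unfolding binomial_torus_def
proof (intro CollectI conjI allI ballI)
  fix u assume "u \<in> R"
  then have "(\<Sum>j\<in>UNIV. u j * int (e j)) = 0"
    by (rule assms(1))
  moreover have "(\<Sum>j\<in>UNIV. u j * int (e j)) = (\<Sum>j\<in>UNIV. int (nat (u j) * e j) - int (nat (- u j) * e j))"
  proof (intro sum.cong refl)
    show "u j * int (e j) = int (nat (u j) * e j) - int (nat (- u j) * e j)" for j
      by (cases "u j \<ge> 0") auto
  qed
  ultimately have "int (\<Sum>j\<in>UNIV. nat (u j) * e j) = int (\<Sum>j\<in>UNIV. nat (- u j) * e j)"
    by (simp add: sum_subtractf)
  then have "(\<Sum>j\<in>UNIV. nat (u j) * e j) = (\<Sum>j\<in>UNIV. nat (- u j) * e j)"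
    by (simp only: of_nat_eq_iff)
  then show "xpow (\<lambda>j. nat (u j)) (curve e s) = xpow (\<lambda>j. nat (- u j)) (curve e s)"
    by (simp add: xpow_curve)
qed (use assms(2) in \<open>simp add: curve_def\<close>)

definition exp_diff :: "('n \<Rightarrow>\<^sub>0 nat) \<Rightarrow> ('n \<Rightarrow>\<^sub>0 nat) \<Rightarrow> 'n \<Rightarrow> int" where
  "exp_diff \<alpha> \<beta> = (\<lambda>j. int (Poly_Mapping.lookup \<alpha> j) - int (Poly_Mapping.lookup \<beta> j))"

lemma sum_exp_diff_weight:
  "(\<Sum>j\<in>UNIV. exp_diff \<alpha> \<beta> j * int (e j)) = int (weight e \<alpha>) - int (weight e \<beta>)"
  by (simp add: exp_diff_def weight_def left_diff_distrib sum_subtractf)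

text \<open>The coefficient of \<open>curve_poly e f\<close> at \<open>k\<close> collects the
  coefficients of \<open>f\<close> at the monomials of weight \<open>k\<close>, and
  \<open>\<psi>\<close> is constant on those. With \<open>\<psi>\<close> the evaluation of monomials
  at a point this yields density of the torus, with \<open>\<psi>\<close> a directional derivative
  it yields the tangent spaces.\<close>

lemma class_sum_zero:
  fixes f :: "('n::finite, 'k::field) mpoly"
  assumes "curve_poly e f = 0"
    and sep: "\<And>\<alpha> \<beta>. \<alpha> \<in> Poly_Mapping.keys f \<Longrightarrow> \<beta> \<in> Poly_Mapping.keys f \<Longrightarrow> weight e \<alpha> = weight e \<beta> \<Longrightarrow> \<psi> \<alpha> = \<psi> \<beta>"
  shows "(\<Sum>\<alpha>\<in>Poly_Mapping.keys f. Poly_Mapping.lookup f \<alpha> * \<psi> \<alpha>) = 0"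
proof -
  let ?K = "Poly_Mapping.keys f"
  have "(\<Sum>\<alpha>\<in>{\<alpha>\<in>?K. weight e \<alpha> = k}. Poly_Mapping.lookup f \<alpha> * \<psi> \<alpha>) = 0" if k: "k \<in> weight e ` ?K" for k
  proof -
    obtain \<beta> where \<beta>: "\<beta> \<in> ?K" "weight e \<beta> = k"
      using k by blast
    have "coeff (curve_poly e f) k = (\<Sum>\<alpha>\<in>?K. if weight e \<alpha> = k then Poly_Mapping.lookup f \<alpha> else 0)"
      unfolding curve_poly_def coeff_sum by (intro sum.cong) auto
    also have "\<dots> = (\<Sum>\<alpha>\<in>{\<alpha>\<in>?K. weight e \<alpha> = k}. Poly_Mapping.lookup f \<alpha>)"
      by (simp add: sum.inter_filter)
    finally have "(\<Sum>\<alpha>\<in>{\<alpha>\<in>?K. weight e \<alpha> = k}. Poly_Mapping.lookup f \<alpha>) = 0"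
      using assms(1) by simp
    moreover have "(\<Sum>\<alpha>\<in>{\<alpha>\<in>?K. weight e \<alpha> = k}. Poly_Mapping.lookup f \<alpha> * \<psi> \<alpha>) =
        (\<Sum>\<alpha>\<in>{\<alpha>\<in>?K. weight e \<alpha> = k}. Poly_Mapping.lookup f \<alpha> * \<psi> \<beta>)"
    proof (intro sum.cong refl)
      fix \<alpha> assume "\<alpha> \<in> {\<alpha>\<in>?K. weight e \<alpha> = k}"
      then have "\<psi> \<alpha> = \<psi> \<beta>"
        using sep[of \<alpha> \<beta>] \<beta> by simp
      then show "Poly_Mapping.lookup f \<alpha> * \<psi> \<alpha> = Poly_Mapping.lookup f \<alpha> * \<psi> \<beta>"
        by simp
    qed
    ultimately show ?thesis
      by (simp flip: sum_distrib_right)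
  qed
  then have "(\<Sum>k\<in>weight e ` ?K. \<Sum>\<alpha>\<in>{\<alpha>\<in>?K. weight e \<alpha> = k}. Poly_Mapping.lookup f \<alpha> * \<psi> \<alpha>) = 0"
    by (intro sum.neutral) blast
  then show ?thesis
    using sum.image_gen[of ?K "\<lambda>\<alpha>. Poly_Mapping.lookup f \<alpha> * \<psi> \<alpha>" "weight e"] by simp
qed

lemma poly_eq_0_of_nonzero_args:
  fixes p :: "'k::field_char_0 poly"
  assumes "\<And>s. s \<noteq> 0 \<Longrightarrow> poly p s = 0"
  shows "p = 0"
proof (rule ccontr)
  assume "p \<noteq> 0"
  then have "finite (insert 0 {s. poly p s = 0})"
    by (simp add: poly_roots_finite)
  moreover have "insert 0 {s. poly p s = 0} = UNIV"
    using assms by auto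
  ultimately show False
    using infinite_UNIV_char_0[where 'a = 'k] by simp
qed

lemma one_in_torus: "(vec_lambda (\<lambda>_. 1) :: 'k::field ^ 'n::finite) \<in> binomial_torus R"
  by (simp add: binomial_torus_def xpow_def)

section \<open>Vanishing and irreducibility for homogeneous relations\<close>

locale projective_rel =
  fixes V :: "('n::finite \<Rightarrow> int) set"
  assumes sum_rel: "u \<in> rel V \<Longrightarrow> (\<Sum>j\<in>UNIV. u j) = 0"
begin

lemma separating_weight:
  assumes "finite E"
  obtains e :: "'n \<Rightarrow> nat" where "\<forall>u\<in>rel V. (\<Sum>j\<in>UNIV. u j * int (e j)) = 0"
    "\<forall>\<alpha>\<in>E. \<forall>\<beta>\<in>E. weight e \<alpha> = weight e \<beta> \<longrightarrow> exp_diff \<alpha> \<beta> \<in> rel V"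
proof -
  let ?D = "(\<lambda>(\<alpha>, \<beta>). exp_diff \<alpha> \<beta>) ` (E \<times> E) - rel V"
  have D: "finite ?D" "?D \<inter> rel V = {}"
    using assms by auto
  obtain e :: "'n \<Rightarrow> nat" where e: "\<forall>u\<in>rel V. (\<Sum>j\<in>UNIV. u j * int (e j)) = 0"
    "\<forall>u\<in>?D. (\<Sum>j\<in>UNIV. u j * int (e j)) \<noteq> 0"
    by (rule generic_weight[OF sum_rel D])
  show ?thesis
  proof (rule that[of e])
    show "\<forall>\<alpha>\<in>E. \<forall>\<beta>\<in>E. weight e \<alpha> = weight e \<beta> \<longrightarrow> exp_diff \<alpha> \<beta> \<in> rel V"
    proof (intro ballI impI, rule ccontr)
      fix \<alpha> \<beta> assume *: "\<alpha> \<in> E" "\<beta> \<in> E" "weight e \<alpha> = weight e \<beta>" "exp_diff \<alpha> \<beta> \<notin> rel V"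
      then have "exp_diff \<alpha> \<beta> \<in> ?D"
        by blast
      then have "(\<Sum>j\<in>UNIV. exp_diff \<alpha> \<beta> j * int (e j)) \<noteq> 0"
        by (rule e(2)[rule_format])
      then show False
        using * by (simp add: sum_exp_diff_weight)
    qed
  qed (rule e(1))
qed

lemma class_sum_zero_of_torus:
  fixes f :: "('n, 'k::field_char_0) mpoly"
  assumes "vanishes_on f (binomial_torus (rel V))"
    and \<psi>: "\<And>\<alpha> \<beta>. exp_diff \<alpha> \<beta> \<in> rel V \<Longrightarrow> \<psi> \<alpha> = \<psi> \<beta>"
  shows "(\<Sum>\<alpha>\<in>Poly_Mapping.keys f. Poly_Mapping.lookup f \<alpha> * \<psi> \<alpha>) = 0"
proof -
  obtain e :: "'n \<Rightarrow> nat" where e: "\<forall>u\<in>rel V. (\<Sum>j\<in>UNIV. u j * int (e j)) = 0"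
    "\<forall>\<alpha>\<in>Poly_Mapping.keys f. \<forall>\<beta>\<in>Poly_Mapping.keys f. weight e \<alpha> = weight e \<beta> \<longrightarrow> exp_diff \<alpha> \<beta> \<in> rel V"
    by (rule separating_weight[OF finite_keys[of f]])
  show ?thesis
  proof (rule class_sum_zero)
    show "curve_poly e f = 0"
      using assms(1) curve_in_torus[OF e(1)[rule_format]]
      by (intro poly_eq_0_of_nonzero_args) (auto simp: poly_curve_poly vanishes_on_def)
  qed (use \<psi> e(2) in blast)
qed

lemma vanishes_on_variety:
  fixes f :: "('n, 'k::field_char_0) mpoly"
  assumes "vanishes_on f (binomial_torus (rel V))"
  shows "vanishes_on f (binomial_variety (rel V))"
  unfolding vanishes_on_def mpoly_eval_xpow
  by (intro ballI class_sum_zero_of_torus[OF assms]; erule xpow_eq_variety) (simp add: exp_diff_def)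

text \<open>One weight separates the monomial classes of \<open>f\<close> and \<open>g\<close>
  simultaneously. Along its curve the product becomes a product of univariate polynomials, one of
  which must be 0, and then the class sums of that factor vanish.\<close>

lemma variety_prime:
  fixes f g :: "('n, 'k::field_char_0) mpoly"
  assumes fg: "vanishes_on (f * g) (binomial_variety (rel V))"
  shows "vanishes_on f (binomial_variety (rel V)) \<or> vanishes_on g (binomial_variety (rel V))"
proof -
  let ?E = "Poly_Mapping.keys f \<union> Poly_Mapping.keys g"
  have "finite ?E"
    by simp
  then obtain e :: "'n \<Rightarrow> nat" where e: "\<forall>u\<in>rel V. (\<Sum>j\<in>UNIV. u j * int (e j)) = 0"
    "\<forall>\<alpha>\<in>?E. \<forall>\<beta>\<in>?E. weight e \<alpha> = weight e \<beta> \<longrightarrow> exp_diff \<alpha> \<beta> \<in> rel V"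
    by (rule separating_weight)
  have vanish: "vanishes_on h (binomial_variety (rel V))"
    if "curve_poly e h = 0" "Poly_Mapping.keys h \<subseteq> ?E" for h :: "('n, 'k) mpoly"
    unfolding vanishes_on_def mpoly_eval_xpow
  proof
    fix x :: "'k ^ 'n" assume x: "x \<in> binomial_variety (rel V)"
    show "(\<Sum>\<alpha>\<in>Poly_Mapping.keys h. Poly_Mapping.lookup h \<alpha> * xpow (Poly_Mapping.lookup \<alpha>) x) = 0"
    proof (rule class_sum_zero[OF that(1)])
      fix \<alpha> \<beta> assume "\<alpha> \<in> Poly_Mapping.keys h" "\<beta> \<in> Poly_Mapping.keys h" "weight e \<alpha> = weight e \<beta>"
      then have "exp_diff \<alpha> \<beta> \<in> rel V"
        using e(2) that(2) by blast
      then show "xpow (Poly_Mapping.lookup \<alpha>) x = xpow (Poly_Mapping.lookup \<beta>) x"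
        using xpow_eq_variety[OF x] by (simp add: exp_diff_def)
    qed
  qed
  have "curve_poly e f * curve_poly e g = 0"
  proof (rule poly_eq_0_of_nonzero_args)
    fix s :: 'k assume "s \<noteq> 0"
    then have "curve e s \<in> binomial_variety (rel V)"
      using curve_in_torus[OF e(1)[rule_format]] torus_subset_variety by blast
    then show "poly (curve_poly e f * curve_poly e g) s = 0"
      using fg by (auto simp: poly_curve_poly vanishes_on_def)
  qed
  then show ?thesis
    using vanish[of f] vanish[of g] by auto
qed

lemma closedin_variety: "closedin zariski (binomial_variety (rel V) :: ('k::field ^ 'n) set)"
  using sum_rel by (rule closedin_binomial_variety)

lemma irreducible_variety:
  assumes "closedin zariski X" "binomial_variety (rel V) \<subseteq> X"
  shows "irreducible_closed (subtopology zariski X) (binomial_variety (rel V) :: ('k::field_char_0 ^ 'n) set)"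
proof -
  have "binomial_variety (rel V) \<noteq> ({} :: ('k ^ 'n) set)"
    using one_in_torus torus_subset_variety by blast
  then show ?thesis
    unfolding irreducible_closed_zariski_iff[OF assms(1)]
    using closedin_variety assms(2) variety_prime by (intro conjI allI impI)
qed

end


section \<open>Echelon form of the relations\<close>

lemma rel_diff: "u \<in> rel V \<Longrightarrow> u' \<in> rel V \<Longrightarrow> (\<lambda>j. u j - u' j) \<in> rel V"
  by (simp add: rel_def left_diff_distrib sum_subtractf)

lemma rel_scale: "u \<in> rel V \<Longrightarrow> (\<lambda>j. c * u j) \<in> rel V"
  by (simp add: rel_def mult.assoc flip: sum_distrib_left)

lemma rel_sum: "(\<And>i. i \<in> I \<Longrightarrow> u i \<in> rel V) \<Longrightarrow> (\<lambda>j. \<Sum>i\<in>I. u i j) \<in> rel V"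
  unfolding rel_def by (simp add: sum_distrib_right sum.swap[of _ I])

lemma rel_scale_cancel: "(\<lambda>j. c * u j) \<in> rel V \<Longrightarrow> c \<noteq> 0 \<Longrightarrow> u \<in> rel V"
  by (simp add: rel_def mult.assoc flip: sum_distrib_left)

lemma rel_antimono: "V \<subseteq> V' \<Longrightarrow> rel V' \<subseteq> rel V"
  by (auto simp: rel_def)

lemma binomial_variety_antimono: "R \<subseteq> R' \<Longrightarrow> binomial_variety R' \<subseteq> binomial_variety R"
  by (auto simp: binomial_variety_def)

text \<open>Rows from 1 on are \<open>N\<close> times unit vectors at the pivots
  \<open>b l'\<close>, and they all vanish at the pivot \<open>b 0\<close>. Row 0 is the all-ones
  vector instead of a pivot row, so that every initial segment of rows again defines a projective
  variety; these form the chain for the lower dimension bound.\<close>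

locale echelon_rel =
  fixes R :: "('n::finite \<Rightarrow> int) set" and w :: "nat \<Rightarrow> 'n \<Rightarrow> int" and b :: "nat \<Rightarrow> 'n" and r :: nat and N :: int
  assumes r: "r \<ge> 1" and N: "N > 0" and R: "R = rel (w ` {..<r})"
    and w0: "w 0 = (\<lambda>_. 1)"
    and w: "\<And>l l'. 1 \<le> l \<Longrightarrow> l < r \<Longrightarrow> l' < r \<Longrightarrow> w l (b l') = (if l = l' then N else 0)"

text \<open>\<open>B\<close> is a basis of the columns, expressed by relations alone: no nonzero
  relation is supported in it, and it is maximal. The numbers \<open>q j i / N\<close> are the
  coordinates of column \<open>j\<close> in this basis, where \<open>N\<close> clears the
  denominators \<open>D j\<close>.\<close>

lemma (in projective_rel) echelon_form:
  obtains w b r N where "echelon_rel (rel V) w b r N"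
proof -
  define indep where "indep B \<longleftrightarrow> (\<forall>u\<in>rel V. {j. u j \<noteq> 0} \<subseteq> B \<longrightarrow> u = (\<lambda>_. 0))" for B
  have "{B. indep B} \<noteq> {}"
    by (auto simp: indep_def intro!: exI[of _ "{}"])
  moreover have "finite {B. indep B}"
    by (rule finite_subset[of _ "Pow UNIV"]) auto
  ultimately obtain B where B: "indep B" "\<And>B'. indep B' \<Longrightarrow> B \<subseteq> B' \<Longrightarrow> B' = B"
    using finite_has_maximal[of "{B. indep B}"] by blast
  have "\<exists>u\<in>rel V. {i. u i \<noteq> 0} \<subseteq> insert j B \<and> u j \<noteq> 0" if "j \<notin> B" for j
  proof -
    have "\<not> indep (insert j B)"
      using B(2)[of "insert j B"] that by auto
    then obtain u where u: "u \<in> rel V" "{i. u i \<noteq> 0} \<subseteq> insert j B" "u \<noteq> (\<lambda>_. 0)"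
      by (auto simp: indep_def)
    moreover have "u j \<noteq> 0"
    proof
      assume "u j = 0"
      then have "{i. u i \<noteq> 0} \<subseteq> B"
        using u(2) by auto
      then show False
        using B(1) u(1,3) by (auto simp: indep_def)
    qed
    ultimately show ?thesis
      by blast
  qed
  then obtain U where U: "\<And>j. j \<notin> B \<Longrightarrow> U j \<in> rel V \<and> {i. U j i \<noteq> 0} \<subseteq> insert j B \<and> U j j \<noteq> 0"
    by metis
  define D where "D j = (if j \<in> B then 1 else U j j)" for j
  define N where "N = (\<Prod>j\<in>UNIV. \<bar>D j\<bar>)"
  have D: "D j \<noteq> 0" for j
    using U by (simp add: D_def)
  then have N: "N > 0"
    unfolding N_def by (intro prod_pos) simp
  have dvd: "D j dvd N" for j
    unfolding N_def using dvd_prodI[of UNIV j "\<lambda>j. \<bar>D j\<bar>"] by simp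
  define q where "q j i = (if j \<in> B then (if i = j then N else 0) else - (N div D j * U j i))" for j i
  \<comment> \<open>The relation expressing \<open>N\<close> times column \<open>j\<close> by the
    basis columns with coefficients \<open>q j i\<close>. It is 0 for \<open>j\<close> in
    \<open>B\<close> and a multiple of \<open>U j\<close> otherwise.\<close>
  define \<rho> where "\<rho> j i = (if i = j then N else 0) - (if i \<in> B then q j i else 0)" for j i
  have \<rho>: "\<rho> j \<in> rel V" for j
  proof (cases "j \<in> B")
    case True
    then have "\<rho> j = (\<lambda>_. 0)"
      by (auto simp: \<rho>_def q_def)
    then show ?thesis
      by (simp add: rel_def)
  next
    case False
    have "\<rho> j i = N div D j * U j i" for i
    proof (cases "i = j")
      case True
      then show ?thesis
        using False dvd[of j] by (simp add: \<rho>_def D_def)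
    next
      case neq: False
      then show ?thesis
        using False U[of j] by (cases "i \<in> B") (auto simp: \<rho>_def q_def)
    qed
    then have "\<rho> j = (\<lambda>i. N div D j * U j i)"
      by blast
    then show ?thesis
      using U[OF False] by (simp add: rel_scale)
  qed
  \<comment> \<open>The entries of the relation \<open>\<rho> j\<close> add up to 0. This later
    permits exchanging one row for the all-ones row.\<close>
  have qsum: "(\<Sum>i\<in>B. q j i) = N" for j
  proof -
    have "(\<Sum>i\<in>UNIV. \<rho> j i) = N - (\<Sum>i\<in>UNIV. if i \<in> B then q j i else 0)"
      by (simp add: \<rho>_def sum_subtractf)
    also have "(\<Sum>i\<in>UNIV. if i \<in> B then q j i else 0) = (\<Sum>i\<in>B. q j i)"
      by (simp add: sum.If_cases)
    finally show ?thesis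
      using sum_rel[OF \<rho>] by simp
  qed
  \<comment> \<open>Subtracting relations \<open>\<rho> j\<close> from \<open>N * u\<close> leaves a
    vector \<open>v\<close> supported in \<open>B\<close>, and such a vector is a relation only if
    it is 0.\<close>
  have rel_iff: "u \<in> rel V \<longleftrightarrow> (\<forall>i\<in>B. (\<Sum>j\<in>UNIV. u j * q j i) = 0)" for u
  proof -
    define v where "v i = (if i \<in> B then (\<Sum>j\<in>UNIV. u j * q j i) else 0)" for i
    have "(\<Sum>j\<in>UNIV. u j * \<rho> j i) = N * u i - v i" for i
    proof -
      have "(\<Sum>j\<in>UNIV. u j * \<rho> j i) = (\<Sum>j\<in>UNIV. (if i = j then u j * N else 0) - (if i \<in> B then u j * q j i else 0))"
        by (intro sum.cong) (auto simp: \<rho>_def right_diff_distrib)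
      also have "\<dots> = N * u i - v i"
        by (simp add: sum_subtractf v_def)
      finally show ?thesis .
    qed
    moreover have "(\<lambda>i. \<Sum>j\<in>UNIV. u j * \<rho> j i) \<in> rel V"
      by (intro rel_sum rel_scale \<rho>)
    ultimately have uv: "(\<lambda>i. N * u i - v i) \<in> rel V"
      by simp
    show ?thesis
    proof
      assume "u \<in> rel V"
      from rel_diff[OF rel_scale[OF this, of N] uv] have "v \<in> rel V"
        by simp
      moreover have "{i. v i \<noteq> 0} \<subseteq> B"
        by (auto simp: v_def)
      ultimately have "v = (\<lambda>_. 0)"
        using B(1) by (auto simp: indep_def)
      then show "\<forall>i\<in>B. (\<Sum>j\<in>UNIV. u j * q j i) = 0"
        by (metis v_def)
    next
      assume "\<forall>i\<in>B. (\<Sum>j\<in>UNIV. u j * q j i) = 0"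
      then have "v = (\<lambda>_. 0)"
        by (auto simp: v_def)
      with uv N show "u \<in> rel V"
        by (auto intro: rel_scale_cancel)
    qed
  qed
  have "B \<noteq> {}"
    using qsum N by force
  obtain b where b: "bij_betw b {..<card B} B"
    using ex_bij_betw_nat_finite[of B] by (auto simp: atLeast0LessThan)
  \<comment> \<open>The rows of \<open>q\<close> indexed by \<open>B\<close> add up to the constant
    \<open>N\<close>, so the row of \<open>b 0\<close> is recovered from the others and the all-ones
    row.\<close>
  define w where "w l = (if l = 0 then (\<lambda>_. 1) else (\<lambda>j. q j (b l)))" for l :: nat
  have r: "card B \<ge> 1"
    using \<open>B \<noteq> {}\<close> by (simp add: Suc_leI card_gt_0_iff)
  have "rel V = rel (w ` {..<card B})"
  proof (intro Set.set_eqI iffI)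
    fix u assume u: "u \<in> rel V"
    have "(\<Sum>j\<in>UNIV. u j * w l j) = 0" if "l < card B" for l
      using u that bij_betwE[OF b] sum_rel[OF u] by (auto simp: w_def rel_iff)
    then show "u \<in> rel (w ` {..<card B})"
      by (auto simp: rel_def)
  next
    fix u assume "u \<in> rel (w ` {..<card B})"
    then have u: "(\<Sum>j\<in>UNIV. u j * w l j) = 0" if "l < card B" for l
      using that by (auto simp: rel_def)
    then have 0: "(\<Sum>j\<in>UNIV. u j) = 0"
      using r by (force simp: w_def)
    have pos: "(\<Sum>j\<in>UNIV. u j * q j (b l)) = 0" if "l \<in> {..<card B} - {0}" for l
      using u[of l] that by (simp add: w_def)
    have "(\<Sum>l<card B. q j (b l)) = N" for j
      using sum.reindex_bij_betw[OF b, of "q j"] qsum by simp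
    then have "(\<Sum>j\<in>UNIV. \<Sum>l<card B. u j * q j (b l)) = 0"
      using 0 by (simp flip: sum_distrib_left sum_distrib_right)
    then have "(\<Sum>l<card B. \<Sum>j\<in>UNIV. u j * q j (b l)) = 0"
      by (subst sum.swap)
    then have "(\<Sum>j\<in>UNIV. u j * q j (b 0)) = 0"
      using r pos by (subst (asm) sum.remove[of _ 0]) auto
    then have "(\<Sum>j\<in>UNIV. u j * q j (b l)) = 0" if "l < card B" for l
      using pos[of l] that by (cases "l = 0") auto
    moreover have "\<exists>l<card B. i = b l" if "i \<in> B" for i
      using that bij_betw_imp_surj_on[OF b] by (force simp: image_iff)
    ultimately show "u \<in> rel V"
      unfolding rel_iff by fast
  qed
  moreover have "w l (b l') = (if l = l' then N else 0)" if "1 \<le> l" "l < card B" "l' < card B" for l l'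
  proof -
    have "b l = b l' \<longleftrightarrow> l = l'"
      using that by (intro inj_on_eq_iff[OF bij_betw_imp_inj_on[OF b]]) auto
    then show ?thesis
      using that bij_betwE[OF b] by (auto simp: w_def q_def)
  qed
  ultimately have "echelon_rel (rel V) w b (card B) N"
    using r N by unfold_locales (auto simp: w_def)
  then show ?thesis
    by (rule that)
qed

context echelon_rel
begin

lemma projective_initial_rows: "projective_rel (w ` {..l})"
proof
  fix u assume "u \<in> rel (w ` {..l})"
  then have "(\<Sum>j\<in>UNIV. u j * w 0 j) = 0"
    by (auto simp: rel_def)
  then show "(\<Sum>j\<in>UNIV. u j) = 0"
    by (simp add: w0)
qed

lemma R_initial_rows: "R = rel (w ` {..r - 1})"
proof -
  have "{..<r} = {..r - 1}"
    using r by auto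
  then show ?thesis
    by (simp add: R)
qed

sublocale projective_rel "w ` {..r - 1}"
  by (rule projective_initial_rows)

lemma rel_iff_sum: "u \<in> R \<longleftrightarrow> (\<forall>l<r. (\<Sum>j\<in>UNIV. u j * w l j) = 0)"
  by (auto simp: R rel_def)

text \<open>The row space over the field, in the form in which it appears as the logarithmic tangent
  space at torus points.\<close>

definition annihilator :: "('k::field ^ 'n) set" where
  "annihilator = {y. \<forall>u\<in>R. (\<Sum>j\<in>UNIV. of_int (u j) * vec_nth y j) = 0}"

text \<open>The rows \<open>W l\<close> are a basis: their values at the pivots show independence,
  and the relation expressing column \<open>j\<close> by the pivot columns determines every entry of
  \<open>y\<close> from its entries at the pivots.\<close>

lemma dim_annihilator: "vec.dim (annihilator :: ('k::field_char_0 ^ 'n) set) = r"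
proof -
  define W :: "nat \<Rightarrow> 'k ^ 'n" where "W l = vec_lambda (\<lambda>j. of_int (w l j))" for l
  have W_b: "vec_nth (W l) (b l') = (if l = 0 then 1 else if l = l' then of_int N else 0)" if "l < r" "l' < r" for l l'
    using that w[of l l'] by (auto simp: W_def w0)
  have coeffs: "c l = 0" if c: "(\<Sum>l<r. c l *s W l) = 0" and l: "l < r" for c :: "nat \<Rightarrow> 'k" and l
  proof -
    have eval: "(\<Sum>l<r. c l * vec_nth (W l) j) = 0" for j
      using arg_cong[OF c, of "\<lambda>x. vec_nth x j"] by simp
    have "(\<Sum>l<r. c l * vec_nth (W l) (b l')) = c 0 + (if l' = 0 then 0 else c l' * of_int N)" if "l' < r" for l'
    proof -
      have "(\<Sum>l<r. c l * vec_nth (W l) (b l')) = (\<Sum>l<r. (if l = 0 then c l else 0) + (if l = l' then (if l' = 0 then 0 else c l' * of_int N) else 0))"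
        using that by (intro sum.cong) (auto simp: W_b)
      then show ?thesis
        using that r by (simp add: sum.distrib)
    qed
    from this[of 0] this[of l] show ?thesis
      using eval r l N by (auto split: if_splits)
  qed
  have inj: "inj_on W {..<r}"
  proof (rule inj_onI, rule ccontr)
    fix l l' assume *: "l \<in> {..<r}" "l' \<in> {..<r}" "W l = W l'" "l \<noteq> l'"
    have "(\<Sum>k<r. ((if k = l then 1 else 0) - (if k = l' then 1 else 0)) *s W k) = W l - W l'"
      using *(1,2) by (simp add: vector_sub_rdistrib sum_subtractf if_distrib[of "\<lambda>c. c *s _"] cong: if_cong)
    then show False
      using coeffs[of "\<lambda>k. (if k = l then 1 else 0) - (if k = l' then 1 else 0)" l] * by simp
  qed
  have indep: "vec.independent (W ` {..<r})"
  proof (subst vec.dependent_finite)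
    show "\<not> (\<exists>u. (\<exists>v\<in>W ` {..<r}. u v \<noteq> 0) \<and> (\<Sum>v\<in>W ` {..<r}. u v *s v) = 0)"
    proof
      assume "\<exists>u. (\<exists>v\<in>W ` {..<r}. u v \<noteq> 0) \<and> (\<Sum>v\<in>W ` {..<r}. u v *s v) = 0"
      then obtain u l where "l < r" "u (W l) \<noteq> 0" "(\<Sum>v\<in>W ` {..<r}. u v *s v) = 0"
        by auto
      then show False
        using coeffs[of "\<lambda>l. u (W l)" l] by (simp add: sum.reindex[OF inj])
    qed
  qed simp
  have sub: "W ` {..<r} \<subseteq> annihilator"
    by (auto simp: annihilator_def W_def rel_iff_sum simp flip: of_int_mult of_int_sum)
  have "y \<in> vec.span (W ` {..<r})" if y: "y \<in> annihilator" for y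
  proof -
    define d where "d l = vec_nth y (b l) - vec_nth y (b 0)" for l
    have key: "of_int N * vec_nth y j = (\<Sum>l\<in>{1..<r}. of_int (w l j) * d l) + of_int N * vec_nth y (b 0)" for j
    proof -
      define \<delta> where "\<delta> k i = (if i = k then 1 else 0 :: int)" for k i :: 'n
      \<comment> \<open>\<open>N\<close> times column \<open>j\<close> minus its expression by the
        pivot columns: column \<open>b l\<close> has coefficient \<open>w l j\<close>, and
        \<open>b 0\<close> takes what remains to make the coefficients add up to
        \<open>N\<close>.\<close>
      define u where "u i = N * \<delta> j i - (\<Sum>l\<in>{1..<r}. w l j * (\<delta> (b l) i - \<delta> (b 0) i)) - N * \<delta> (b 0) i" for i
      have sums: "(\<Sum>i\<in>UNIV. of_int (u i) * z i) = of_int N * z j - (\<Sum>l\<in>{1..<r}. of_int (w l j) * (z (b l) - z (b 0))) - of_int N * z (b 0)"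
        for z :: "'n \<Rightarrow> 'a::comm_ring_1"
      proof -
        have \<delta>: "(\<Sum>i\<in>UNIV. of_int (\<delta> k i) * z i) = z k" for k
          by (simp add: \<delta>_def if_distrib[of of_int] if_distrib[of "\<lambda>c. c * _"] cong: if_cong)
        have "(\<Sum>i\<in>UNIV. of_int (u i) * z i) = of_int N * (\<Sum>i\<in>UNIV. of_int (\<delta> j i) * z i)
            - (\<Sum>i\<in>UNIV. \<Sum>l\<in>{1..<r}. of_int (w l j) * (of_int (\<delta> (b l) i) * z i - of_int (\<delta> (b 0) i) * z i))
            - of_int N * (\<Sum>i\<in>UNIV. of_int (\<delta> (b 0) i) * z i)"
          unfolding sum_distrib_left[of "of_int N"] sum_subtractf[symmetric] u_def
          by (intro sum.cong refl) (simp add: left_diff_distrib right_diff_distrib sum_distrib_right sum_subtractf mult.assoc)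
        also have "(\<Sum>i\<in>UNIV. \<Sum>l\<in>{1..<r}. of_int (w l j) * (of_int (\<delta> (b l) i) * z i - of_int (\<delta> (b 0) i) * z i))
            = (\<Sum>l\<in>{1..<r}. of_int (w l j) * (z (b l) - z (b 0)))"
          by (subst sum.swap) (simp add: sum_subtractf \<delta> flip: sum_distrib_left)
        finally show ?thesis
          by (simp add: \<delta>)
      qed
      have "(\<Sum>i\<in>UNIV. u i * w l i) = 0" if "l < r" for l
      proof (cases "l = 0")
        case True
        then show ?thesis
          using sums[of "w 0"] by (simp add: w0)
      next
        case False
        have "(\<Sum>l'\<in>{1..<r}. w l' j * (w l (b l') - w l (b 0))) = (\<Sum>l'\<in>{1..<r}. if l' = l then w l j * N else 0)"
          using False that r by (intro sum.cong refl) (auto simp: w)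
        then show ?thesis
          using sums[of "w l"] False that r by (simp add: w)
      qed
      then have "u \<in> R"
        by (simp add: rel_iff_sum)
      then have "(\<Sum>i\<in>UNIV. of_int (u i) * vec_nth y i) = 0"
        using y by (simp add: annihilator_def)
      then have "of_int N * vec_nth y j - (\<Sum>l\<in>{1..<r}. of_int (w l j) * d l) - of_int N * vec_nth y (b 0) = 0"
        using sums[of "vec_nth y"] by (simp only: d_def)
      then show ?thesis
        by (simp only: diff_diff_eq right_minus_eq)
    qed
    have "of_int N *s y = (\<Sum>l\<in>{1..<r}. d l *s W l) + (of_int N * vec_nth y (b 0)) *s W 0"
      unfolding Finite_Cartesian_Product.vec_eq_iff
    proof
      fix j
      show "vec_nth (of_int N *s y) j = vec_nth ((\<Sum>l\<in>{1..<r}. d l *s W l) + (of_int N * vec_nth y (b 0)) *s W 0) j"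
        using key[of j] by (simp add: W_def w0 mult.commute)
    qed
    moreover have "\<dots> \<in> vec.span (W ` {..<r})"
      using r by (intro vec.span_add vec.span_sum vec.span_scale vec.span_base) auto
    ultimately have "inverse (of_int N) *s (of_int N *s y) \<in> vec.span (W ` {..<r})"
      by (metis vec.span_scale)
    then show ?thesis
      using N by (simp add: vector_smult_assoc)
  qed
  then have "annihilator \<subseteq> vec.span (W ` {..<r})"
    by blast
  from vec.dim_unique[OF sub this indep] show ?thesis
    by (simp add: card_image inj)
qed

end


section \<open>Dimension\<close>

lemma exists_linear_dependency:
  fixes a :: "'i \<Rightarrow> 'p \<Rightarrow> 'k::field"
  assumes "finite P" "finite I" "card P < card I"
  shows "\<exists>c. (\<exists>i\<in>I. c i \<noteq> 0) \<and> (\<forall>p\<in>P. (\<Sum>i\<in>I. c i * a i p) = 0)"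
  using assms
proof (induction P arbitrary: I a rule: finite_induct)
  case empty
  then have "I \<noteq> {}"
    by auto
  then show ?case
    by (intro exI[of _ "\<lambda>_. 1"]) auto
next
  case (insert p P)
  show ?case
  proof (cases "\<exists>i\<in>I. a i p \<noteq> 0")
    case False
    have "card P < card I"
      using insert by simp
    then obtain c where c: "\<exists>i\<in>I. c i \<noteq> 0" "\<forall>q\<in>P. (\<Sum>i\<in>I. c i * a i q) = 0"
      using insert.IH[OF insert.prems(1), of a] by blast
    moreover have "(\<Sum>i\<in>I. c i * a i p) = 0"
      using False by (intro sum.neutral) auto
    ultimately show ?thesis
      by auto
  next
    case True
    then obtain k where k: "k \<in> I" "a k p \<noteq> 0"
      by blast
    define a' where "a' i q = a i q - a i p / a k p * a k q" for i q
    have "finite (I - {k})" "card P < card (I - {k})"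
      using insert k by auto
    then obtain c where c: "\<exists>i\<in>I - {k}. c i \<noteq> 0" "\<forall>q\<in>P. (\<Sum>i\<in>I - {k}. c i * a' i q) = 0"
      using insert.IH[of "I - {k}" a'] by blast
    \<comment> \<open>Elimination with pivot \<open>k\<close>: the value at \<open>k\<close> is
      chosen so that the sum at \<open>p\<close> is 0.\<close>
    define c' where "c' i = (if i = k then - (\<Sum>i\<in>I - {k}. c i * a i p) / a k p else c i)" for i
    have eq: "(\<Sum>i\<in>I. c' i * a i q) = (\<Sum>i\<in>I - {k}. c i * a' i q)" for q
    proof -
      have "(\<Sum>i\<in>I. c' i * a i q) = c' k * a k q + (\<Sum>i\<in>I - {k}. c' i * a i q)"
        using insert.prems(1) k(1) by (rule sum.remove)
      also have "(\<Sum>i\<in>I - {k}. c' i * a i q) = (\<Sum>i\<in>I - {k}. c i * a i q)"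
        by (intro sum.cong) (auto simp: c'_def)
      also have "c' k * a k q = - (\<Sum>i\<in>I - {k}. c i * (a i p / a k p * a k q))"
        by (simp add: c'_def sum_distrib_right sum_divide_distrib mult.assoc)
      finally show ?thesis
        by (simp add: a'_def right_diff_distrib sum_subtractf)
    qed
    have "(\<Sum>i\<in>I. c' i * a i q) = 0" if "q \<in> insert p P" for q
      using that c(2) k(2) by (auto simp: eq a'_def)
    moreover have "\<exists>i\<in>I. c' i \<noteq> 0"
      using c(1) by (auto simp: c'_def)
    ultimately show ?thesis
      by blast
  qed
qed

text \<open>That is, \<open>H\<close> is at most the value at \<open>Q\<close> of the Hilbert function of \<open>Z\<close>.\<close>

definition independent_forms :: "('k::field ^ 'n::finite) set \<Rightarrow> nat \<Rightarrow> nat \<Rightarrow> bool" where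
  "independent_forms Z Q H \<longleftrightarrow> (\<exists>g :: nat \<Rightarrow> ('n, 'k) mpoly. (\<forall>k<H. hom_of_degree Q (g k)) \<and>
     (\<forall>c. (\<forall>z\<in>Z. (\<Sum>k<H. c k * mpoly_eval (g k) z) = 0) \<longrightarrow> (\<forall>k<H. c k = 0)))"

lemma independent_forms_0 [simp]: "independent_forms Z Q 0"
  by (simp add: independent_forms_def)

lemma sum_lessThan_add: "(\<Sum>k<m + n. h k) = (\<Sum>k<m. h k) + (\<Sum>k<n. h (m + k))"
  for h :: "nat \<Rightarrow> 'a::comm_monoid_add"
  by (induction n) (auto simp: add.assoc)

text \<open>An inequality between Hilbert functions. Multiples of \<open>f\<close> vanish on
  \<open>Z'\<close>, so restriction to \<open>Z'\<close> isolates the first \<open>H\<close>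
  coefficients. Multiplication by \<open>f\<close> is injective modulo the forms vanishing on
  \<open>Z\<close>, by primality, which handles the remaining ones.\<close>

lemma independent_forms_add:
  fixes Z Z' :: "('k::field ^ 'n::finite) set"
  assumes sub: "Z' \<subseteq> Z"
    and prime: "\<And>f g. homogeneous f \<Longrightarrow> homogeneous g \<Longrightarrow> vanishes_on (f * g) Z \<Longrightarrow> vanishes_on f Z \<or> vanishes_on g Z"
    and f: "hom_of_degree d f" "vanishes_on f Z'" "\<not> vanishes_on f Z"
    and H: "independent_forms Z' (d + Q) H" and H': "independent_forms Z Q H'"
  shows "independent_forms Z (d + Q) (H + H')"
proof -
  obtain g :: "nat \<Rightarrow> ('n, 'k) mpoly" where g: "\<forall>k<H. hom_of_degree (d + Q) (g k)"
    "\<And>c. (\<forall>z\<in>Z'. (\<Sum>k<H. c k * mpoly_eval (g k) z) = 0) \<Longrightarrow> (\<forall>k<H. c k = 0)"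
    using H unfolding independent_forms_def by blast
  obtain g' :: "nat \<Rightarrow> ('n, 'k) mpoly" where g': "\<forall>k<H'. hom_of_degree Q (g' k)"
    "\<And>c. (\<forall>z\<in>Z. (\<Sum>k<H'. c k * mpoly_eval (g' k) z) = 0) \<Longrightarrow> (\<forall>k<H'. c k = 0)"
    using H' unfolding independent_forms_def by blast
  define h where "h k = (if k < H then g k else f * g' (k - H))" for k
  have "hom_of_degree (d + Q) (h k)" if "k < H + H'" for k
    using that g(1) g'(1) f(1) by (auto simp: h_def intro!: hom_of_degree_mult)
  moreover have "\<forall>k<H + H'. c k = 0" if c: "\<forall>z\<in>Z. (\<Sum>k<H + H'. c k * mpoly_eval (h k) z) = 0" for c
  proof -
    have split: "(\<Sum>k<H + H'. c k * mpoly_eval (h k) z) =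
        (\<Sum>k<H. c k * mpoly_eval (g k) z) + mpoly_eval f z * (\<Sum>k<H'. c (H + k) * mpoly_eval (g' k) z)" for z
      by (simp add: sum_lessThan_add h_def sum_distrib_left mult_ac)
    have "\<forall>z\<in>Z'. (\<Sum>k<H. c k * mpoly_eval (g k) z) = 0"
    proof
      fix z assume "z \<in> Z'"
      then show "(\<Sum>k<H. c k * mpoly_eval (g k) z) = 0"
        using split[of z] c f(2) sub by (auto simp: vanishes_on_def)
    qed
    then have lo: "\<forall>k<H. c k = 0"
      by (rule g(2))
    define G where "G = (\<Sum>k<H'. Poly_Mapping.single 0 (c (H + k)) * g' k)"
    have "hom_of_degree Q G"
      using g'(1) unfolding G_def by (intro hom_of_degree_sum hom_of_degree_scale) auto
    have G: "mpoly_eval G z = (\<Sum>k<H'. c (H + k) * mpoly_eval (g' k) z)" for z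
      by (simp add: G_def)
    have "vanishes_on (f * G) Z"
      using c lo by (simp add: vanishes_on_def split G)
    then have "vanishes_on G Z"
      using prime[of f G] f \<open>hom_of_degree Q G\<close> by (auto simp: homogeneous_iff)
    then have "\<forall>k<H'. c (H + k) = 0"
      by (intro g'(2)) (simp add: vanishes_on_def G)
    then have "c k = 0" if "k < H + H'" for k
      using lo that \<open>\<forall>k<H'. c (H + k) = 0\<close>[rule_format, of "k - H"] by (cases "k < H") auto
    then show ?thesis
      by blast
  qed
  ultimately show ?thesis
    unfolding independent_forms_def by blast
qed

text \<open>Along the chain the Hilbert function gains one degree of growth per step. The form
  \<open>f\<close>, of degree \<open>d\<close>, vanishes on \<open>Z i\<close> but not on
  \<open>Z (Suc i)\<close>; using it \<open>M + 1\<close> times costs degree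
  \<open>(M + 1) * d\<close> and adds up \<open>M + 1\<close> copies of the bound for
  \<open>Z i\<close>. The constant \<open>D\<close> does not depend on \<open>M\<close>.\<close>

lemma hilbert_growth:
  fixes Z :: "nat \<Rightarrow> ('k::field ^ 'n::finite) set"
  assumes prime: "\<And>i f g. i \<le> l \<Longrightarrow> homogeneous f \<Longrightarrow> homogeneous g \<Longrightarrow> vanishes_on (f * g) (Z i) \<Longrightarrow>
      vanishes_on f (Z i) \<or> vanishes_on g (Z i)"
    and ne: "\<exists>z\<in>Z 0. z \<noteq> 0"
    and closed: "\<And>i. i \<le> l \<Longrightarrow> closedin zariski (Z i)" and strict: "\<And>i. i < l \<Longrightarrow> Z i \<subset> Z (Suc i)"
  shows "i \<le> l \<Longrightarrow> \<exists>D. \<forall>M Q. Q \<ge> D * (M + 1) \<longrightarrow> independent_forms (Z i) Q ((M + 1) ^ i)"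
proof (induction i)
  case 0
  obtain z j where z: "z \<in> Z 0" "vec_nth z j \<noteq> 0"
    using ne by (auto simp: Finite_Cartesian_Product.vec_eq_iff)
  have "independent_forms (Z 0) Q 1" for Q
    unfolding independent_forms_def
  proof (intro exI[of _ "\<lambda>_. coord j ^ Q"] conjI allI impI)
    show "hom_of_degree Q (coord j ^ Q)"
      using hom_of_degree_power[OF hom_of_degree_coord, of Q j] by simp
  next
    fix c :: "nat \<Rightarrow> 'k" and k :: nat
    assume "\<forall>z\<in>Z 0. (\<Sum>k<1. c k * mpoly_eval (coord j ^ Q) z) = 0" and "k < 1"
    with z(1) have "(\<Sum>k<1. c k * mpoly_eval (coord j ^ Q) z) = 0"
      by blast
    then show "c k = 0"
      using z(2) \<open>k < 1\<close> by simp
  qed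
  then show ?case
    by simp
next
  case (Suc i)
  then obtain D where D: "\<And>M Q. Q \<ge> D * (M + 1) \<Longrightarrow> independent_forms (Z i) Q ((M + 1) ^ i)"
    by auto
  obtain z where z: "z \<in> Z (Suc i)" "z \<notin> Z i"
    using strict[of i] Suc.prems by auto
  have "z \<noteq> 0"
    using z(1) closed[of "Suc i"] closedin_zariski_nonzero Suc.prems by blast
  then obtain f where "homogeneous f" and f: "vanishes_on f (Z i)" "mpoly_eval f z \<noteq> 0"
    using z(2) closed[of i] Suc.prems unfolding closedin_zariski_iff by auto
  then obtain d where d: "hom_of_degree d f"
    by (auto simp: homogeneous_iff)
  have step: "independent_forms (Z (Suc i)) Q (m * (M + 1) ^ i)" if "Q \<ge> D * (M + 1) + m * d" for m M Q
    using that
  proof (induction m arbitrary: Q)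
    case (Suc m)
    define Q' where "Q' = Q - d"
    have Q: "Q = d + Q'" and Q': "Q' \<ge> D * (M + 1) + m * d"
      using Suc.prems by (auto simp: Q'_def)
    have "independent_forms (Z (Suc i)) (d + Q') ((M + 1) ^ i + m * (M + 1) ^ i)"
    proof (rule independent_forms_add[where Z' = "Z i" and f = f])
      show "Z i \<subseteq> Z (Suc i)"
        using strict[of i] \<open>Suc i \<le> l\<close> by auto
      show "\<not> vanishes_on f (Z (Suc i))"
        using f(2) z(1) by (auto simp: vanishes_on_def)
      show "independent_forms (Z i) (d + Q') ((M + 1) ^ i)"
        using Q' by (intro D) auto
    qed (use prime[of "Suc i"] \<open>Suc i \<le> l\<close> d f(1) Suc.IH[OF Q'] in auto)
    then show ?case
      by (simp add: Q)
  qed simp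
  have "independent_forms (Z (Suc i)) Q ((M + 1) ^ Suc i)" if "Q \<ge> (D + d) * (M + 1)" for M Q
    using step[where m = "M + 1" and M = M and Q = Q] that by (simp add: algebra_simps)
  then show ?case
    by blast
qed

section \<open>Upper and lower bounds for chains in the variety\<close>

context echelon_rel
begin

text \<open>On the variety a form of degree \<open>Q\<close> is determined by its coefficient sums
  over classes of monomials. A class is given by the pairings with the rows 1 to
  \<open>r - 1\<close>, since the pairing with row 0 is \<open>Q\<close>, and each pairing lies
  between \<open>- C * Q\<close> and \<open>C * Q\<close>. More forms than classes are therefore
  dependent.\<close>

lemma hilbert_bound:
  obtains C :: nat where "\<And>Q H. independent_forms (binomial_variety R :: ('k::field ^ 'n) set) Q H \<Longrightarrow> H \<le> (2 * (C * Q) + 1) ^ (r - 1)"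
proof
  define C where "C = nat (\<Sum>l<r. \<Sum>j\<in>UNIV. \<bar>w l j\<bar>)"
  fix Q H assume "independent_forms (binomial_variety R :: ('k ^ 'n) set) Q H"
  then obtain g :: "nat \<Rightarrow> ('n, 'k) mpoly" where g: "\<forall>k<H. hom_of_degree Q (g k)"
    "\<And>c. (\<forall>z\<in>binomial_variety R. (\<Sum>k<H. c k * mpoly_eval (g k) z) = 0) \<Longrightarrow> (\<forall>k<H. c k = 0)"
    unfolding independent_forms_def by blast
  define cls where "cls \<alpha> = restrict (\<lambda>l. \<Sum>j\<in>UNIV. int (Poly_Mapping.lookup \<alpha> j) * w l j) {1..<r}" for \<alpha> :: "'n \<Rightarrow>\<^sub>0 nat"
  define P where "P = PiE {1..<r} (\<lambda>_. {- int (C * Q)..int (C * Q)})"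
  have P: "finite P" "card P = (2 * (C * Q) + 1) ^ (r - 1)"
  proof -
    have "card {- int (C * Q)..int (C * Q)} = 2 * (C * Q) + 1"
      unfolding card_atLeastAtMost_int by linarith
    then show "finite P" "card P = (2 * (C * Q) + 1) ^ (r - 1)"
      by (simp_all add: P_def card_PiE finite_PiE del: card_atLeastAtMost_int)
  qed
  have clsP: "cls \<alpha> \<in> P" if "(\<Sum>j\<in>UNIV. Poly_Mapping.lookup \<alpha> j) = Q" for \<alpha>
    unfolding cls_def P_def
  proof (rule restrict_PiE_iff[THEN iffD2], intro ballI)
    fix l assume l: "l \<in> {1..<r}"
    have "\<bar>w l j\<bar> \<le> int C" for j
    proof -
      have "\<bar>w l j\<bar> \<le> (\<Sum>j\<in>UNIV. \<bar>w l j\<bar>)"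
        by (intro member_le_sum) auto
      also have "\<dots> \<le> (\<Sum>l<r. \<Sum>j\<in>UNIV. \<bar>w l j\<bar>)"
        using l by (intro member_le_sum[of l _ "\<lambda>l. \<Sum>j\<in>UNIV. \<bar>w l j\<bar>"] sum_nonneg) auto
      finally show ?thesis
        unfolding C_def by linarith
    qed
    then have "\<bar>\<Sum>j\<in>UNIV. int (Poly_Mapping.lookup \<alpha> j) * w l j\<bar> \<le> (\<Sum>j\<in>UNIV. int (Poly_Mapping.lookup \<alpha> j) * int C)"
      by (intro order_trans[OF sum_abs] sum_mono) (auto simp: abs_mult intro!: mult_left_mono)
    also have "\<dots> = int (C * Q)"
      using that by (simp flip: sum_distrib_right of_nat_sum)
    finally show "(\<Sum>j\<in>UNIV. int (Poly_Mapping.lookup \<alpha> j) * w l j) \<in> {- int (C * Q)..int (C * Q)}"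
      by (auto simp: abs_le_iff)
  qed
  have clsR: "exp_diff \<alpha> \<beta> \<in> R" if "(\<Sum>j\<in>UNIV. Poly_Mapping.lookup \<alpha> j) = Q" "(\<Sum>j\<in>UNIV. Poly_Mapping.lookup \<beta> j) = Q"
    "cls \<alpha> = cls \<beta>" for \<alpha> \<beta>
    unfolding rel_iff_sum
  proof (intro allI impI)
    fix l assume "l < r"
    have eq: "(\<Sum>j\<in>UNIV. exp_diff \<alpha> \<beta> j * w l j) = (\<Sum>j\<in>UNIV. int (Poly_Mapping.lookup \<alpha> j) * w l j) - (\<Sum>j\<in>UNIV. int (Poly_Mapping.lookup \<beta> j) * w l j)"
      by (simp add: exp_diff_def left_diff_distrib sum_subtractf)
    show "(\<Sum>j\<in>UNIV. exp_diff \<alpha> \<beta> j * w l j) = 0"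
    proof (cases "l = 0")
      case True
      then show ?thesis
        using that(1,2) unfolding eq by (simp add: w0 flip: of_nat_sum)
    next
      case False
      then show ?thesis
        using fun_cong[OF that(3), of l] \<open>l < r\<close> by (simp add: eq cls_def)
    qed
  qed
  define a where "a k p = (\<Sum>\<alpha> | \<alpha> \<in> Poly_Mapping.keys (g k) \<and> cls \<alpha> = p. Poly_Mapping.lookup (g k) \<alpha>)" for k p
  show "H \<le> (2 * (C * Q) + 1) ^ (r - 1)"
  proof (rule ccontr)
    assume "\<not> H \<le> (2 * (C * Q) + 1) ^ (r - 1)"
    then obtain c where c: "\<exists>k<H. c k \<noteq> 0" "\<forall>p\<in>P. (\<Sum>k<H. c k * a k p) = 0"
      using exists_linear_dependency[of P "{..<H}" a] P by auto
    have "(\<Sum>k<H. c k * mpoly_eval (g k) z) = 0" if z: "z \<in> binomial_variety R" for z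
    proof -
      \<comment> \<open>The value at \<open>z\<close> shared by all monomials of degree
        \<open>Q\<close> in the class \<open>p\<close>.\<close>
      define \<chi> where "\<chi> p = xpow (Poly_Mapping.lookup (SOME \<alpha>. (\<Sum>j\<in>UNIV. Poly_Mapping.lookup \<alpha> j) = Q \<and> cls \<alpha> = p)) z" for p
      have \<chi>: "xpow (Poly_Mapping.lookup \<alpha>) z = \<chi> (cls \<alpha>)" if "(\<Sum>j\<in>UNIV. Poly_Mapping.lookup \<alpha> j) = Q" for \<alpha>
      proof -
        define \<beta> where "\<beta> = (SOME \<beta>. (\<Sum>j\<in>UNIV. Poly_Mapping.lookup \<beta> j) = Q \<and> cls \<beta> = cls \<alpha>)"
        have "(\<Sum>j\<in>UNIV. Poly_Mapping.lookup \<beta> j) = Q \<and> cls \<beta> = cls \<alpha>"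
          unfolding \<beta>_def by (rule someI[of _ \<alpha>]) (use that in simp)
        then have "exp_diff \<alpha> \<beta> \<in> R"
          using that by (intro clsR) auto
        then show ?thesis
          unfolding \<chi>_def \<beta>_def[symmetric] using xpow_eq_variety[OF z] by (simp add: exp_diff_def)
      qed
      have eval: "mpoly_eval (g k) z = (\<Sum>p\<in>P. a k p * \<chi> p)" if "k < H" for k
      proof -
        have keys: "(\<Sum>j\<in>UNIV. Poly_Mapping.lookup \<alpha> j) = Q" if "\<alpha> \<in> Poly_Mapping.keys (g k)" for \<alpha>
          using that g(1) \<open>k < H\<close> by (simp add: hom_of_degree_def)
        have "mpoly_eval (g k) z = (\<Sum>\<alpha>\<in>Poly_Mapping.keys (g k). Poly_Mapping.lookup (g k) \<alpha> * \<chi> (cls \<alpha>))"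
          unfolding mpoly_eval_xpow by (intro sum.cong refl) (simp add: \<chi> keys)
        also have "\<dots> = (\<Sum>p\<in>P. \<Sum>\<alpha> | \<alpha> \<in> Poly_Mapping.keys (g k) \<and> cls \<alpha> = p. Poly_Mapping.lookup (g k) \<alpha> * \<chi> (cls \<alpha>))"
          using P(1) clsP keys by (intro sum.group[symmetric]) auto
        also have "\<dots> = (\<Sum>p\<in>P. a k p * \<chi> p)"
          unfolding a_def sum_distrib_right by (intro sum.cong refl) auto
        finally show ?thesis .
      qed
      have "(\<Sum>k<H. c k * mpoly_eval (g k) z) = (\<Sum>k<H. \<Sum>p\<in>P. c k * a k p * \<chi> p)"
        by (intro sum.cong refl) (simp add: eval sum_distrib_left mult.assoc)
      also have "\<dots> = (\<Sum>p\<in>P. (\<Sum>k<H. c k * a k p) * \<chi> p)"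
        by (subst sum.swap) (simp add: sum_distrib_right)
      also have "\<dots> = 0"
        using c(2) by simp
      finally show ?thesis .
    qed
    then have "\<forall>k<H. c k = 0"
      by (intro g(2)) blast
    then show False
      using c(1) by blast
  qed
qed

text \<open>A chain of length \<open>l\<close> forces growth of degree at least \<open>l\<close>,
  while the count of classes permits only degree \<open>r - 1\<close>.\<close>

lemma chain_length_bound:
  fixes Z :: "nat \<Rightarrow> ('k::field_char_0 ^ 'n) set"
  assumes irr: "\<forall>i\<le>l. irreducible_closed (subtopology zariski (binomial_variety R)) (Z i)"
    and strict: "\<forall>i<l. Z i \<subset> Z (Suc i)"
  shows "l \<le> r - 1"
proof -
  have X: "closedin zariski (binomial_variety R :: ('k ^ 'n) set)"
    unfolding R_initial_rows by (rule closedin_variety)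
  have irr': "closedin zariski (Z i) \<and> Z i \<subseteq> binomial_variety R \<and> Z i \<noteq> {} \<and>
      (\<forall>f g. homogeneous f \<longrightarrow> homogeneous g \<longrightarrow> vanishes_on (f * g) (Z i) \<longrightarrow> vanishes_on f (Z i) \<or> vanishes_on g (Z i))"
    if "i \<le> l" for i
    using irr that unfolding irreducible_closed_zariski_iff[OF X] by blast
  have "\<exists>z\<in>Z 0. z \<noteq> 0"
    using irr'[of 0] by (auto simp: binomial_variety_def)
  then obtain D where D: "\<And>M Q. Q \<ge> D * (M + 1) \<Longrightarrow> independent_forms (Z l) Q ((M + 1) ^ l)"
    using hilbert_growth[of l Z l] irr' strict by blast
  obtain C where C: "\<And>Q H. independent_forms (binomial_variety R :: ('k ^ 'n) set) Q H \<Longrightarrow> H \<le> (2 * (C * Q) + 1) ^ (r - 1)"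
    using hilbert_bound by blast
  have mono: "independent_forms (binomial_variety R :: ('k ^ 'n) set) Q H" if H: "independent_forms (Z l) Q H" for Q H
  proof -
    have sub: "Z l \<subseteq> binomial_variety R"
      using irr'[of l] by simp
    from H obtain g :: "nat \<Rightarrow> ('n, 'k) mpoly" where g: "\<forall>k<H. hom_of_degree Q (g k)"
      "\<forall>c. (\<forall>z\<in>Z l. (\<Sum>k<H. c k * mpoly_eval (g k) z) = 0) \<longrightarrow> (\<forall>k<H. c k = 0)"
      unfolding independent_forms_def by blast
    have "\<forall>k<H. c k = 0" if "\<forall>z\<in>binomial_variety R. (\<Sum>k<H. c k * mpoly_eval (g k) z) = 0" for c
      using g(2)[rule_format, of c] that sub by blast
    with g(1) show ?thesis
      unfolding independent_forms_def by (intro exI[of _ g]) simp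
  qed
  show ?thesis
  proof (rule ccontr)
    assume "\<not> l \<le> r - 1"
    \<comment> \<open>In degree \<open>D * (M + 1)\<close> the number of classes is at most
      \<open>(E * (M + 1)) ^ (r - 1)\<close>. With \<open>M = E ^ (r - 1)\<close> this equals
      \<open>M * (M + 1) ^ (r - 1)\<close>, which is less than \<open>(M + 1) ^ r\<close>.\<close>
    define E where "E = 2 * (C * D) + 1"
    define M where "M = E ^ (r - 1)"
    have "(M + 1) ^ r \<le> (M + 1) ^ l"
      using \<open>\<not> l \<le> r - 1\<close> by (intro power_increasing) auto
    also have "\<dots> \<le> (2 * (C * (D * (M + 1))) + 1) ^ (r - 1)"
      by (intro C mono D) simp
    also have "\<dots> \<le> (E * (M + 1)) ^ (r - 1)"
      by (intro power_mono) (auto simp: E_def algebra_simps)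
    also have "\<dots> = M * (M + 1) ^ (r - 1)"
      unfolding power_mult_distrib by (simp only: M_def)
    also have "\<dots> < (M + 1) * (M + 1) ^ (r - 1)"
      by simp
    also have "\<dots> = (M + 1) ^ r"
      using r by (metis Suc_diff_1 power_Suc less_eq_Suc_le One_nat_def)
    finally show False
      by simp
  qed
qed

text \<open>Adjoining rows one at a time shrinks the relation lattice and enlarges the variety. A
  monomial curve whose exponents come from the new row leaves the smaller variety.\<close>

lemma exists_chain:
  obtains Z :: "nat \<Rightarrow> ('k::field_char_0 ^ 'n) set" where
    "\<forall>i\<le>r - 1. irreducible_closed (subtopology zariski (binomial_variety R)) (Z i)"
    "\<forall>i<r - 1. Z i \<subset> Z (Suc i)"
proof
  define Z :: "nat \<Rightarrow> ('k ^ 'n) set" where "Z i = binomial_variety (rel (w ` {..i}))" for i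
  show "\<forall>i\<le>r - 1. irreducible_closed (subtopology zariski (binomial_variety R)) (Z i)"
  proof (intro allI impI)
    fix i assume "i \<le> r - 1"
    interpret i: projective_rel "w ` {..i}"
      by (rule projective_initial_rows)
    show "irreducible_closed (subtopology zariski (binomial_variety R)) (Z i)"
      unfolding Z_def R_initial_rows
      by (intro i.irreducible_variety closedin_variety binomial_variety_antimono rel_antimono image_mono)
        (use \<open>i \<le> r - 1\<close> in auto)
  qed
  show "\<forall>i<r - 1. Z i \<subset> Z (Suc i)"
  proof (intro allI impI psubsetI)
    fix i assume i: "i < r - 1"
    show "Z i \<subseteq> Z (Suc i)"
      unfolding Z_def by (intro binomial_variety_antimono rel_antimono image_mono) auto
    \<comment> \<open>The shift by \<open>S\<close> makes the exponents nonnegative. It is harmless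
      because row 0, the all-ones row, is already present.\<close>
    define S where "S = (\<Sum>j\<in>UNIV. \<bar>w (Suc i) j\<bar>)"
    define e where "e j = nat (w (Suc i) j + S)" for j
    have "\<bar>w (Suc i) j\<bar> \<le> S" for j
      unfolding S_def by (intro member_le_sum) auto
    then have nonneg: "w (Suc i) j + S \<ge> 0" for j
      by (smt (verit))
    \<comment> \<open>The parameter 2 has distinct powers for distinct exponents in characteristic
      0, so the point remembers the exponents.\<close>
    have x: "(curve e 2 :: 'k ^ 'n) \<in> Z (Suc i)"
    proof -
      have "(\<Sum>j\<in>UNIV. u j * int (e j)) = 0" if u: "u \<in> rel (w ` {..Suc i})" for u
      proof -
        have "(\<Sum>j\<in>UNIV. u j * w (Suc i) j) = 0" "(\<Sum>j\<in>UNIV. u j * w 0 j) = 0"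
          using u by (auto simp: rel_def)
        moreover have "(\<Sum>j\<in>UNIV. u j * int (e j)) = (\<Sum>j\<in>UNIV. u j * w (Suc i) j) + (\<Sum>j\<in>UNIV. u j * w 0 j) * S"
          by (simp add: e_def nonneg distrib_left sum.distrib w0 sum_distrib_right)
        ultimately show ?thesis
          by simp
      qed
      then show ?thesis
        unfolding Z_def using curve_in_torus[of "rel (w ` {..Suc i})" e "2 :: 'k"] torus_subset_variety by auto
    qed
    have "(curve e 2 :: 'k ^ 'n) \<notin> Z i"
    proof
      assume *: "(curve e 2 :: 'k ^ 'n) \<in> Z i"
      \<comment> \<open>Rows up to \<open>i\<close> take equal values at the pivots
        \<open>b (Suc i)\<close> and \<open>b 0\<close>, so these two coordinates agree on
        \<open>Z i\<close>. Row \<open>Suc i\<close> tells them apart.\<close>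
      define p where "p k j = (if j = b k then 1 else 0 :: nat)" for k j
      have "(\<lambda>j. int (p (Suc i) j) - int (p 0 j)) \<in> rel (w ` {..i})"
      proof -
        have "(\<Sum>j\<in>UNIV. (int (p (Suc i) j) - int (p 0 j)) * w l j) = 0" if "l \<le> i" for l
        proof -
          have "(\<Sum>j\<in>UNIV. (int (p (Suc i) j) - int (p 0 j)) * w l j) =
              (\<Sum>j\<in>UNIV. (if j = b (Suc i) then w l j else 0) - (if j = b 0 then w l j else 0))"
            by (intro sum.cong) (auto simp: p_def)
          also have "\<dots> = w l (b (Suc i)) - w l (b 0)"
            by (simp add: sum_subtractf)
          also have "\<dots> = 0"
            using w[of l "Suc i"] w[of l 0] that i by (cases "l = 0") (auto simp: w0)
          finally show ?thesis .
        qed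
        then show ?thesis
          by (auto simp: rel_def)
      qed
      then have "xpow (p (Suc i)) (curve e 2 :: 'k ^ 'n) = xpow (p 0) (curve e 2)"
        using * unfolding Z_def by (intro xpow_eq_variety[of _ "rel (w ` {..i})"])
      moreover have "(\<Sum>j\<in>UNIV. p k j * e j) = e (b k)" for k
        by (simp add: p_def if_distrib[of "\<lambda>c. c * _"] cong: if_cong)
      ultimately have "(of_nat (2 ^ e (b (Suc i))) :: 'k) = of_nat (2 ^ e (b 0))"
        by (simp add: xpow_curve)
      then have "e (b (Suc i)) = e (b 0)"
        unfolding of_nat_eq_iff by simp
      then have "w (Suc i) (b (Suc i)) = w (Suc i) (b 0)"
        using nonneg[of "b (Suc i)"] nonneg[of "b 0"] by (simp add: e_def)
      then show False
        using w[of "Suc i" "Suc i"] w[of "Suc i" 0] i N by auto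
    qed
    with x show "Z i \<noteq> Z (Suc i)"
      by blast
  qed
qed

lemma krull_dim_variety:
  "krull_dim (subtopology zariski (binomial_variety R :: ('k::field_char_0 ^ 'n) set)) = enat (r - 1)"
  unfolding krull_dim_def
proof (rule Sup_eqI)
  fix y assume "y \<in> {enat l |l. \<exists>Z :: nat \<Rightarrow> ('k ^ 'n) set.
     (\<forall>i\<le>l. irreducible_closed (subtopology zariski (binomial_variety R)) (Z i)) \<and> (\<forall>i<l. Z i \<subset> Z (Suc i))}"
  then show "y \<le> enat (r - 1)"
    using chain_length_bound by auto
next
  fix y assume y: "\<And>z. z \<in> {enat l |l. \<exists>Z :: nat \<Rightarrow> ('k ^ 'n) set.
     (\<forall>i\<le>l. irreducible_closed (subtopology zariski (binomial_variety R)) (Z i)) \<and> (\<forall>i<l. Z i \<subset> Z (Suc i))} \<Longrightarrow> z \<le> y"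
  obtain Z :: "nat \<Rightarrow> ('k ^ 'n) set" where
    "\<forall>i\<le>r - 1. irreducible_closed (subtopology zariski (binomial_variety R)) (Z i)"
    "\<forall>i<r - 1. Z i \<subset> Z (Suc i)"
    by (rule exists_chain)
  then show "enat (r - 1) \<le> y"
    by (intro y) blast
qed

end


section \<open>Conormal vectors and the dual variety\<close>

text \<open>A vector outside the span is separated from it by a linear functional, which in
  coordinates is the pairing with some \<open>y\<close>.\<close>

lemma in_span_of_annihilator:
  fixes h :: "'k::field ^ 'n::finite"
  assumes "\<And>y. (\<And>s. s \<in> S \<Longrightarrow> (\<Sum>j\<in>UNIV. vec_nth s j * vec_nth y j) = 0) \<Longrightarrow> (\<Sum>j\<in>UNIV. vec_nth h j * vec_nth y j) = 0"
  shows "h \<in> vec.span S"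
proof (rule ccontr)
  assume h: "h \<notin> vec.span S"
  obtain B where B: "B \<subseteq> S" "vec.independent B" "S \<subseteq> vec.span B"
    by (rule vec.maximal_independent_subset)
  then have "h \<notin> vec.span B"
    using h vec.span_mono by blast
  then have "vec.independent (insert h B)"
    using B(2) by (simp add: vec.independent_insertI)
  interpret functional: vector_space_pair "(*s) :: 'k \<Rightarrow> 'k ^ 'n \<Rightarrow> 'k ^ 'n" "(*) :: 'k \<Rightarrow> 'k \<Rightarrow> 'k"
    by unfold_locales (auto simp: algebra_simps)
  obtain g where g: "Vector_Spaces.linear (*s) (*) g" and gB: "\<forall>x\<in>insert h B. g x = (if x = h then 1 else 0)"
    using functional.linear_independent_extend[OF \<open>vec.independent (insert h B)\<close>, of "\<lambda>x. if x = h then 1 else 0"] by blast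
  interpret g: Vector_Spaces.linear "(*s)" "(*)" g
    by (rule g)
  define y :: "'k ^ 'n" where "y = vec_lambda (\<lambda>j. g (axis j 1))"
  have gy: "g v = (\<Sum>j\<in>UNIV. vec_nth v j * vec_nth y j)" for v
  proof -
    have "g v = g (\<Sum>j\<in>UNIV. vec_nth v j *s axis j 1)"
      by (simp only: basis_expansion)
    then show ?thesis
      by (simp only: g.sum g.scale y_def vec_lambda_beta)
  qed
  have "g s = 0" if "s \<in> vec.span B" for s
  proof (rule g.eq_0_on_span[OF _ that])
    fix b assume "b \<in> B"
    then show "g b = 0"
      using gB \<open>h \<notin> vec.span B\<close> vec.span_base[of b B] by auto
  qed
  then have "g h = 0"
    unfolding gy using assms B(3) by blast
  then show False
    using gB by simp
qed

text \<open>The linear functional on polynomials with value \<open>\<psi> \<alpha>\<close> on the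
  monomial \<open>\<alpha>\<close>. Evaluation and the operators \<open>coord j\<close> times
  \<open>mpoly_pderiv j\<close>, taken at a point, have this form.\<close>

definition coeff_sum :: "(('n \<Rightarrow>\<^sub>0 nat) \<Rightarrow> 'k) \<Rightarrow> ('n::finite, 'k::field) mpoly \<Rightarrow> 'k" where
  "coeff_sum \<psi> f = (\<Sum>\<alpha>\<in>Poly_Mapping.keys f. Poly_Mapping.lookup f \<alpha> * \<psi> \<alpha>)"

lemma coeff_sum_diff: "coeff_sum \<psi> (f - g) = coeff_sum \<psi> f - coeff_sum \<psi> g"
proof -
  let ?S = "Poly_Mapping.keys f \<union> Poly_Mapping.keys g"
  have *: "coeff_sum \<psi> h = (\<Sum>\<alpha>\<in>?S. Poly_Mapping.lookup h \<alpha> * \<psi> \<alpha>)" if "Poly_Mapping.keys h \<subseteq> ?S" for h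
    unfolding coeff_sum_def by (rule sum.mono_neutral_left) (use that in \<open>auto simp: in_keys_iff\<close>)
  have "Poly_Mapping.keys (f - g) \<subseteq> ?S"
    by (auto simp: in_keys_iff lookup_minus)
  then show ?thesis
    by (simp add: * lookup_minus left_diff_distrib sum_subtractf)
qed

lemma coeff_sum_monomial_of: "coeff_sum \<psi> (monomial_of e) = \<psi> (Abs_poly_mapping e)"
  by (simp add: coeff_sum_def monomial_of_def)

text \<open>Multiplying the derivative by the coordinate restores the exponent, so each monomial is
  only multiplied by its degree in that variable.\<close>

lemma coord_mult_pderiv:
  "vec_nth x j * mpoly_eval (mpoly_pderiv j f) x =
    coeff_sum (\<lambda>\<alpha>. of_nat (Poly_Mapping.lookup \<alpha> j) * xpow (Poly_Mapping.lookup \<alpha>) x) f"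
proof -
  have *: "vec_nth x j * (of_nat (Poly_Mapping.lookup \<alpha> j) * c *
      (\<Prod>i\<in>UNIV. vec_nth x i ^ Poly_Mapping.lookup (\<alpha> - Poly_Mapping.single j 1) i)) =
      c * (of_nat (Poly_Mapping.lookup \<alpha> j) * xpow (Poly_Mapping.lookup \<alpha>) x)" for \<alpha> and c :: 'a
  proof (cases "Poly_Mapping.lookup \<alpha> j")
    case (Suc n)
    have "xpow (Poly_Mapping.lookup \<alpha>) x = vec_nth x j ^ Suc n * (\<Prod>i\<in>UNIV - {j}. vec_nth x i ^ Poly_Mapping.lookup \<alpha> i)"
      unfolding xpow_def Suc[symmetric] by (rule prod.remove) auto
    moreover have "(\<Prod>i\<in>UNIV. vec_nth x i ^ Poly_Mapping.lookup (\<alpha> - Poly_Mapping.single j 1) i) =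
        vec_nth x j ^ n * (\<Prod>i\<in>UNIV - {j}. vec_nth x i ^ Poly_Mapping.lookup \<alpha> i)"
      by (subst prod.remove[of _ j]) (auto simp: Suc lookup_minus lookup_single when_def intro!: prod.cong)
    ultimately show ?thesis
      by simp
  qed simp
  show ?thesis
    unfolding mpoly_pderiv_def coeff_sum_def mpoly_eval_sum mpoly_eval_single sum_distrib_left * ..
qed

section \<open>Tangent spaces and conormal vectors at torus points\<close>

context echelon_rel
begin

lemma R_rows: "rel (w ` {..r - 1}) = R"
  by (rule R_initial_rows[symmetric])

lemma vanishes_variety_iff:
  fixes f :: "('n, 'k::field_char_0) mpoly"
  shows "vanishes_on f (binomial_variety R) \<longleftrightarrow> vanishes_on f (binomial_torus R)"
  using vanishes_on_variety[of f] torus_subset_variety[of R] unfolding R_rows by (auto simp: vanishes_on_def)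

text \<open>The binomial of a relation \<open>u\<close> has as its differential at \<open>y\<close>
  a nonzero multiple of the pairing of \<open>u\<close> with \<open>v / y\<close>. Conversely, for
  \<open>v / y\<close> orthogonal to the relations, the derivative along \<open>v\<close> takes
  equal values on monomials of one class, so it kills every polynomial vanishing on the
  variety.\<close>

lemma tangent_space_torus:
  fixes y :: "'k::field_char_0 ^ 'n"
  assumes y: "y \<in> binomial_torus R"
  shows "tangent_space (binomial_variety R) y = {v. vec_lambda (\<lambda>j. vec_nth v j / vec_nth y j) \<in> annihilator}"
proof (intro Set.set_eqI iffI CollectI)
  have nz: "vec_nth y j \<noteq> 0" for j
    using y by (simp add: binomial_torus_def)
  have deriv: "mpoly_eval (mpoly_pderiv j f) y = coeff_sum (\<lambda>\<alpha>. of_nat (Poly_Mapping.lookup \<alpha> j) * xpow (Poly_Mapping.lookup \<alpha>) y) f / vec_nth y j"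
    for j and f :: "('n, 'k) mpoly"
    using coord_mult_pderiv[of y j f] nz[of j] by (simp add: field_simps)
  fix v
  {
    assume v: "v \<in> tangent_space (binomial_variety R) y"
    show "vec_lambda (\<lambda>j. vec_nth v j / vec_nth y j) \<in> annihilator"
      unfolding annihilator_def
    proof (intro CollectI ballI)
      fix u assume u: "u \<in> R"
      let ?f = "monomial_of (\<lambda>j. nat (u j)) - monomial_of (\<lambda>j. nat (- u j)) :: ('n, 'k) mpoly"
      have "homogeneous ?f"
        using sum_rel u R_rows by (intro homogeneous_binomial) auto
      moreover have "\<forall>z\<in>binomial_variety R. mpoly_eval ?f z = 0"
        using u by (auto simp: binomial_variety_def)
      ultimately have 0: "(\<Sum>j\<in>UNIV. mpoly_eval (mpoly_pderiv j ?f) y * vec_nth v j) = 0"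
        using v unfolding tangent_space_def by blast
      have "mpoly_eval (mpoly_pderiv j ?f) y = xpow (\<lambda>j. nat (u j)) y * of_int (u j) / vec_nth y j" for j
      proof -
        have "xpow (\<lambda>j. nat (- u j)) y = xpow (\<lambda>j. nat (u j)) y"
          using y u by (simp add: binomial_torus_def)
        then have "mpoly_eval (mpoly_pderiv j ?f) y = (of_nat (nat (u j)) - of_nat (nat (- u j))) * xpow (\<lambda>j. nat (u j)) y / vec_nth y j"
          by (simp add: deriv coeff_sum_diff coeff_sum_monomial_of left_diff_distrib)
        moreover have "(of_nat (nat (u j)) - of_nat (nat (- u j)) :: 'k) = of_int (u j)"
          by (cases "u j \<ge> 0") auto
        ultimately show ?thesis
          by (simp add: mult.commute)
      qed
      then have "xpow (\<lambda>j. nat (u j)) y * (\<Sum>j\<in>UNIV. of_int (u j) * (vec_nth v j / vec_nth y j)) = 0"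
        using 0 by (simp add: sum_distrib_left mult.assoc)
      then show "(\<Sum>j\<in>UNIV. of_int (u j) * vec_nth (vec_lambda (\<lambda>j. vec_nth v j / vec_nth y j)) j) = 0"
        using xpow_nonzero[of y] nz by simp
    qed
  next
    assume v: "v \<in> {v. vec_lambda (\<lambda>j. vec_nth v j / vec_nth y j) \<in> annihilator}"
    show "v \<in> tangent_space (binomial_variety R) y"
      unfolding tangent_space_def
    proof (intro CollectI allI impI, elim conjE)
      fix f :: "('n, 'k) mpoly" assume "\<forall>z\<in>binomial_variety R. mpoly_eval f z = 0"
      then have f: "vanishes_on f (binomial_torus (rel (w ` {..r - 1})))"
        unfolding R_rows vanishes_variety_iff[symmetric] by (simp add: vanishes_on_def)
      \<comment> \<open>The derivative at \<open>y\<close> in direction \<open>v\<close> of the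
        monomial \<open>\<alpha>\<close>.\<close>
      define \<psi> where "\<psi> \<alpha> = (\<Sum>j\<in>UNIV. of_nat (Poly_Mapping.lookup \<alpha> j) * (vec_nth v j / vec_nth y j)) * xpow (Poly_Mapping.lookup \<alpha>) y" for \<alpha>
      have "coeff_sum \<psi> f = 0"
        unfolding coeff_sum_def
      proof (rule class_sum_zero_of_torus[OF f])
        fix \<alpha> \<beta> assume *: "exp_diff \<alpha> \<beta> \<in> rel (w ` {..r - 1})"
        then have "(\<Sum>j\<in>UNIV. of_int (exp_diff \<alpha> \<beta> j) * (vec_nth v j / vec_nth y j)) = 0"
          using v unfolding R_rows by (simp add: annihilator_def)
        moreover have "xpow (Poly_Mapping.lookup \<alpha>) y = xpow (Poly_Mapping.lookup \<beta>) y"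
          using * y torus_subset_variety[of R] unfolding R_rows by (intro xpow_eq_variety[of y R]) (auto simp: exp_diff_def)
        ultimately show "\<psi> \<alpha> = \<psi> \<beta>"
          by (simp add: \<psi>_def exp_diff_def left_diff_distrib sum_subtractf del: times_divide_eq_right)
      qed
      moreover have "(\<Sum>j\<in>UNIV. mpoly_eval (mpoly_pderiv j f) y * vec_nth v j) = coeff_sum \<psi> f"
        unfolding deriv coeff_sum_def \<psi>_def
        by (simp add: sum_distrib_left sum_distrib_right sum_divide_distrib mult_ac sum.swap[of _ UNIV])
      ultimately show "(\<Sum>j\<in>UNIV. mpoly_eval (mpoly_pderiv j f) y * vec_nth v j) = 0"
        by simp
    qed
  }
qed

lemma torus_subset_regular: "binomial_torus R \<subseteq> regular_points (binomial_variety R :: ('k::field_char_0 ^ 'n) set)"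
proof
  fix y :: "'k ^ 'n" assume y: "y \<in> binomial_torus R"
  then have nz: "vec_nth y j \<noteq> 0" for j
    by (simp add: binomial_torus_def)
  define D where "D v = vec_lambda (\<lambda>j. vec_nth y j * vec_nth v j)" for v
  have "Vector_Spaces.linear (*s) (*s) D"
    by (simp add: Vector_Spaces.linear_iff vec.vector_space_axioms D_def Finite_Cartesian_Product.vec_eq_iff distrib_left mult_ac)
  moreover have "inj D"
    using nz by (auto simp: inj_on_def D_def Finite_Cartesian_Product.vec_eq_iff)
  moreover have "tangent_space (binomial_variety R) y = D ` annihilator"
  proof (intro Set.set_eqI iffI)
    fix v assume "v \<in> tangent_space (binomial_variety R) y"
    then have "vec_lambda (\<lambda>j. vec_nth v j / vec_nth y j) \<in> annihilator"
      by (simp add: tangent_space_torus[OF y])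
    moreover have "v = D (vec_lambda (\<lambda>j. vec_nth v j / vec_nth y j))"
      using nz by (simp add: D_def Finite_Cartesian_Product.vec_eq_iff)
    ultimately show "v \<in> D ` annihilator"
      by blast
  next
    fix v assume "v \<in> D ` annihilator"
    then obtain z where z: "v = D z" "z \<in> annihilator"
      by blast
    then have "vec_lambda (\<lambda>j. vec_nth v j / vec_nth y j) = z"
      using nz by (simp add: D_def Finite_Cartesian_Product.vec_eq_iff)
    then show "v \<in> tangent_space (binomial_variety R) y"
      using z by (simp add: tangent_space_torus[OF y])
  qed
  ultimately have "vec.dim (tangent_space (binomial_variety R) y) = r"
    using vec.dim_image_eq[of D annihilator] by (simp add: dim_annihilator inj_on_subset)
  then show "y \<in> regular_points (binomial_variety R)"
    using y torus_subset_variety[of R] r by (auto simp: regular_points_def krull_dim_variety one_enat_def)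
qed

text \<open>Conormality in logarithmic coordinates: the componentwise product of \<open>h\<close>
  and \<open>y\<close> is orthogonal to the row space.\<close>

definition torus_conormals :: "('k::field ^ 'n) set" where
  "torus_conormals = {h. h \<noteq> 0 \<and> (\<exists>y\<in>binomial_torus R. \<forall>v\<in>annihilator. (\<Sum>j\<in>UNIV. vec_nth h j * vec_nth y j * vec_nth v j) = 0)}"

text \<open>A conormal vector at any point \<open>x\<close> of the variety, regular or not, is a combination \<open>H x\<close> of gradients of
  equations. Replacing \<open>x\<close> by the points of the torus gives conormal vectors \<open>H y\<close>, of which \<open>H x\<close> is a limit.\<close>

lemma conormal_in_closure:
  fixes x h :: "'k::field_char_0 ^ 'n"
  assumes x: "x \<in> binomial_variety R" and h: "tangent_space (binomial_variety R) x \<subseteq> hyperplane h"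
    and g: "homogeneous g" "vanishes_on g torus_conormals" and "h \<noteq> 0"
  shows "mpoly_eval g h = 0"
proof -
  define grad where "grad f z = vec_lambda (\<lambda>j. mpoly_eval (mpoly_pderiv j f) z)" for f and z :: "'k ^ 'n"
  define I where "I = {f :: ('n, 'k) mpoly. homogeneous f \<and> (\<forall>z\<in>binomial_variety R. mpoly_eval f z = 0)}"
  have tangent: "v \<in> tangent_space (binomial_variety R) z \<longleftrightarrow> (\<forall>f\<in>I. (\<Sum>j\<in>UNIV. vec_nth (grad f z) j * vec_nth v j) = 0)" for v z
    by (auto simp: tangent_space_def I_def grad_def)
  have "h \<in> vec.span ((\<lambda>f. grad f x) ` I)"
  proof (rule in_span_of_annihilator)
    fix y assume "\<And>s. s \<in> (\<lambda>f. grad f x) ` I \<Longrightarrow> (\<Sum>j\<in>UNIV. vec_nth s j * vec_nth y j) = 0"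
    then have "y \<in> tangent_space (binomial_variety R) x"
      unfolding tangent by blast
    then show "(\<Sum>j\<in>UNIV. vec_nth h j * vec_nth y j) = 0"
      using h by (auto simp: hyperplane_def)
  qed
  then obtain t c where t: "finite t" "t \<subseteq> (\<lambda>f. grad f x) ` I" and hc: "h = (\<Sum>s\<in>t. c s *s s)"
    by (auto simp: vec.span_explicit)
  from t(2) have "\<forall>s\<in>t. \<exists>f\<in>I. s = grad f x"
    by blast
  then obtain F where F: "\<And>s. s \<in> t \<Longrightarrow> F s \<in> I \<and> s = grad (F s) x"
    by metis
  define G where "G j = (\<Sum>s\<in>t. Poly_Mapping.single 0 (c s) * mpoly_pderiv j (F s))" for j
  define H where "H z = vec_lambda (\<lambda>j. mpoly_eval (G j) z)" for z
  have H_eq: "H z = (\<Sum>s\<in>t. c s *s grad (F s) z)" for z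
    by (simp add: H_def G_def grad_def Finite_Cartesian_Product.vec_eq_iff)
  have Hx: "H x = h"
    unfolding H_eq hc using F by (intro sum.cong) auto
  have H_torus: "H y = 0 \<or> H y \<in> torus_conormals" if y: "y \<in> binomial_torus R" for y
  proof -
    have "(\<Sum>j\<in>UNIV. vec_nth (H y) j * vec_nth y j * vec_nth v j) = 0" if v: "v \<in> annihilator" for v
    proof -
      define v' where "v' = vec_lambda (\<lambda>j. vec_nth y j * vec_nth v j)"
      have "vec_lambda (\<lambda>j. vec_nth v' j / vec_nth y j) = v"
        using y by (simp add: v'_def binomial_torus_def Finite_Cartesian_Product.vec_eq_iff)
      then have "v' \<in> tangent_space (binomial_variety R) y"
        using v by (simp add: tangent_space_torus[OF y])
      then have "(\<Sum>j\<in>UNIV. vec_nth (grad (F s) y) j * vec_nth v' j) = 0" if "s \<in> t" for s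
        using F[OF that] unfolding tangent by blast
      then have "(\<Sum>s\<in>t. c s * (\<Sum>j\<in>UNIV. vec_nth (grad (F s) y) j * vec_nth v' j)) = 0"
        by simp
      moreover have "(\<Sum>j\<in>UNIV. vec_nth (H y) j * vec_nth y j * vec_nth v j) = (\<Sum>s\<in>t. c s * (\<Sum>j\<in>UNIV. vec_nth (grad (F s) y) j * vec_nth v' j))"
        by (simp add: H_eq v'_def sum_distrib_left sum_distrib_right mult.assoc sum.swap[of _ t])
      ultimately show ?thesis
        by simp
    qed
    then show ?thesis
      using y by (auto simp: torus_conormals_def)
  qed
  have Hg: "mpoly_eval (mpoly_subst g G) z = mpoly_eval g (H z)" for z
    by (simp add: mpoly_eval_subst H_def)
  obtain j where j: "vec_nth h j \<noteq> 0"
    using \<open>h \<noteq> 0\<close> by (auto simp: Finite_Cartesian_Product.vec_eq_iff)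
  \<comment> \<open>The factor \<open>G j\<close> covers torus points with \<open>H y = 0\<close>,
    which are not conormal vectors and where a form of degree 0 need not vanish. At \<open>x\<close>
    this factor is nonzero.\<close>
  have "vanishes_on (mpoly_subst g G * G j) (binomial_torus R)"
    unfolding vanishes_on_def
  proof
    fix y :: "'k ^ 'n" assume "y \<in> binomial_torus R"
    then consider "H y = 0" | "H y \<in> torus_conormals"
      using H_torus by blast
    then show "mpoly_eval (mpoly_subst g G * G j) y = 0"
    proof cases
      case 1
      then have "vec_nth (H y) j = 0"
        by simp
      then show ?thesis
        by (simp add: H_def)
    next
      case 2
      then show ?thesis
        using g(2) by (simp add: Hg vanishes_on_def)
    qed
  qed
  then have "vanishes_on (mpoly_subst g G * G j) (binomial_variety R)"
    by (simp only: vanishes_variety_iff)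
  then have "mpoly_eval (mpoly_subst g G * G j) x = 0"
    using x by (simp only: vanishes_on_def)
  moreover have "mpoly_eval (G j) x = vec_nth h j"
    using Hx by (auto simp: H_def)
  ultimately show ?thesis
    using j by (simp add: Hg Hx)
qed

lemma dual_variety_eq:
  "dual_variety (binomial_variety R) =
    {h :: 'k::field_char_0 ^ 'n. h \<noteq> 0 \<and> (\<forall>g. homogeneous g \<and> vanishes_on g torus_conormals \<longrightarrow> mpoly_eval g h = 0)}"
proof -
  define N :: "('k ^ 'n) set" where "N = {h. h \<noteq> 0 \<and> (\<exists>x\<in>regular_points (binomial_variety R). x \<in> hyperplane h \<and>
    tangent_space (binomial_variety R) x \<subseteq> hyperplane h)}"
  have sub: "torus_conormals \<subseteq> N"
  proof
    fix h :: "'k ^ 'n" assume "h \<in> torus_conormals"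
    then obtain y where h: "h \<noteq> 0" and y: "y \<in> binomial_torus R"
      and ann: "\<And>v. v \<in> annihilator \<Longrightarrow> (\<Sum>j\<in>UNIV. vec_nth h j * vec_nth y j * vec_nth v j) = 0"
      by (auto simp: torus_conormals_def)
    have nz: "vec_nth y j \<noteq> 0" for j
      using y by (simp add: binomial_torus_def)
    have tangent: "tangent_space (binomial_variety R) y \<subseteq> hyperplane h"
    proof
      fix v assume "v \<in> tangent_space (binomial_variety R) y"
      then have "vec_lambda (\<lambda>j. vec_nth v j / vec_nth y j) \<in> annihilator"
        by (simp add: tangent_space_torus[OF y])
      from ann[OF this] show "v \<in> hyperplane h"
        using nz by (simp add: hyperplane_def)
    qed
    \<comment> \<open>Euler's relation: in logarithmic coordinates \<open>y\<close> is the all-ones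
      vector, which is orthogonal to every relation.\<close>
    moreover have "y \<in> tangent_space (binomial_variety R) y"
    proof -
      have "(\<Sum>j\<in>UNIV. of_int (u j) :: 'k) = 0" if "u \<in> R" for u
        using sum_rel[unfolded R_rows, OF that] by (simp flip: of_int_sum)
      then show ?thesis
        using nz by (simp add: tangent_space_torus[OF y] annihilator_def)
    qed
    ultimately show "h \<in> N"
      using h y torus_subset_regular unfolding N_def by blast
  qed
  have "vanishes_on g N" if "homogeneous g" "vanishes_on g torus_conormals" for g :: "('n, 'k) mpoly"
    unfolding vanishes_on_def
  proof
    fix h assume "h \<in> N"
    then show "mpoly_eval g h = 0"
      using that by (auto simp: N_def regular_points_def intro: conormal_in_closure)
  qed
  then have "homogeneous g \<and> vanishes_on g N \<longleftrightarrow> homogeneous g \<and> vanishes_on g torus_conormals" for g :: "('n, 'k) mpoly"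
    using sub by (auto simp: vanishes_on_def)
  moreover have "dual_variety (binomial_variety R) = zariski closure_of N"
    by (simp add: dual_variety_def N_def)
  moreover have "0 \<notin> N"
    by (simp add: N_def)
  ultimately show ?thesis
    by (simp add: closure_of_zariski)
qed

text \<open>Forms are pulled back along \<open>P\<close> and its inverse, and on either side
  vanishing need only be tested over the torus. The second assumption aims at the variety and not at
  its torus because a conormal vector at a torus point may have zero coordinates.\<close>

lemma self_dual_criterion:
  fixes P :: "'k::field_char_0 ^ 'n ^ 'n"
  assumes P: "invertible P"
    and torus: "\<And>x. x \<in> binomial_torus R \<Longrightarrow> P *v x \<in> torus_conormals"
    and conormal: "\<And>x. P *v x \<in> torus_conormals \<Longrightarrow> x \<in> binomial_variety R"
  shows "self_dual (binomial_variety R :: ('k ^ 'n) set)"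
  unfolding self_dual_def
proof (intro exI[of _ P] conjI P)
  obtain P' where P': "P' ** P = Finite_Cartesian_Product.mat 1" "P ** P' = Finite_Cartesian_Product.mat 1"
    using P by (auto simp: invertible_def)
  have inv: "P *v (P' *v x) = x" "P' *v (P *v x) = x" for x
    by (simp_all add: matrix_vector_mul_assoc P')
  have X: "closedin zariski (binomial_variety R :: ('k ^ 'n) set)"
    using closedin_variety unfolding R_rows .
  show "(\<lambda>x. P *v x) ` binomial_variety R = dual_variety (binomial_variety R)"
  proof (intro Set.set_eqI iffI)
    fix h :: "'k ^ 'n" assume "h \<in> (\<lambda>x. P *v x) ` binomial_variety R"
    then obtain x where x: "x \<in> binomial_variety R" and h: "h = P *v x"
      by blast
    have "x \<noteq> 0"
      using x by (simp add: binomial_variety_def)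
    then have "h \<noteq> 0"
      using inv(2)[of x] by (auto simp: h)
    moreover have "mpoly_eval g h = 0" if g: "homogeneous g" "vanishes_on g torus_conormals" for g
    proof -
      obtain g' where g': "\<And>x. mpoly_eval g' x = mpoly_eval g (P *v x)"
        using homogeneous_linear_subst[OF g(1)] by blast
      have "vanishes_on g' (binomial_torus R)"
        using g(2) torus by (simp add: vanishes_on_def g')
      then have "vanishes_on g' (binomial_variety R)"
        by (simp add: vanishes_variety_iff)
      then show ?thesis
        using x by (simp add: vanishes_on_def g' h)
    qed
    ultimately show "h \<in> dual_variety (binomial_variety R)"
      by (simp add: dual_variety_eq)
  next
    fix h :: "'k ^ 'n" assume "h \<in> dual_variety (binomial_variety R)"
    then have h: "h \<noteq> 0" and van: "\<And>g. homogeneous g \<Longrightarrow> vanishes_on g torus_conormals \<Longrightarrow> mpoly_eval g h = 0"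
      by (auto simp: dual_variety_eq)
    have "P' *v h \<in> binomial_variety R"
    proof -
      have "mpoly_eval f (P' *v h) = 0" if f: "homogeneous f" "vanishes_on f (binomial_variety R)" for f
      proof -
        obtain f' where f': "homogeneous f'" "\<And>x. mpoly_eval f' x = mpoly_eval f (P' *v x)"
          using homogeneous_linear_subst[OF f(1)] by blast
        have "vanishes_on f' torus_conormals"
          using f(2) conormal by (auto simp: vanishes_on_def f' inv)
        then have "mpoly_eval f' h = 0"
          by (rule van[OF f'(1)])
        then show ?thesis
          by (simp add: f')
      qed
      moreover have "P' *v h \<noteq> 0"
        using h inv(1)[of h] by auto
      ultimately show ?thesis
        using X unfolding closedin_zariski_iff by blast
    qed
    then show "h \<in> (\<lambda>x. P *v x) ` binomial_variety R"
      using inv(1) by (metis image_eqI)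
  qed
qed

end


section \<open>Self-duality from a block structure\<close>

lemma xpow_mult: "xpow e (vec_lambda (\<lambda>j. f j * vec_nth x j)) = xpow e (vec_lambda f) * xpow e x"
  by (simp add: xpow_def power_mult_distrib prod.distrib)

lemma xpow_inverse: "xpow e (vec_lambda (\<lambda>j. inverse (vec_nth x j))) = inverse (xpow e x)"
  by (simp add: xpow_def power_inverse prod_inversef[unfolded o_def])

lemma inverse_in_torus: "x \<in> binomial_torus R \<Longrightarrow> vec_lambda (\<lambda>j. inverse (vec_nth x j)) \<in> binomial_torus R"
  by (simp add: binomial_torus_def xpow_inverse)

text \<open>Both sides contain every \<open>s k\<close> to the same power, hence the equality persists where \<open>s\<close> vanishes.\<close>

lemma xpow_label_scaling:
  fixes u :: "'n::finite \<Rightarrow> int" and \<kappa> :: "'n \<Rightarrow> 'l"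
  assumes "\<And>k. (\<Sum>j | \<kappa> j = k. u j) = 0"
  shows "xpow (\<lambda>j. nat (u j)) (vec_lambda (\<lambda>j. s (\<kappa> j))) = xpow (\<lambda>j. nat (- u j)) (vec_lambda (\<lambda>j. s (\<kappa> j)))"
proof -
  have eq: "xpow e (vec_lambda (\<lambda>j. s (\<kappa> j))) = (\<Prod>k\<in>range \<kappa>. s k ^ (\<Sum>j | \<kappa> j = k. e j))" for e
  proof -
    have "xpow e (vec_lambda (\<lambda>j. s (\<kappa> j))) = (\<Prod>j\<in>UNIV. s (\<kappa> j) ^ e j)"
      by (simp add: xpow_def)
    also have "\<dots> = (\<Prod>k\<in>range \<kappa>. \<Prod>j | \<kappa> j = k. s (\<kappa> j) ^ e j)"
      by (subst prod.group[of UNIV "range \<kappa>" \<kappa>, symmetric]) auto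
    also have "\<dots> = (\<Prod>k\<in>range \<kappa>. s k ^ (\<Sum>j | \<kappa> j = k. e j))"
      by (intro prod.cong refl) (simp add: power_sum)
    finally show ?thesis .
  qed
  have "(\<Sum>j | \<kappa> j = k. nat (u j)) = (\<Sum>j | \<kappa> j = k. nat (- u j))" for k
  proof -
    have "(\<Sum>j | \<kappa> j = k. int (nat (u j)) - int (nat (- u j))) = (\<Sum>j | \<kappa> j = k. u j)"
      by (intro sum.cong) auto
    then have "int (\<Sum>j | \<kappa> j = k. nat (u j)) = int (\<Sum>j | \<kappa> j = k. nat (- u j))"
      using assms[of k] by (simp add: sum_subtractf)
    then show ?thesis
      by (simp only: of_nat_eq_iff)
  qed
  then show ?thesis
    by (simp add: eq)
qed

text \<open>\<open>rep\<close> selects one index among those carrying equal columns and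
  \<open>lab\<close> is the block. The fibre sums of a relation are a multiple of \<open>c\<close>
  depending only on the block, and over \<open>free\<close> columns they are always 0.
  \<open>t\<close> is a single relation whose multipliers vanish at no other block, and
  \<open>card_rep\<close> matches redundant copies with free representatives.\<close>

locale lawrence_rel =
  fixes V :: "('n::finite \<Rightarrow> int) set" and rep :: "'n \<Rightarrow> 'n" and free :: "'n \<Rightarrow> bool" and lab :: "'n \<Rightarrow> nat"
    and c :: "'n \<Rightarrow> int" and t :: "nat \<Rightarrow> int"
  assumes rep_rep: "rep (rep j) = rep j"
    and free_rep: "free (rep j) = free j"
    and lab_rep: "lab (rep j) = lab j"
    and c_nonzero: "\<not> free j \<Longrightarrow> c j \<noteq> 0"
    and rep_rel: "(\<lambda>i. int (if i = j then 1 else 0) - int (if i = rep j then 1 else 0)) \<in> rel V"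
    and free_sum: "u \<in> rel V \<Longrightarrow> free j \<Longrightarrow> (\<Sum>i | rep i = rep j. u i) = 0"
    and fibre_sum: "u \<in> rel V \<Longrightarrow> \<exists>t. \<forall>j. rep j = j \<longrightarrow> \<not> free j \<longrightarrow> (\<Sum>i | rep i = j. u i) = t (lab j) * c j"
    and label_sum: "u \<in> rel V \<Longrightarrow> (\<Sum>j | \<not> free j \<and> lab j = l. u j) = 0"
    and t_nonzero: "\<not> free j \<Longrightarrow> t (lab j) \<noteq> 0"
    and t_rel: "(\<lambda>j. if rep j = j \<and> \<not> free j then t (lab j) * c j else 0) \<in> rel V"
    and card_rep: "card {j. rep j \<noteq> j} = card {j. rep j = j \<and> free j}"
begin

text \<open>Classes of coordinates that may be scaled by a common factor without leaving the
  variety: the non-free columns of one block together, each free column alone with its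
  copies.\<close>

definition key :: "'n \<Rightarrow> 'n + nat" where
  "key j = (if free j then Inl (rep j) else Inr (lab j))"

lemma key_sum:
  assumes u: "u \<in> rel V"
  shows "(\<Sum>j | key j = k. u j) = 0"
proof (cases k)
  case (Inl b)
  show ?thesis
  proof (cases "free b \<and> rep b = b")
    case True
    then have "{j. key j = k} = {j. rep j = rep b}"
      using Inl free_rep by (auto simp: key_def)
    then show ?thesis
      using free_sum[OF u, of b] True by simp
  next
    case False
    then have "{j. key j = k} = {}"
      using Inl free_rep rep_rep by (auto simp: key_def split: if_splits)
    then show ?thesis
      by simp
  qed
next
  case (Inr l)
  then have "{j. key j = k} = {j. \<not> free j \<and> lab j = l}"
    by (auto simp: key_def split: if_splits)
  then show ?thesis
    using label_sum[OF u] by simp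
qed

sublocale projective_rel V
proof
  fix u assume u: "u \<in> rel V"
  have "(\<Sum>j\<in>UNIV. u j) = (\<Sum>k\<in>range key. \<Sum>j | key j = k. u j)"
    by (subst sum.group[of UNIV "range key" key, symmetric]) auto
  then show "(\<Sum>j\<in>UNIV. u j) = 0"
    by (simp add: key_sum[OF u])
qed

lemma torus_rep:
  assumes "x \<in> binomial_torus (rel V)"
  shows "vec_nth x (rep j) = vec_nth x j"
proof -
  have eq: "xpow (\<lambda>i. if i = k then 1 else 0) x = vec_nth x k" for k
    by (simp add: xpow_def if_distrib[of "\<lambda>n. _ ^ n"] cong: if_cong)
  have "xpow (\<lambda>i. if i = j then 1 else 0) x = xpow (\<lambda>i. if i = rep j then 1 else 0) x"
    using assms torus_subset_variety by (intro xpow_eq_variety[OF _ rep_rel]) auto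
  then show ?thesis
    by (simp add: eq)
qed

lemma scaled_torus_point:
  assumes "x \<in> binomial_torus (rel V)" and "u \<in> rel V"
  shows "xpow (\<lambda>j. nat (u j)) (vec_lambda (\<lambda>j. s (key j) * vec_nth x j)) = xpow (\<lambda>j. nat (- u j)) (vec_lambda (\<lambda>j. s (key j) * vec_nth x j))"
  using assms xpow_label_scaling[where \<kappa> = key and u = u and s = s, OF key_sum] by (simp add: xpow_mult binomial_torus_def)

lemma sum_over_reps: "(\<Sum>j\<in>UNIV. g j) = (\<Sum>b | rep b = b. \<Sum>i | rep i = b. g i)"
  by (subst sum.group[of UNIV "{b. rep b = b}" rep, symmetric]) (auto simp: rep_rep)

text \<open>Torus points and members of \<open>annihilator\<close> are constant on the fibres of
  \<open>rep\<close>, so conormality constrains only the fibre sums of a vector. The linear map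
  \<open>F\<close> realizes the required fibre sums. It places the free coordinates, which the
  variety leaves arbitrary, at the redundant copies, which conormality leaves arbitrary.\<close>

theorem self_dual_variety: "self_dual (binomial_variety (rel V) :: ('k::field_char_0 ^ 'n) set)"
proof -
  obtain w b r N where "echelon_rel (rel V) w b r N"
    by (rule echelon_form)
  then interpret echelon_rel "rel V" w b r N .
  have annD: "(\<Sum>j\<in>UNIV. of_int (u j) * vec_nth v j) = 0" if "v \<in> annihilator" "u \<in> rel V" for u and v :: "'k ^ 'n"
    using that by (simp add: annihilator_def)
  obtain \<sigma> where \<sigma>: "bij_betw \<sigma> {j. rep j = j \<and> free j} {j. rep j \<noteq> j}"
    using finite_same_card_bij[of "{j. rep j = j \<and> free j}" "{j. rep j \<noteq> j}"] card_rep by auto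
  define \<tau> where "\<tau> = inv_into {j. rep j = j \<and> free j} \<sigma>"
  have \<tau>\<sigma>: "\<tau> (\<sigma> j) = j" if "rep j = j" "free j" for j
    unfolding \<tau>_def using that \<sigma> by (simp add: bij_betw_inv_into_left)
  have \<sigma>\<tau>: "\<sigma> (\<tau> j) = j" "rep (\<tau> j) = \<tau> j" "free (\<tau> j)" if "rep j \<noteq> j" for j
    unfolding \<tau>_def using that \<sigma> bij_betw_inv_into_right[OF \<sigma>, of j] bij_betwE[OF bij_betw_inv_into[OF \<sigma>]] by auto
  \<comment> \<open>The fibre sums of \<open>F x\<close>. For free \<open>j\<close> this is the
    difference of the two coordinates at the repeated column matched with \<open>j\<close>, which is
    0 on the torus; otherwise it is the diagonal scaling by \<open>c\<close>.\<close>
  define \<phi> :: "'k ^ 'n \<Rightarrow> 'n \<Rightarrow> 'k" where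
    "\<phi> x j = (if free j then vec_nth x (\<sigma> j) - vec_nth x (rep (\<sigma> j)) else of_int (c j) * vec_nth x j)" for x j
  \<comment> \<open>At a representative, the values at the other indices of its fibre are subtracted
    so that the fibre sum becomes \<open>\<phi> x j\<close>.\<close>
  define F :: "'k ^ 'n \<Rightarrow> 'k ^ 'n" where
    "F x = vec_lambda (\<lambda>j. if rep j \<noteq> j then vec_nth x (\<tau> j) else \<phi> x j - (\<Sum>i\<in>{i. rep i = j} - {j}. vec_nth x (\<tau> i)))" for x
  have F_rep: "vec_nth (F x) j = vec_nth x (\<tau> j)" if "rep j \<noteq> j" for x j
    using that by (simp add: F_def)
  have F_sum: "(\<Sum>i | rep i = j. vec_nth (F x) i) = \<phi> x j" if "rep j = j" for x j
  proof -
    have "(\<Sum>i | rep i = j. vec_nth (F x) i) = vec_nth (F x) j + (\<Sum>i\<in>{i. rep i = j} - {j}. vec_nth (F x) i)"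
      using that by (intro sum.remove) auto
    also have "(\<Sum>i\<in>{i. rep i = j} - {j}. vec_nth (F x) i) = (\<Sum>i\<in>{i. rep i = j} - {j}. vec_nth x (\<tau> i))"
      by (intro sum.cong refl F_rep) auto
    finally show ?thesis
      using that by (simp add: F_def)
  qed
  have "Vector_Spaces.linear (*s) (*s) F"
  proof -
    have "F (x + y) = F x + F y" for x y
      by (simp add: F_def \<phi>_def Finite_Cartesian_Product.vec_eq_iff sum.distrib algebra_simps)
    moreover have "F (a *s x) = a *s F x" for a x
      by (simp add: F_def \<phi>_def Finite_Cartesian_Product.vec_eq_iff algebra_simps sum_distrib_left)
    ultimately show ?thesis
      by (simp add: Vector_Spaces.linear_iff vec.vector_space_axioms)
  qed
  then have PF: "matrix F *v x = F x" for x
    by (rule matrix_works)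
  \<comment> \<open>Free coordinates of \<open>x\<close> are read off at redundant copies, non-free
    representatives from their fibre sums, and redundant coordinates from the differences at free
    representatives.\<close>
  have "x = 0" if "F x = 0" for x
  proof -
    have "vec_nth x j = 0" if j: "rep j = j" for j
    proof (cases "free j")
      case True
      then have "rep (\<sigma> j) \<noteq> \<sigma> j"
        using j bij_betwE[OF \<sigma>] by auto
      then show ?thesis
        using F_rep[of "\<sigma> j" x] \<tau>\<sigma>[OF j True] \<open>F x = 0\<close> by simp
    next
      case False
      then show ?thesis
        using F_sum[OF j, of x] \<open>F x = 0\<close> c_nonzero[OF False] by (simp add: \<phi>_def)
    qed
    moreover have "vec_nth x j = vec_nth x (rep j)" if j: "rep j \<noteq> j" for j
      using F_sum[OF \<sigma>\<tau>(2)[OF j], of x] \<open>F x = 0\<close> \<sigma>\<tau>[OF j] by (simp add: \<phi>_def)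
    ultimately have "vec_nth x j = 0" for j
      by (metis rep_rep)
    then show ?thesis
      by (simp add: Finite_Cartesian_Product.vec_eq_iff)
  qed
  then have inv: "invertible (matrix F)"
    unfolding invertible_left_inverse matrix_left_invertible_ker by (simp add: PF)
  have pairing: "(\<Sum>j\<in>UNIV. vec_nth (F x) j * vec_nth y j * vec_nth v j) = (\<Sum>j | rep j = j. vec_nth y j * vec_nth v j * \<phi> x j)"
    if y: "y \<in> binomial_torus (rel V)" and v: "\<And>j. vec_nth v (rep j) = vec_nth v j" for x y v
  proof -
    have "(\<Sum>i | rep i = j. vec_nth (F x) i * vec_nth y i * vec_nth v i) = vec_nth y j * vec_nth v j * \<phi> x j" if j: "rep j = j" for j
    proof -
      have "(\<Sum>i | rep i = j. vec_nth (F x) i * vec_nth y i * vec_nth v i) = (\<Sum>i | rep i = j. vec_nth y j * vec_nth v j * vec_nth (F x) i)"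
      proof (intro sum.cong refl)
        fix i assume "i \<in> {i. rep i = j}"
        then have "vec_nth y i = vec_nth y j" "vec_nth v i = vec_nth v j"
          using torus_rep[OF y, of i] v[of i] by auto
        then show "vec_nth (F x) i * vec_nth y i * vec_nth v i = vec_nth y j * vec_nth v j * vec_nth (F x) i"
          by simp
      qed
      then show ?thesis
        using F_sum[OF j] by (simp flip: sum_distrib_left)
    qed
    then show ?thesis
      unfolding sum_over_reps by (intro sum.cong) auto
  qed
  show ?thesis
  proof (rule self_dual_criterion[OF inv], unfold PF)
    fix x :: "'k ^ 'n" assume x: "x \<in> binomial_torus (rel V)"
    have nz: "vec_nth x j \<noteq> 0" for j
      using x by (simp add: binomial_torus_def)
    \<comment> \<open>The tangency point \<open>y\<close> is \<open>1 / x\<close> scaled by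
      \<open>t\<close> on non-free blocks. Then \<open>y\<close> times \<open>\<phi> x\<close> is
      the relation \<open>t_rel\<close> on representatives, and \<open>v\<close> annihilates
      it.\<close>
    define s :: "'n + nat \<Rightarrow> 'k" where "s k = (case k of Inl _ \<Rightarrow> 1 | Inr l \<Rightarrow> of_int (t l))" for k
    define x' where "x' = vec_lambda (\<lambda>j. inverse (vec_nth x j))"
    define y where "y = vec_lambda (\<lambda>j. s (key j) * vec_nth x' j)"
    have s: "s (key j) = (if free j then 1 else of_int (t (lab j)))" for j
      by (simp add: s_def key_def)
    have "x' \<in> binomial_torus (rel V)"
      unfolding x'_def using x by (rule inverse_in_torus)
    then have y: "y \<in> binomial_torus (rel V)"
      using scaled_torus_point[of x' _ s] t_nonzero nz by (auto simp: y_def binomial_torus_def s x'_def)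
    show "F x \<in> torus_conormals"
      unfolding torus_conormals_def
    proof (intro CollectI conjI bexI[OF _ y] ballI)
      show "F x \<noteq> 0"
        using \<open>\<And>x. F x = 0 \<Longrightarrow> x = 0\<close>[of x] nz by auto
      fix v :: "'k ^ 'n" assume v: "v \<in> annihilator"
      have v_rep: "vec_nth v (rep j) = vec_nth v j" for j
      proof -
        have "(\<Sum>i\<in>UNIV. of_int (int (if i = j then 1 else 0) - int (if i = rep j then 1 else 0)) * vec_nth v i) = 0"
          by (rule annD[OF v rep_rel])
        moreover have "(\<Sum>i\<in>UNIV. of_int (int (if i = j then 1 else 0) - int (if i = rep j then 1 else 0)) * vec_nth v i) =
            (\<Sum>i\<in>UNIV. (if i = j then vec_nth v i else 0) - (if i = rep j then vec_nth v i else 0))"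
          by (intro sum.cong) auto
        ultimately have "(\<Sum>i\<in>UNIV. (if i = j then vec_nth v i else 0) - (if i = rep j then vec_nth v i else 0)) = 0"
          by (simp only:)
        then show ?thesis
          by (simp add: sum_subtractf)
      qed
      have "(\<Sum>j | rep j = j. vec_nth y j * vec_nth v j * \<phi> x j) =
          (\<Sum>j | rep j = j. of_int (if rep j = j \<and> \<not> free j then t (lab j) * c j else 0) * vec_nth v j)"
      proof (intro sum.cong refl)
        fix j assume "j \<in> {j. rep j = j}"
        moreover have "\<phi> x j = 0" if "free j"
          using that torus_rep[OF x, of "\<sigma> j"] by (simp add: \<phi>_def)
        ultimately show "vec_nth y j * vec_nth v j * \<phi> x j = of_int (if rep j = j \<and> \<not> free j then t (lab j) * c j else 0) * vec_nth v j"
          using nz[of j] by (cases "free j") (simp_all add: \<phi>_def y_def x'_def s)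
      qed
      also have "\<dots> = (\<Sum>j\<in>UNIV. of_int (if rep j = j \<and> \<not> free j then t (lab j) * c j else 0) * vec_nth v j)"
        by (intro sum.mono_neutral_left) auto
      also have "\<dots> = 0"
        by (rule annD[OF v t_rel])
      finally show "(\<Sum>j\<in>UNIV. vec_nth (F x) j * vec_nth y j * vec_nth v j) = 0"
        using pairing[OF y v_rep] by simp
    qed
  next
    fix x :: "'k ^ 'n" assume "F x \<in> torus_conormals"
    then obtain y where "F x \<noteq> 0" and y: "y \<in> binomial_torus (rel V)"
      and ann: "\<And>v. v \<in> annihilator \<Longrightarrow> (\<Sum>j\<in>UNIV. vec_nth (F x) j * vec_nth y j * vec_nth v j) = 0"
      by (auto simp: torus_conormals_def)
    have nz: "vec_nth y j \<noteq> 0" for j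
      using y by (simp add: binomial_torus_def)
    \<comment> \<open>Indicators of fibres serve as test vectors. For free \<open>k\<close> they lie
      in \<open>annihilator\<close> by \<open>free_sum\<close>; for two non-free representatives in
      one block, the combination weighted crosswise by \<open>c\<close> does so by
      \<open>fibre_sum\<close>.\<close>
    define ind :: "'n \<Rightarrow> 'n \<Rightarrow> 'k" where "ind k j = (if rep j = k then 1 else 0)" for k j
    have ind_sum: "(\<Sum>j\<in>UNIV. of_int (u j) * ind k j) = of_int (\<Sum>j | rep j = k. u j)" for u k
      by (simp add: ind_def if_distrib[of "\<lambda>z. _ * z"] flip: sum.inter_filter cong: if_cong)
    have ind_pairing: "(\<Sum>j | rep j = j. vec_nth y j * ind k j * \<phi> x j) = vec_nth y k * \<phi> x k" if "rep k = k" for k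
    proof -
      have "(\<Sum>j | rep j = j. vec_nth y j * ind k j * \<phi> x j) = (\<Sum>j | rep j = j. if j = k then vec_nth y k * \<phi> x k else 0)"
        by (intro sum.cong) (auto simp: ind_def)
      then show ?thesis
        using that by simp
    qed
    have ind_rep: "vec_nth (vec_lambda (ind k)) (rep j) = vec_nth (vec_lambda (ind k)) j" for j k
      by (simp add: ind_def rep_rep)
    have x_rep: "vec_nth x (rep j) = vec_nth x j" for j
    proof (cases "rep j = j")
      case False
      note k = \<sigma>\<tau>[OF False]
      have "vec_lambda (ind (\<tau> j)) \<in> annihilator"
        using free_sum[of _ "\<tau> j"] k by (simp add: annihilator_def ind_sum)
      from ann[OF this] have "vec_nth y (\<tau> j) * \<phi> x (\<tau> j) = 0"
        unfolding pairing[OF y ind_rep] unfolding vec_lambda_beta ind_pairing[OF k(2)] .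
      then show ?thesis
        using nz k by (simp add: \<phi>_def)
    qed simp
    have block: "vec_nth x j * vec_nth y j = vec_nth x k * vec_nth y k"
      if j: "rep j = j" "\<not> free j" and k: "rep k = k" "\<not> free k" and jk: "lab j = lab k" for j k
    proof -
      define v :: "'k ^ 'n" where "v = vec_lambda (\<lambda>i. of_int (c k) * ind j i - of_int (c j) * ind k i)"
      have "v \<in> annihilator"
        unfolding annihilator_def
      proof (intro CollectI ballI)
        fix u assume "u \<in> rel V"
        then obtain t' where t': "\<forall>j. rep j = j \<longrightarrow> \<not> free j \<longrightarrow> (\<Sum>i | rep i = j. u i) = t' (lab j) * c j"
          using fibre_sum by blast
        have "(\<Sum>i\<in>UNIV. of_int (u i) * vec_nth v i) = of_int (c k) * (\<Sum>i\<in>UNIV. of_int (u i) * ind j i) - of_int (c j) * (\<Sum>i\<in>UNIV. of_int (u i) * ind k i)"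
          by (simp add: v_def right_diff_distrib sum_subtractf sum_distrib_left mult.left_commute)
        then show "(\<Sum>i\<in>UNIV. of_int (u i) * vec_nth v i) = 0"
          using t' j k jk unfolding ind_sum by simp
      qed
      from ann[OF this] have "(\<Sum>i | rep i = i. vec_nth y i * vec_nth v i * \<phi> x i) = 0"
        by (subst (asm) pairing[OF y]) (simp_all add: v_def ind_def rep_rep)
      moreover have "(\<Sum>i | rep i = i. vec_nth y i * vec_nth v i * \<phi> x i) =
          of_int (c k) * (\<Sum>i | rep i = i. vec_nth y i * ind j i * \<phi> x i) - of_int (c j) * (\<Sum>i | rep i = i. vec_nth y i * ind k i * \<phi> x i)"
        by (simp add: v_def algebra_simps sum_subtractf sum_distrib_left)
      ultimately have "of_int (c k) * (vec_nth y j * \<phi> x j) = of_int (c j) * (vec_nth y k * \<phi> x k)"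
        using ind_pairing j k by simp
      then show ?thesis
        using j k c_nonzero by (simp add: \<phi>_def mult.commute)
    qed
    have key_const: "vec_nth x j * vec_nth y j = vec_nth x k * vec_nth y k" if "key j = key k" for j k
    proof (cases "free j")
      case True
      then have "rep j = rep k"
        using that by (auto simp: key_def split: if_splits)
      then show ?thesis
        using x_rep torus_rep[OF y] by metis
    next
      case False
      then have "\<not> free k" "lab j = lab k"
        using that by (auto simp: key_def split: if_splits)
      then have "vec_nth x (rep j) * vec_nth y (rep j) = vec_nth x (rep k) * vec_nth y (rep k)"
        using False by (intro block) (auto simp: rep_rep free_rep lab_rep)
      then show ?thesis
        by (simp add: x_rep torus_rep[OF y])
    qed
    \<comment> \<open>By \<open>key_const\<close> the product of \<open>x\<close> and
      \<open>y\<close> depends only on the class, so \<open>x\<close> is a scaling of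
      \<open>1 / y\<close>. The factors may be 0, hence \<open>x\<close> need not lie in the
      torus.\<close>
    define s where "s k = (let j = (SOME j. key j = k) in vec_nth x j * vec_nth y j)" for k
    have s: "s (key j) = vec_nth x j * vec_nth y j" for j
      unfolding s_def Let_def by (rule key_const) (rule someI, rule refl)
    define y' where "y' = vec_lambda (\<lambda>j. inverse (vec_nth y j))"
    have "y' \<in> binomial_torus (rel V)"
      unfolding y'_def using y by (rule inverse_in_torus)
    moreover have "x = vec_lambda (\<lambda>j. s (key j) * vec_nth y' j)"
      using nz by (simp add: s y'_def Finite_Cartesian_Product.vec_eq_iff)
    ultimately have "xpow (\<lambda>j. nat (u j)) x = xpow (\<lambda>j. nat (- u j)) x" if "u \<in> rel V" for u
      using scaled_torus_point[OF _ that, of y' s] by simp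
    moreover have "x \<noteq> 0"
    proof
      assume "x = 0"
      then have "F x = 0"
        by (simp add: F_def \<phi>_def Finite_Cartesian_Product.vec_eq_iff)
      with \<open>F x \<noteq> 0\<close> show False ..
    qed
    ultimately show "x \<in> binomial_variety (rel V)"
      by (simp add: binomial_variety_def)
  qed
qed

end


section \<open>The kernel of a generalized Lawrence matrix\<close>

lemma lawrence_block_mult:
  assumes "v \<in> carrier_vec (dim_vec c)" "r < dim_vec c - 1"
  shows "(lawrence_block c *\<^sub>v v) $ r = c $ 0 * v $ (r + 1) - c $ (r + 1) * v $ 0"
proof -
  have "(lawrence_block c *\<^sub>v v) $ r =
      (\<Sum>j = 0..<dim_vec c. (if j = 0 then - (c $ (r + 1)) else if j = r + 1 then c $ 0 else 0) * v $ j)"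
    using assms by (simp add: lawrence_block_def scalar_prod_def)
  also have "\<dots> = (\<Sum>j = 0..<dim_vec c. (if j = 0 then - (c $ (r + 1)) * v $ 0 else 0) + (if j = r + 1 then c $ 0 * v $ (r + 1) else 0))"
    by (intro sum.cong) auto
  also have "\<dots> = c $ 0 * v $ (r + 1) - c $ (r + 1) * v $ 0"
    using assms(2) less_diff_conv[of r "dim_vec c" 1] unfolding sum.distrib by (simp add: sum.delta' sum.delta)
  finally show ?thesis .
qed

text \<open>The rows say that \<open>v\<close> is proportional to \<open>c\<close>. Then
  \<open>c $ 0\<close> divides every \<open>v $ 0 * c $ j\<close>, hence also \<open>v $ 0\<close>
  because \<open>c\<close> is primitive, so the factor is an integer.\<close>

lemma lawrence_block_kernel:
  assumes "primitive_vec c" "c $ 0 > 0" and v: "v \<in> carrier_vec (dim_vec c)"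
  shows "lawrence_block c *\<^sub>v v = 0\<^sub>v (dim_vec c - 1) \<longleftrightarrow> (\<exists>t. v = t \<cdot>\<^sub>v c)"
proof
  assume 0: "lawrence_block c *\<^sub>v v = 0\<^sub>v (dim_vec c - 1)"
  have proportional: "c $ 0 * v $ j = c $ j * v $ 0" if "j < dim_vec c" for j
  proof (cases j)
    case (Suc r)
    then have "(lawrence_block c *\<^sub>v v) $ r = 0"
      using 0 that by simp
    then show ?thesis
      using lawrence_block_mult[OF v, of r] Suc that by simp
  qed simp
  have "c $ 0 dvd x" if x: "x \<in> (*) (v $ 0) ` {c $ j |j. j < dim_vec c}" for x
  proof -
    obtain j where "j < dim_vec c" "x = v $ 0 * c $ j"
      using x by auto
    then show ?thesis
      using proportional[of j] by (metis dvd_triv_left mult.commute)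
  qed
  then have "c $ 0 dvd Gcd ((*) (v $ 0) ` {c $ j |j. j < dim_vec c})"
    by (rule Gcd_greatest)
  then have "c $ 0 dvd v $ 0"
    using assms(1) unfolding Gcd_mult primitive_vec_def by simp
  then obtain t where t: "v $ 0 = c $ 0 * t" ..
  have "v $ j = t * c $ j" if "j < dim_vec c" for j
    using proportional[OF that] assms(2) by (simp add: t)
  then have "v = t \<cdot>\<^sub>v c"
    using v by (intro eq_vecI) auto
  then show "\<exists>t. v = t \<cdot>\<^sub>v c" ..
next
  assume "\<exists>t. v = t \<cdot>\<^sub>v c"
  then show "lawrence_block c *\<^sub>v v = 0\<^sub>v (dim_vec c - 1)"
    using v lawrence_block_mult[of _ c] by (intro eq_vecI) (auto simp: lawrence_block_def[of c, THEN arg_cong[of _ _ dim_row]] simp del: index_mult_mat_vec)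
qed

fun block_positions :: "nat list \<Rightarrow> (nat \<times> nat) list" where
  "block_positions [] = []"
| "block_positions (m # ms) = map (Pair 0) [0..<m] @ map (\<lambda>(i, j). (Suc i, j)) (block_positions ms)"

lemma length_block_positions [simp]: "length (block_positions ms) = sum_list ms"
  by (induction ms) auto

lemma set_block_positions: "set (block_positions ms) = Sigma {..<length ms} (\<lambda>i. {..<ms ! i})"
proof (induction ms)
  case (Cons m ms)
  show ?case
  proof (intro Set.set_eqI)
    fix p :: "nat \<times> nat"
    obtain i j where p: "p = (i, j)"
      by (cases p)
    show "p \<in> set (block_positions (m # ms)) \<longleftrightarrow> p \<in> Sigma {..<length (m # ms)} (\<lambda>i. {..<(m # ms) ! i})"
      by (cases i) (auto simp: p Cons.IH image_iff)
  qed
qed simp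

lemma distinct_block_positions: "distinct (block_positions ms)"
  by (induction ms) (auto simp: distinct_map inj_on_def)

definition block_multiples :: "int list \<Rightarrow> int vec list \<Rightarrow> int vec" where
  "block_multiples ts cs = vec_of_list (map (\<lambda>(i, j). ts ! i * cs ! i $ j) (block_positions (map dim_vec cs)))"

lemma block_multiples_Cons: "block_multiples (t # ts) (c # cs) = (t \<cdot>\<^sub>v c) @\<^sub>v block_multiples ts cs"
proof -
  have "vec_of_list (map (\<lambda>j. t * c $ j) [0..<dim_vec c]) = t \<cdot>\<^sub>v c"
    by (intro eq_vecI) (auto simp: vec_of_list_index)
  moreover have "vec_of_list (xs @ ys) = vec_of_list xs @\<^sub>v vec_of_list ys" for xs ys :: "int list"
    by (intro eq_vecI) (auto simp: vec_of_list_index nth_append)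
  ultimately show ?thesis
    by (simp add: block_multiples_def o_def split_def)
qed

lemma dim_block_multiples [simp]: "dim_vec (block_multiples ts cs) = sum_list (map dim_vec cs)"
  by (simp add: block_multiples_def)

definition lawrence_multiplier :: "int vec \<Rightarrow> bool" where
  "lawrence_multiplier c \<longleftrightarrow> dim_vec c \<ge> 1 \<and> primitive_vec c \<and> full_support c \<and> c $ 0 > 0"

lemma append_vec_eq_0:
  fixes v w :: "'a::zero vec"
  assumes "v \<in> carrier_vec n" "w \<in> carrier_vec m"
  shows "v @\<^sub>v w = 0\<^sub>v (n + m) \<longleftrightarrow> v = 0\<^sub>v n \<and> w = 0\<^sub>v m"
proof -
  have eq: "0\<^sub>v (n + m) = 0\<^sub>v n @\<^sub>v (0\<^sub>v m :: 'a vec)"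
    by (intro eq_vecI) auto
  show ?thesis
    unfolding eq using append_vec_eq[OF assms(1) zero_carrier_vec] .
qed

lemma diag_lawrence_carrier:
  "diag_block_mat (map lawrence_block cs) \<in> carrier_mat (dim_row (diag_block_mat (map lawrence_block cs))) (sum_list (map dim_vec cs))"
proof (rule carrier_matI[OF refl])
  have "dim_col (lawrence_block c) = dim_vec c" for c
    by (simp add: lawrence_block_def)
  then show "dim_col (diag_block_mat (map lawrence_block cs)) = sum_list (map dim_vec cs)"
    unfolding dim_diag_block_mat(2) map_map o_def by simp
qed

lemma diag_lawrence_kernel:
  assumes "\<forall>c\<in>set cs. lawrence_multiplier c" "v \<in> carrier_vec (sum_list (map dim_vec cs))"
  shows "diag_block_mat (map lawrence_block cs) *\<^sub>v v = 0\<^sub>v (dim_row (diag_block_mat (map lawrence_block cs))) \<longleftrightarrow>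
    (\<exists>ts. length ts = length cs \<and> v = block_multiples ts cs)"
  using assms
proof (induction cs arbitrary: v)
  case Nil
  then have "v = block_multiples [] []"
    by (intro eq_vecI) (auto simp: block_multiples_def)
  then show ?case
    by (auto intro!: eq_vecI)
next
  case (Cons c cs)
  let ?D = "diag_block_mat (map lawrence_block cs)" and ?k = "sum_list (map dim_vec cs)"
  have c: "primitive_vec c" "c $ 0 > 0" "\<forall>c\<in>set cs. lawrence_multiplier c"
    using Cons.prems by (auto simp: lawrence_multiplier_def)
  have B: "lawrence_block c \<in> carrier_mat (dim_vec c - 1) (dim_vec c)" for c
    by (simp add: lawrence_block_def)
  have Dc: "?D \<in> carrier_mat (dim_row ?D) ?k"
    by (rule diag_lawrence_carrier)
  have "v \<in> carrier_vec (dim_vec c + ?k)"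
    using Cons.prems(2) by simp
  then obtain v1 v2 where v: "v1 \<in> carrier_vec (dim_vec c)" "v2 \<in> carrier_vec ?k" "v = v1 @\<^sub>v v2"
    by (metis vec_first_carrier vec_last_carrier vec_first_last_append)
  have cons: "diag_block_mat (map lawrence_block (c # cs)) =
      four_block_mat (lawrence_block c) (0\<^sub>m (dim_vec c - 1) ?k) (0\<^sub>m (dim_row ?D) (dim_vec c)) ?D"
    unfolding list.map diag_block_mat.simps Let_def carrier_matD[OF B] carrier_matD(2)[OF Dc] ..
  have Dv: "?D *\<^sub>v v2 \<in> carrier_vec (dim_row ?D)"
    by (rule mult_mat_vec_carrier[OF Dc v(2)])
  have Bv: "lawrence_block c *\<^sub>v v1 \<in> carrier_vec (dim_vec c - 1)"
    by (rule mult_mat_vec_carrier[OF B v(1)])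
  have "0\<^sub>m (dim_vec c - 1) ?k *\<^sub>v v2 = 0\<^sub>v (dim_vec c - 1)" "0\<^sub>m (dim_row ?D) (dim_vec c) *\<^sub>v v1 = 0\<^sub>v (dim_row ?D)"
    using v(1,2) by auto
  then have "diag_block_mat (map lawrence_block (c # cs)) *\<^sub>v v = (lawrence_block c *\<^sub>v v1) @\<^sub>v (?D *\<^sub>v v2)"
    unfolding cons v(3) four_block_mat_mult_vec[OF B zero_carrier_mat zero_carrier_mat Dc v(1,2)]
    using Bv Dv by simp
  moreover have "dim_row (diag_block_mat (map lawrence_block (c # cs))) = (dim_vec c - 1) + dim_row ?D"
    by (simp add: Let_def carrier_matD[OF B])
  ultimately have "diag_block_mat (map lawrence_block (c # cs)) *\<^sub>v v = 0\<^sub>v (dim_row (diag_block_mat (map lawrence_block (c # cs)))) \<longleftrightarrow>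
      lawrence_block c *\<^sub>v v1 = 0\<^sub>v (dim_vec c - 1) \<and> ?D *\<^sub>v v2 = 0\<^sub>v (dim_row ?D)"
    using append_vec_eq_0[OF Bv Dv] by simp
  also have "\<dots> \<longleftrightarrow> (\<exists>t. v1 = t \<cdot>\<^sub>v c) \<and> (\<exists>ts. length ts = length cs \<and> v2 = block_multiples ts cs)"
    using lawrence_block_kernel[OF c(1,2) v(1)] Cons.IH[OF c(3) v(2)] by simp
  also have "\<dots> \<longleftrightarrow> (\<exists>ts. length ts = length (c # cs) \<and> v = block_multiples ts (c # cs))"
  proof
    assume "(\<exists>t. v1 = t \<cdot>\<^sub>v c) \<and> (\<exists>ts. length ts = length cs \<and> v2 = block_multiples ts cs)"
    then obtain t ts where "v1 = t \<cdot>\<^sub>v c" "length ts = length cs" "v2 = block_multiples ts cs"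
      by blast
    then show "\<exists>ts. length ts = length (c # cs) \<and> v = block_multiples ts (c # cs)"
      by (intro exI[of _ "t # ts"]) (simp add: block_multiples_Cons v(3))
  next
    assume "\<exists>ts. length ts = length (c # cs) \<and> v = block_multiples ts (c # cs)"
    then obtain t ts where ts: "length ts = length cs" "v = block_multiples (t # ts) (c # cs)"
      by (metis length_Suc_conv list.size(4) Suc_eq_plus1)
    then have "v1 = t \<cdot>\<^sub>v c" "v2 = block_multiples ts cs"
      using append_vec_eq[of v1 "dim_vec c" "t \<cdot>\<^sub>v c" v2 "block_multiples ts cs"] v by (auto simp: block_multiples_Cons)
    with ts(1) show "(\<exists>t. v1 = t \<cdot>\<^sub>v c) \<and> (\<exists>ts. length ts = length cs \<and> v2 = block_multiples ts cs)"
      by blast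
  qed
  finally show ?case .
qed

lemma mat_of_cols_mult_vec:
  "r < d \<Longrightarrow> dim_vec v = length xs \<Longrightarrow> (mat_of_cols d xs *\<^sub>v v) $ r = (\<Sum>j<length xs. xs ! j $ r * v $ j)"
  by (simp add: scalar_prod_def mat_of_cols_index atLeast0LessThan)

lemma length_multiples:
  assumes "length bs = length cs" "length ls = length cs" "\<forall>i<length cs. dim_vec (ls ! i) = dim_vec (cs ! i)"
  shows "length (concat (map2 multiples_block bs ls)) = sum_list (map dim_vec cs)"
  using assms
proof (induction cs arbitrary: bs ls)
  case (Cons c cs)
  obtain b bs' l ls' where eqs: "bs = b # bs'" "ls = l # ls'"
    using Cons.prems(1,2) by (auto simp: length_Suc_conv)
  have "dim_vec l = dim_vec c" "\<forall>i<length cs. dim_vec (ls' ! i) = dim_vec (cs ! i)"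
    using Cons.prems(3) by (auto simp: eqs)
  then show ?case
    using Cons.IH[of bs' ls'] Cons.prems(1,2) by (auto simp: eqs multiples_block_def)
qed simp

text \<open>Within a block the products of multipliers and entries of \<open>c\<close> add up to 1,
  so the block contributes \<open>t\<close> times \<open>b\<close> for any choice of the
  multipliers.\<close>

lemma multiples_mult_block_multiples:
  assumes "length bs = length cs" "length ls = length cs" "length ts = length cs"
    and "set bs \<subseteq> carrier_vec d" "\<forall>i<length cs. dim_vec (ls ! i) = dim_vec (cs ! i) \<and> ls ! i \<bullet> cs ! i = 1" "r < d"
  shows "(\<Sum>l<sum_list (map dim_vec cs). concat (map2 multiples_block bs ls) ! l $ r * block_multiples ts cs $ l) =
      (\<Sum>i<length cs. ts ! i * bs ! i $ r)"
  using assms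
proof (induction cs arbitrary: bs ls ts)
  case (Cons c cs)
  obtain b bs' l ls' t ts' where eqs: "bs = b # bs'" "ls = l # ls'" "ts = t # ts'"
    using Cons.prems(1-3) by (auto simp: length_Suc_conv)
  have l: "dim_vec l = dim_vec c" "l \<bullet> c = 1" and b: "b \<in> carrier_vec d"
    using Cons.prems(4,5) by (auto simp: eqs dest: spec[of _ 0])
  have tl: "\<forall>i<length cs. dim_vec (ls' ! i) = dim_vec (cs ! i) \<and> ls' ! i \<bullet> cs ! i = 1"
    using Cons.prems(5) by (auto simp: eqs)
  let ?X = "concat (map2 multiples_block bs' ls')"
  have IH: "(\<Sum>l<sum_list (map dim_vec cs). ?X ! l $ r * block_multiples ts' cs $ l) = (\<Sum>i<length cs. ts' ! i * bs' ! i $ r)"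
    using Cons.IH[of bs' ls' ts'] Cons.prems tl by (auto simp: eqs)
  have len: "length (multiples_block b l) = dim_vec c"
    by (simp add: multiples_block_def l)
  have "(\<Sum>j<dim_vec c. multiples_block b l ! j $ r * (t * c $ j)) = t * b $ r * (\<Sum>j<dim_vec c. l $ j * c $ j)"
    using b \<open>r < d\<close> by (simp add: multiples_block_def l sum_distrib_left mult_ac)
  also have "(\<Sum>j<dim_vec c. l $ j * c $ j) = 1"
    using l by (simp add: scalar_prod_def atLeast0LessThan)
  finally have head: "(\<Sum>j<dim_vec c. multiples_block b l ! j $ r * (t * c $ j)) = t * b $ r"
    by simp
  have "(\<Sum>k<dim_vec c + sum_list (map dim_vec cs). (multiples_block b l @ ?X) ! k $ r * block_multiples (t # ts') (c # cs) $ k) =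
      t * b $ r + (\<Sum>i<length cs. ts' ! i * bs' ! i $ r)"
    unfolding sum_lessThan_add using head IH by (simp add: nth_append len block_multiples_Cons)
  then show ?case
    by (simp add: eqs len sum.lessThan_Suc_shift del: sum.lessThan_Suc)
qed simp

lemma GLM_kernel:
  assumes "generalized_lawrence_matrix d bs cs C"
  shows "dim_col C = sum_list (map dim_vec cs)"
    and "v \<in> carrier_vec (dim_col C) \<Longrightarrow> C *\<^sub>v v = 0\<^sub>v (dim_row C) \<longleftrightarrow>
      (\<exists>ts. length ts = length cs \<and> v = block_multiples ts cs \<and> (\<forall>r<d. (\<Sum>i<length cs. ts ! i * bs ! i $ r) = 0))"
proof -
  obtain ls where bs: "length bs = length cs" "set bs \<subseteq> carrier_vec d" and cs: "\<forall>c\<in>set cs. lawrence_multiplier c"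
    and ls: "length ls = length cs" "\<forall>i<length cs. dim_vec (ls ! i) = dim_vec (cs ! i) \<and> ls ! i \<bullet> cs ! i = 1"
    and C: "C = GLM d bs cs ls"
    using assms by (auto simp: generalized_lawrence_matrix_def lawrence_multiplier_def)
  let ?A = "mat_of_cols d (concat (map2 multiples_block bs ls))" and ?D = "diag_block_mat (map lawrence_block cs)"
  have length: "length (concat (map2 multiples_block bs ls)) = sum_list (map dim_vec cs)"
    using ls(2) by (intro length_multiples bs(1) ls(1)) simp
  have A: "?A \<in> carrier_mat d (sum_list (map dim_vec cs))"
    unfolding length[symmetric] by (rule mat_of_cols_carrier)
  note carrier = A diag_lawrence_carrier[of cs]
  have dims: "C \<in> carrier_mat (d + dim_row ?D) (sum_list (map dim_vec cs))"
    unfolding C GLM_def using carrier by (rule carrier_append_rows)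
  then show col: "dim_col C = sum_list (map dim_vec cs)"
    by simp
  assume "v \<in> carrier_vec (dim_col C)"
  then have v: "v \<in> carrier_vec (sum_list (map dim_vec cs))"
    by (simp add: col)
  have "C *\<^sub>v v = (?A *\<^sub>v v) @\<^sub>v (?D *\<^sub>v v)"
    unfolding C GLM_def by (rule mat_mult_append[OF carrier v])
  then have "C *\<^sub>v v = 0\<^sub>v (dim_row C) \<longleftrightarrow> ?A *\<^sub>v v = 0\<^sub>v d \<and> ?D *\<^sub>v v = 0\<^sub>v (dim_row ?D)"
    using dims append_vec_eq_0[OF mult_mat_vec_carrier[OF carrier(1) v] mult_mat_vec_carrier[OF carrier(2) v]] by simp
  also have "\<dots> \<longleftrightarrow> (\<exists>ts. length ts = length cs \<and> v = block_multiples ts cs \<and> ?A *\<^sub>v v = 0\<^sub>v d)"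
    unfolding diag_lawrence_kernel[OF cs v] by blast
  also have "\<dots> \<longleftrightarrow> (\<exists>ts. length ts = length cs \<and> v = block_multiples ts cs \<and> (\<forall>r<d. (\<Sum>i<length cs. ts ! i * bs ! i $ r) = 0))"
  proof -
    have "?A *\<^sub>v block_multiples ts cs = 0\<^sub>v d \<longleftrightarrow> (\<forall>r<d. (\<Sum>i<length cs. ts ! i * bs ! i $ r) = 0)" if ts: "length ts = length cs" for ts
    proof -
      have "(?A *\<^sub>v block_multiples ts cs) $ r = (\<Sum>i<length cs. ts ! i * bs ! i $ r)" if "r < d" for r
        using multiples_mult_block_multiples[OF bs(1) ls(1) ts bs(2) ls(2) that] that length by (subst mat_of_cols_mult_vec) auto
      moreover have "?A *\<^sub>v block_multiples ts cs = 0\<^sub>v d \<longleftrightarrow> (\<forall>r<d. (?A *\<^sub>v block_multiples ts cs) $ r = 0)"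
        by (auto simp del: index_mult_mat_vec intro!: eq_vecI)
      ultimately show ?thesis
        by simp
    qed
    then show ?thesis
      by blast
  qed
  finally show "C *\<^sub>v v = 0\<^sub>v (dim_row C) \<longleftrightarrow>
      (\<exists>ts. length ts = length cs \<and> v = block_multiples ts cs \<and> (\<forall>r<d. (\<Sum>i<length cs. ts ! i * bs ! i $ r) = 0))" .
qed


section \<open>Multisets of columns\<close>

text \<open>\<open>Sig\<close> indexes the columns of the generalized Lawrence matrix by pairs (block, position), \<open>cc\<close> holds the
  entries of the vectors \<open>c'\<^sub>i\<close>, and \<open>L\<close> is the relation lattice of the \<open>b\<^sub>i\<close>. Distinct elements of \<open>Sig\<close>
  may carry the same column.\<close>

locale lawrence_configuration =
  fixes Sig :: "(nat \<times> nat) set" and column :: "nat \<times> nat \<Rightarrow> int vec" and cc :: "nat \<times> nat \<Rightarrow> int"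
    and L :: "(nat \<Rightarrow> int) set" and m :: nat and a :: "'n::finite \<Rightarrow> int vec" and t :: "nat \<Rightarrow> int"
  assumes finite_Sig: "finite Sig"
    and range_a: "range a = column ` Sig"
    and card_a: "CARD('n) = card Sig + card {q\<in>Sig. fst q = 0}"
    and cc_nonzero: "q \<in> Sig \<Longrightarrow> cc q \<noteq> 0"
    and cc_sum: "i \<noteq> 0 \<Longrightarrow> (\<Sum>q | q \<in> Sig \<and> fst q = i. cc q) = 0"
    and kernel: "(\<forall>r<m. (\<Sum>q\<in>Sig. v q * column q $ r) = 0) \<longleftrightarrow> (\<exists>t\<in>L. \<forall>q\<in>Sig. v q = t (fst q) * cc q)"
    and L_0: "t' \<in> L \<Longrightarrow> t' 0 = 0"
    and t_in: "t \<in> L"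
    and t_nz: "q \<in> Sig \<Longrightarrow> fst q \<noteq> 0 \<Longrightarrow> t (fst q) \<noteq> 0"
begin

text \<open>The difference of two unit vectors is a relation, so it is a multiple of
  \<open>cc\<close> on each block. Its multiplier at the block of \<open>q\<close> is nonzero, which
  excludes block 0 and any third position there. As \<open>cc\<close> adds up to 0 on the block,
  \<open>q\<close> cannot be alone, so \<open>q'\<close> belongs to it.\<close>

lemma equal_columns:
  assumes q: "q \<in> Sig" "q' \<in> Sig" "q \<noteq> q'" "column q = column q'"
  shows "fst q \<noteq> 0" "x \<in> Sig \<Longrightarrow> fst x = fst q \<longleftrightarrow> x = q \<or> x = q'"
proof -
  define v :: "nat \<times> nat \<Rightarrow> int" where "v x = (if x = q then 1 else 0) - (if x = q' then 1 else 0)" for x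
  have "(\<Sum>x\<in>Sig. v x * column x $ r) = 0" for r
  proof -
    have "(\<Sum>x\<in>Sig. v x * column x $ r) = (\<Sum>x\<in>Sig. (if x = q then column q $ r else 0) - (if x = q' then column q' $ r else 0))"
      by (intro sum.cong) (auto simp: v_def)
    then show ?thesis
      using q finite_Sig by (simp add: sum_subtractf)
  qed
  then obtain t where t: "t \<in> L" "\<And>x. x \<in> Sig \<Longrightarrow> v x = t (fst x) * cc x"
    using kernel[of v] by blast
  have nz: "t (fst q) \<noteq> 0"
    using t(2)[OF q(1)] q(3) by (auto simp: v_def)
  then show 0: "fst q \<noteq> 0"
    using L_0[OF t(1)] by metis
  have sub: "x = q \<or> x = q'" if "x \<in> Sig" "fst x = fst q" for x
    using t(2)[OF that(1)] nz that cc_nonzero[OF that(1)] by (auto simp: v_def split: if_splits)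
  have "fst q' = fst q"
  proof (rule ccontr)
    assume "fst q' \<noteq> fst q"
    then have "{x. x \<in> Sig \<and> fst x = fst q} = {q}"
      using sub q by auto
    then show False
      using cc_sum[OF 0] cc_nonzero[OF q(1)] by simp
  qed
  then show "x \<in> Sig \<Longrightarrow> fst x = fst q \<longleftrightarrow> x = q \<or> x = q'"
    using sub by metis
qed

section \<open>Passing from indices to positions of columns\<close>

definition pos :: "'n \<Rightarrow> nat \<times> nat" where
  "pos j = (SOME q. q \<in> Sig \<and> column q = a j)"

definition rep :: "'n \<Rightarrow> 'n" where
  "rep j = (SOME i. a i = a j)"

definition dup :: "nat \<Rightarrow> bool" where
  "dup i \<longleftrightarrow> (\<exists>q\<in>Sig. \<exists>q'\<in>Sig. q \<noteq> q' \<and> column q = column q' \<and> fst q = i)"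

text \<open>Exactly the blocks whose multiplier is forced to be 0: block 0 by \<open>L_0\<close>,
  and blocks with a repeated column by \<open>push_dup\<close>.\<close>

definition free :: "'n \<Rightarrow> bool" where
  "free j \<longleftrightarrow> fst (pos j) = 0 \<or> dup (fst (pos j))"

definition push :: "('n \<Rightarrow> int) \<Rightarrow> nat \<times> nat \<Rightarrow> int" where
  "push u q = (\<Sum>j | pos j = q. u j)"

lemma pos: "pos j \<in> Sig" "column (pos j) = a j"
proof -
  have "a j \<in> column ` Sig"
    using range_a by blast
  then have "\<exists>q. q \<in> Sig \<and> column q = a j"
    by (metis imageE)
  then have "pos j \<in> Sig \<and> column (pos j) = a j"
    unfolding pos_def by (rule someI_ex)
  then show "pos j \<in> Sig" "column (pos j) = a j"
    by auto
qed

lemma pos_eq_iff: "pos i = pos j \<longleftrightarrow> a i = a j"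
  by (metis pos(2) pos_def)

lemma a_rep: "a (rep j) = a j"
  unfolding rep_def by (rule someI) (rule refl)

lemma rep_eq_iff: "rep i = rep j \<longleftrightarrow> a i = a j"
  by (metis a_rep rep_def)

lemma rep_rep: "rep (rep j) = rep j"
  by (simp add: rep_eq_iff a_rep)

lemma pos_rep: "pos (rep j) = pos j"
  by (simp add: pos_eq_iff a_rep)

lemma range_pos_unique: "q \<in> range pos \<Longrightarrow> q' \<in> range pos \<Longrightarrow> column q = column q' \<Longrightarrow> q = q'"
  using pos pos_eq_iff by auto

lemma in_range_pos:
  assumes "q \<in> Sig" "\<not> dup (fst q)"
  shows "q \<in> range pos"
proof -
  have "column q \<in> range a"
    using assms(1) range_a by simp
  then obtain j where "a j = column q"
    by auto
  then have "pos j = q"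
    using assms pos[of j] unfolding dup_def by metis
  then show ?thesis
    by blast
qed

lemma not_dup_0: "\<not> dup 0"
  using equal_columns(1) unfolding dup_def by metis

lemma dup_block:
  assumes "dup i"
  obtains q q' where "q \<in> range pos" "q' \<in> Sig - range pos" "column q = column q'" "fst q = i"
    "\<forall>x\<in>Sig. fst x = i \<longleftrightarrow> x = q \<or> x = q'"
proof -
  obtain q q' where q: "q \<in> Sig" "q' \<in> Sig" "q \<noteq> q'" "column q = column q'" "fst q = i"
    using assms by (auto simp: dup_def)
  note block = equal_columns(2)[OF q(1-4), unfolded q(5)]
  have "column q \<in> range a"
    using q(1) range_a by simp
  then obtain j where j: "column (pos j) = column q"
    using pos(2) by auto
  have "fst (pos j) = i"
    using equal_columns(2)[of q "pos j" q] equal_columns(2)[of q "pos j" "pos j"] pos(1)[of j] q j by (cases "pos j = q") auto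
  then consider "pos j = q" | "pos j = q'"
    using block[OF pos(1)] by blast
  then show ?thesis
  proof cases
    case 1
    then have "q' \<notin> range pos"
      using range_pos_unique[of q q'] q by (metis rangeI)
    then show ?thesis
      using that[of q q'] 1 q block by auto
  next
    case 2
    then have "q \<notin> range pos"
      using range_pos_unique[of q q'] q by (metis rangeI)
    moreover have "fst q' = i"
      using block q(2) by blast
    ultimately show ?thesis
      using that[of q' q] 2 q block by auto
  qed
qed

lemma relation_iff_push: "u \<in> int_relations m a \<longleftrightarrow> (\<exists>t\<in>L. \<forall>q\<in>Sig. push u q = t (fst q) * cc q)"
proof -
  have "(\<Sum>j\<in>UNIV. u j * a j $ r) = (\<Sum>q\<in>Sig. push u q * column q $ r)" for r
  proof -
    have "(\<Sum>j\<in>UNIV. u j * a j $ r) = (\<Sum>q\<in>Sig. \<Sum>j | pos j = q. u j * a j $ r)"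
      using finite_Sig pos by (subst sum.group[of UNIV Sig pos, symmetric]) auto
    also have "\<dots> = (\<Sum>q\<in>Sig. push u q * column q $ r)"
      unfolding push_def sum_distrib_right by (intro sum.cong) (auto simp: pos(2)[symmetric])
    finally show ?thesis .
  qed
  then show ?thesis
    unfolding int_relations_def kernel[symmetric] by simp
qed

lemma push_rep: "(\<Sum>i | rep i = rep j. u i) = push u (pos j)"
  unfolding push_def rep_eq_iff pos_eq_iff ..

lemma push_outside_range: "q \<notin> range pos \<Longrightarrow> push u q = 0"
  unfolding push_def by (rule sum.neutral) auto

text \<open>Of the two positions with the same column, \<open>pos\<close> selects only one. The
  other receives no index, so its pushed value is 0 although \<open>cc\<close> is nonzero
  there.\<close>

lemma push_dup:
  assumes "\<forall>q\<in>Sig. push u q = t' (fst q) * cc q" "dup i"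
  shows "t' i = 0"
proof -
  obtain q q' where "q' \<in> Sig - range pos" "\<forall>x\<in>Sig. fst x = i \<longleftrightarrow> x = q \<or> x = q'"
    by (rule dup_block[OF assms(2)])
  then have "q' \<in> Sig" "fst q' = i" "push u q' = 0"
    by (auto simp: push_outside_range)
  then show ?thesis
    using assms(1) cc_nonzero[of q'] by auto
qed

text \<open>A dup block has two positions but one distinct column, and \<open>fst\<close> matches
  dup blocks both with the positions missed by \<open>pos\<close> and with the dup positions that it
  hits. Hence both sides count the positions of block 0 plus the number of dup blocks.\<close>

lemma card_not_rep: "card {j. rep j \<noteq> j} = card {j. rep j = j \<and> free j}"
proof -
  have inj: "inj_on pos {j. rep j = j}"
  proof (rule inj_onI)
    fix i j assume "i \<in> {j. rep j = j}" "j \<in> {j. rep j = j}" "pos i = pos j"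
    then show "i = j"
      using rep_eq_iff[of i j] by (simp add: pos_eq_iff)
  qed
  have img: "pos ` {j. rep j = j} = range pos"
  proof
    show "range pos \<subseteq> pos ` {j. rep j = j}"
    proof (rule image_subsetI)
      fix j
      show "pos j \<in> pos ` {j. rep j = j}"
        using rep_rep[of j] by (intro image_eqI[of _ _ "rep j"]) (auto simp: pos_rep)
    qed
  qed blast
  define A where "A = {q\<in>range pos. dup (fst q)}"
  have sub: "range pos \<subseteq> Sig"
    using pos(1) by blast
  have "bij_betw fst A {i. dup i}"
  proof (rule bij_betw_imageI)
    show "inj_on fst A"
    proof (rule inj_onI)
      fix x y assume xy: "x \<in> A" "y \<in> A" "fst x = fst y"
      then have "dup (fst x)"
        by (simp add: A_def)
      then obtain q q' where "column q = column q'" "\<forall>z\<in>Sig. fst z = fst x \<longleftrightarrow> z = q \<or> z = q'"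
        by (rule dup_block)
      then have "column x = column y"
        using xy sub unfolding A_def by (metis (no_types, lifting) mem_Collect_eq subsetD)
      then show "x = y"
        using xy range_pos_unique by (auto simp: A_def)
    qed
    show "fst ` A = {i. dup i}"
    proof
      show "{i. dup i} \<subseteq> fst ` A"
      proof clarify
        fix i assume "dup i"
        then obtain q q' where "q \<in> range pos" "fst q = i"
          by (rule dup_block)
        then show "i \<in> fst ` A"
          using \<open>dup i\<close> by (auto simp: A_def)
      qed
    qed (auto simp: A_def)
  qed
  moreover have "bij_betw fst (Sig - range pos) {i. dup i}"
  proof (rule bij_betw_imageI)
    have dup: "dup (fst q)" if "q \<in> Sig - range pos" for q
      using that in_range_pos by blast
    show "inj_on fst (Sig - range pos)"
    proof (rule inj_onI)
      fix x y assume xy: "x \<in> Sig - range pos" "y \<in> Sig - range pos" "fst x = fst y"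
      obtain q q' where "q \<in> range pos" "\<forall>z\<in>Sig. fst z = fst x \<longleftrightarrow> z = q \<or> z = q'"
        by (rule dup_block[OF dup[OF xy(1)]])
      then show "x = y"
        using xy by (metis DiffE)
    qed
    show "fst ` (Sig - range pos) = {i. dup i}"
    proof
      show "{i. dup i} \<subseteq> fst ` (Sig - range pos)"
      proof clarify
        fix i assume "dup i"
        then obtain q q' where "q' \<in> Sig - range pos" "\<forall>z\<in>Sig. fst z = i \<longleftrightarrow> z = q \<or> z = q'"
          by (rule dup_block)
        then show "i \<in> fst ` (Sig - range pos)"
          by (intro rev_image_eqI[of q']) auto
      qed
    qed (use dup in auto)
  qed
  ultimately have AB: "card A = card (Sig - range pos)"
    by (metis bij_betw_same_card)
  have finpos: "finite (range pos)"
    by simp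
  have "card {j. rep j = j \<and> free j} = card (pos ` {j. rep j = j \<and> free j})"
    by (rule card_image[symmetric]) (rule inj_on_subset[OF inj], blast)
  also have "pos ` {j. rep j = j \<and> free j} = {q\<in>pos ` {j. rep j = j}. fst q = 0 \<or> dup (fst q)}"
    by (auto simp: free_def)
  also have "\<dots> = {q\<in>Sig. fst q = 0} \<union> A"
    unfolding img A_def using sub in_range_pos not_dup_0 by auto
  also have "card \<dots> = card {q\<in>Sig. fst q = 0} + card A"
    using finite_Sig finpos not_dup_0 by (intro card_Un_disjoint) (auto simp: A_def)
  also have "card A = card Sig - card (range pos)"
    unfolding AB by (rule card_Diff_subset[OF finpos sub])
  finally have "card {j. rep j = j \<and> free j} = card {q\<in>Sig. fst q = 0} + (card Sig - card (range pos))" .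
  moreover have "card (range pos) \<le> card Sig"
    by (rule card_mono[OF finite_Sig sub])
  moreover have "card {j. rep j = j} = card (range pos)"
    using card_image[OF inj] img by simp
  moreover have "card {j. rep j \<noteq> j} = CARD('n) - card {j. rep j = j}"
    using card_Diff_subset[of "{j. rep j = j}" UNIV] by (simp add: Collect_neg_eq Compl_eq_Diff_UNIV)
  ultimately show ?thesis
    using card_a by simp
qed

sublocale lawrence_rel "(\<lambda>r j. a j $ r) ` {..<m}" rep free "\<lambda>j. fst (pos j)" "\<lambda>j. cc (pos j)" t
proof (unfold_locales, unfold int_relations_eq[symmetric])
  show "rep (rep j) = rep j" "free (rep j) = free j" "fst (pos (rep j)) = fst (pos j)" for j
    by (simp_all add: rep_rep free_def pos_rep)
  show "cc (pos j) \<noteq> 0" for j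
    by (rule cc_nonzero[OF pos(1)])
  show "(\<lambda>i. int (if i = j then 1 else 0) - int (if i = rep j then 1 else 0)) \<in> int_relations m a" for j
  proof -
    have "(\<Sum>i\<in>UNIV. (int (if i = j then 1 else 0) - int (if i = rep j then 1 else 0)) * a i $ r) =
        (\<Sum>i\<in>UNIV. (if i = j then a i $ r else 0) - (if i = rep j then a i $ r else 0))" for r
      by (intro sum.cong) auto
    then show ?thesis
      by (simp add: int_relations_def sum_subtractf a_rep)
  qed
  show "(\<Sum>i | rep i = rep j. u i) = 0" if u: "u \<in> int_relations m a" and j: "free j" for u j
  proof -
    obtain t' where t': "t' \<in> L" "\<forall>q\<in>Sig. push u q = t' (fst q) * cc q"
      using u relation_iff_push by blast
    have "t' (fst (pos j)) = 0"
      using j L_0[OF t'(1)] push_dup[OF t'(2)] by (auto simp: free_def)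
    then show ?thesis
      using t'(2) pos(1)[of j] by (simp add: push_rep)
  qed
  show "\<exists>t. \<forall>j. rep j = j \<longrightarrow> \<not> free j \<longrightarrow> (\<Sum>i | rep i = j. u i) = t (fst (pos j)) * cc (pos j)" if u: "u \<in> int_relations m a" for u
  proof -
    obtain t' where t': "\<forall>q\<in>Sig. push u q = t' (fst q) * cc q"
      using u relation_iff_push by blast
    have "(\<Sum>i | rep i = j. u i) = t' (fst (pos j)) * cc (pos j)" if "rep j = j" for j
      using push_rep[where j = j and u = u] t' pos(1)[of j] that by simp
    then show ?thesis
      by blast
  qed
  show "(\<Sum>j | \<not> free j \<and> fst (pos j) = l. u j) = 0" if u: "u \<in> int_relations m a" for u l
  proof (cases "l = 0 \<or> dup l")
    case True
    then have "{j. \<not> free j \<and> fst (pos j) = l} = {}"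
      by (auto simp: free_def)
    then show ?thesis
      by (simp only: sum.empty)
  next
    case False
    obtain t' where t': "\<forall>q\<in>Sig. push u q = t' (fst q) * cc q"
      using u relation_iff_push by blast
    have "{j. \<not> free j \<and> fst (pos j) = l} = {j. fst (pos j) = l}"
      using False by (auto simp: free_def)
    then have "(\<Sum>j | \<not> free j \<and> fst (pos j) = l. u j) = (\<Sum>q | q \<in> Sig \<and> fst q = l. \<Sum>j | j \<in> {j. fst (pos j) = l} \<and> pos j = q. u j)"
      using finite_Sig pos(1) by (subst sum.group[of "{j. fst (pos j) = l}" "{q. q \<in> Sig \<and> fst q = l}" pos u]) auto
    also have "\<dots> = (\<Sum>q | q \<in> Sig \<and> fst q = l. t' l * cc q)"
    proof (intro sum.cong refl)
      fix q assume q: "q \<in> {q. q \<in> Sig \<and> fst q = l}"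
      then have "{j. j \<in> {j. fst (pos j) = l} \<and> pos j = q} = {j. pos j = q}"
        by auto
      then show "(\<Sum>j | j \<in> {j. fst (pos j) = l} \<and> pos j = q. u j) = t' l * cc q"
        using t' q by (simp add: push_def)
    qed
    also have "\<dots> = t' l * (\<Sum>q | q \<in> Sig \<and> fst q = l. cc q)"
      by (rule sum_distrib_left[symmetric])
    also have "\<dots> = 0"
      using cc_sum[of l] False by simp
    finally show ?thesis .
  qed
  show "t (fst (pos j)) \<noteq> 0" if "\<not> free j" for j
    using that t_nz[OF pos(1)] by (simp add: free_def)
  show "card {j. rep j \<noteq> j} = card {j. rep j = j \<and> free j}"
    by (rule card_not_rep)
  show "(\<lambda>j. if rep j = j \<and> \<not> free j then t (fst (pos j)) * cc (pos j) else 0) \<in> int_relations m a"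
  proof -
    \<comment> \<open>The multipliers \<open>t\<close> placed on the non-free representatives.
      Pushed to positions, this is the relation given by \<open>t\<close> with the dup blocks
      replaced by 0.\<close>
    define u where "u = (\<lambda>j. if rep j = j \<and> \<not> free j then t (fst (pos j)) * cc (pos j) else 0)"
    have push_u: "push u q = (if dup (fst q) then 0 else t (fst q) * cc q)" if q: "q \<in> Sig" for q
    proof (cases "fst q = 0 \<or> dup (fst q)")
      case True
      then have "push u q = 0"
        unfolding push_def u_def by (intro sum.neutral) (auto simp: free_def)
      then show ?thesis
        using True L_0[OF t_in] by auto
    next
      case False
      then obtain j where j: "pos j = q"
        using in_range_pos[OF q] by auto
      have "push u q = (\<Sum>i | pos i = q. if i = rep j then t (fst q) * cc q else 0)"
        unfolding push_def
      proof (intro sum.cong refl)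
        fix i assume "i \<in> {i. pos i = q}"
        then have i: "pos i = q" "rep i = rep j"
          using j by (auto simp: rep_eq_iff pos_eq_iff)
        then have "rep i = i \<longleftrightarrow> i = rep j"
          using rep_rep by metis
        then show "u i = (if i = rep j then t (fst q) * cc q else 0)"
          using i(1) j False by (simp add: u_def free_def pos_rep)
      qed
      then show ?thesis
        using False j pos_rep[of j] by simp
    qed
    have "(\<Sum>q\<in>Sig. push u q * column q $ r) = 0" if r: "r < m" for r
    proof -
      define f where "f q = t (fst q) * cc q * column q $ r" for q
      have "(\<Sum>q\<in>Sig. f q) = 0"
        unfolding f_def using kernel[of "\<lambda>q. t (fst q) * cc q"] t_in r by blast
      \<comment> \<open>In a dup block both positions carry the same column and the entries of
        \<open>cc\<close> cancel, so leaving out these blocks does not change the sum.\<close>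
      moreover have "(\<Sum>q | q \<in> Sig \<and> dup (fst q). f q) = 0"
      proof -
        have "(\<Sum>q | q \<in> Sig \<and> dup (fst q). f q) = (\<Sum>i\<in>fst ` Sig. \<Sum>q | q \<in> {q. q \<in> Sig \<and> dup (fst q)} \<and> fst q = i. f q)"
          using finite_Sig by (subst sum.group) auto
        also have "\<dots> = 0"
        proof (rule sum.neutral, rule ballI)
          fix i
          show "(\<Sum>q | q \<in> {q. q \<in> Sig \<and> dup (fst q)} \<and> fst q = i. f q) = 0"
          proof (cases "dup i")
            case True
            obtain p p' where p: "column p = column p'" "\<forall>x\<in>Sig. fst x = i \<longleftrightarrow> x = p \<or> x = p'"
              by (rule dup_block[OF True])
            have "i \<noteq> 0"
              using True not_dup_0 by metis
            have "(\<Sum>q | q \<in> {q. q \<in> Sig \<and> dup (fst q)} \<and> fst q = i. f q) = (\<Sum>q | q \<in> Sig \<and> fst q = i. t i * column p $ r * cc q)"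
              using True p by (intro sum.cong) (auto simp: f_def)
            also have "\<dots> = t i * column p $ r * (\<Sum>q | q \<in> Sig \<and> fst q = i. cc q)"
              by (rule sum_distrib_left[symmetric])
            also have "\<dots> = 0"
              using cc_sum[OF \<open>i \<noteq> 0\<close>] by simp
            finally show ?thesis .
          next
            case False
            then have "{q. q \<in> {q. q \<in> Sig \<and> dup (fst q)} \<and> fst q = i} = {}"
              by auto
            then show ?thesis
              by (simp only: sum.empty)
          qed
        qed
        finally show ?thesis .
      qed
      moreover have "(\<Sum>q\<in>Sig. push u q * column q $ r) = (\<Sum>q\<in>Sig. f q - (if dup (fst q) then f q else 0))"
        by (intro sum.cong) (auto simp: push_u f_def)
      ultimately show ?thesis
        using finite_Sig by (simp add: sum_subtractf sum.inter_filter[symmetric])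
    qed
    then have "u \<in> int_relations m a"
      unfolding relation_iff_push kernel[symmetric] by blast
    then show ?thesis
      by (simp add: u_def)
  qed
qed

theorem self_dual_toric: "self_dual (toric_variety m a :: ('k::field_char_0 ^ 'n) set)"
  unfolding toric_variety_eq int_relations_eq by (rule self_dual_variety)

text \<open>The all-ones vector is orthogonal to the relations, and over \<open>\<rat>\<close> the row space is the orthogonal
  complement of the relations.\<close>

theorem projective: "projective_configuration m a"
proof -
  define row :: "nat \<Rightarrow> rat ^ 'n" where "row r = vec_lambda (\<lambda>j. of_int (a j $ r))" for r
  have "vec_lambda (\<lambda>_. 1) \<in> vec.span (row ` {..<m})"
  proof (rule in_span_of_annihilator)
    fix y :: "rat ^ 'n" assume y: "\<And>s. s \<in> row ` {..<m} \<Longrightarrow> (\<Sum>j\<in>UNIV. vec_nth s j * vec_nth y j) = 0"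
    \<comment> \<open>A common denominator turns \<open>y\<close> into an integral relation, whose
      entries add up to 0.\<close>
    define D where "D = (\<Prod>j\<in>UNIV. snd (quotient_of (vec_nth y j)))"
    have pos: "snd (quotient_of z) > 0" for z
      by (rule quotient_of_denom_pos')
    then have D: "D \<noteq> 0"
      by (simp add: D_def less_imp_neq[symmetric])
    have "\<exists>z. of_int D * vec_nth y j = of_int z" for j
    proof -
      have "snd (quotient_of (vec_nth y j)) dvd D"
        unfolding D_def by (rule dvd_prodI) auto
      then obtain e where "D = snd (quotient_of (vec_nth y j)) * e" ..
      moreover have "vec_nth y j = of_int (fst (quotient_of (vec_nth y j))) / of_int (snd (quotient_of (vec_nth y j)))"
        by (rule quotient_of_div) (rule surjective_pairing)
      ultimately have "of_int D * vec_nth y j = of_int (fst (quotient_of (vec_nth y j)) * e)"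
        using pos[of "vec_nth y j"] by (simp add: field_simps)
      then show ?thesis ..
    qed
    then obtain u where u: "\<And>j. of_int D * vec_nth y j = of_int (u j)"
      by metis
    have "u \<in> int_relations m a"
      unfolding int_relations_def
    proof (intro CollectI allI impI)
      fix r assume "r < m"
      then have "of_int D * (\<Sum>j\<in>UNIV. vec_nth (row r) j * vec_nth y j) = 0"
        using y by simp
      then have "(\<Sum>j\<in>UNIV. of_int (a j $ r) * (of_int D * vec_nth y j)) = 0"
        by (simp add: row_def sum_distrib_left mult.left_commute)
      then have "of_int (\<Sum>j\<in>UNIV. u j * a j $ r) = (0 :: rat)"
        unfolding u by (simp add: mult.commute)
      then show "(\<Sum>j\<in>UNIV. u j * a j $ r) = 0"
        by (simp only: of_int_eq_0_iff)
    qed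
    then have "(\<Sum>j\<in>UNIV. u j) = 0"
      using sum_rel by (simp add: int_relations_eq)
    then have "of_int D * (\<Sum>j\<in>UNIV. vec_nth y j) = 0"
      by (simp add: sum_distrib_left u flip: of_int_sum)
    then show "(\<Sum>j\<in>UNIV. vec_nth (vec_lambda (\<lambda>_. 1)) j * vec_nth y j) = 0"
      using D by simp
  qed
  then obtain T c where T: "finite T" "T \<subseteq> row ` {..<m}" "vec_lambda (\<lambda>_. 1) = (\<Sum>s\<in>T. c s *s s)"
    by (auto simp: vec.span_explicit)
  \<comment> \<open>Distinct row indices may give equal rows, so one index is kept for each vector
    of \<open>T\<close>.\<close>
  obtain S where S: "S \<subseteq> {..<m}" "inj_on row S" "T = row ` S"
    using T(2) by (metis subset_image_inj)
  define \<omega> where "\<omega> r = (if r \<in> S then c (row r) else 0)" for r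
  have "(\<Sum>r<m. \<omega> r * of_int (a j $ r)) = 1" for j
  proof -
    have "1 = vec_nth (\<Sum>s\<in>T. c s *s s) j"
      unfolding T(3)[symmetric] by simp
    also have "\<dots> = (\<Sum>r\<in>S. c (row r) * of_int (a j $ r))"
      unfolding S(3) by (simp add: sum.reindex[OF S(2)]) (simp add: row_def)
    also have "\<dots> = (\<Sum>r\<in>S. \<omega> r * of_int (a j $ r))"
      by (simp add: \<omega>_def)
    also have "\<dots> = (\<Sum>r<m. \<omega> r * of_int (a j $ r))"
      using S(1) by (intro sum.mono_neutral_left) (auto simp: \<omega>_def)
    finally show ?thesis
      by simp
  qed
  then show ?thesis
    unfolding projective_configuration_def by blast
qed

end

theorem theorem3p8:
  fixes d k n :: nat
    and as' cs' :: "int vec list"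
    and c0' :: "int vec"
    and C :: "int mat"
    and A :: "int vec multiset"
    and a :: "'n::finite \<Rightarrow> int vec"
  assumes "d \<ge> 1"
    and "generalized_lawrence_matrix d (unit_vec d 0 # as') (c0' # cs') C"
    and "dim_col C = n"
    and "dim_vec c0' = k" and "k \<ge> 1" and "c0' $ 0 = 1"
    and "\<forall>v\<in>set as'. v $ 0 = 0"
    and "\<forall>c\<in>set cs'. (\<Sum>j<dim_vec c. c $ j) = 0"
    and "non_pyramidal (mat_of_cols d as')"
    and "size A = n + k" and "set_mset A = set (cols C)"
    and "image_mset a (mset_set UNIV) = A"
  shows "projective_configuration (dim_row C) a \<and>
    self_dual (toric_variety (dim_row C) a :: ('k::{alg_closed_field, field_char_0} ^ 'n) set)"
proof -
  define cs where "cs = c0' # cs'"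
  define bs where "bs = unit_vec d 0 # as'"
  define ps where "ps = block_positions (map dim_vec cs)"
  define Sig where "Sig = set ps"
  define idx where "idx = the_inv_into {..<n} (\<lambda>l. ps ! l)"
  define column where "column q = col C (idx q)" for q
  define cc where "cc q = cs ! fst q $ snd q" for q
  define L where "L = {t :: nat \<Rightarrow> int. \<forall>r<d. (\<Sum>i<length cs. t i * bs ! i $ r) = 0}"
  have glm: "generalized_lawrence_matrix d bs cs C"
    using assms(2) by (simp add: bs_def cs_def)
  then have len: "length bs = length cs" and bs: "set bs \<subseteq> carrier_vec d"
    and cs: "\<forall>c\<in>set cs. dim_vec c \<ge> 1 \<and> full_support c"
    by (auto simp: generalized_lawrence_matrix_def)
  have n: "n = length ps"
    using GLM_kernel(1)[OF glm] assms(3) by (simp add: ps_def)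
  have Sig: "Sig = Sigma {..<length cs} (\<lambda>i. {..<dim_vec (cs ! i)})"
    by (auto simp: Sig_def ps_def set_block_positions)
  have bij: "bij_betw (\<lambda>l. ps ! l) {..<n} Sig"
    unfolding Sig_def n by (rule bij_betw_nth) (auto simp: ps_def distinct_block_positions)
  have idx: "idx (ps ! l) = l" if "l < n" for l
    unfolding idx_def using bij that by (auto intro: the_inv_into_f_f simp: bij_betw_def)
  have sum_Sig: "(\<Sum>q\<in>Sig. g q) = (\<Sum>l<n. g (ps ! l))" for g :: "nat \<times> nat \<Rightarrow> int"
    using sum.reindex_bij_betw[OF bij, of g] by simp
  \<comment> \<open>The unit vector is the only member of \<open>bs\<close> with a nonzero first
    entry, so the equation for row 0 reads \<open>t 0 = 0\<close>.\<close>
  have L0: "t 0 = 0" if "t \<in> L" for t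
  proof -
    have "(\<Sum>i<length cs. t i * bs ! i $ 0) = t 0"
    proof -
      have "(\<Sum>i<length cs. t i * bs ! i $ 0) = (\<Sum>i<length cs. if i = 0 then t 0 else 0)"
      proof (intro sum.cong refl)
        fix i assume "i \<in> {..<length cs}"
        then show "t i * bs ! i $ 0 = (if i = 0 then t 0 else 0)"
          using assms(1,7) len by (cases i) (auto simp: bs_def cs_def)
      qed
      then show ?thesis
        by (simp add: cs_def)
    qed
    then show ?thesis
      using that assms(1) by (auto simp: L_def)
  qed
  have L_tail: "t \<in> L \<longleftrightarrow> t 0 = 0 \<and> (\<forall>r<d. (\<Sum>i<length as'. t (Suc i) * as' ! i $ r) = 0)" for t
  proof -
    have eq: "(\<Sum>i<length cs. t i * bs ! i $ r) = t 0 * unit_vec d 0 $ r + (\<Sum>i<length as'. t (Suc i) * as' ! i $ r)" for r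
      using len by (simp add: bs_def cs_def sum.lessThan_Suc_shift del: sum.lessThan_Suc)
    show ?thesis
    proof (cases "t 0 = 0")
      case True
      then show ?thesis
        by (simp add: L_def eq)
    qed (use L0 in blast)
  qed
  obtain t where t: "t \<in> L" "\<forall>i<length as'. t (Suc i) \<noteq> 0"
  proof -
    \<comment> \<open>Non-pyramidality gives, for each single \<open>i\<close>, a kernel vector that
      is nonzero at \<open>i\<close>. Shifted by one place with 0 in front, these lie in
      \<open>L\<close>, and generic combinations yield one element that works for all
      \<open>i\<close>.\<close>
    have "\<exists>t\<in>L. \<forall>i\<in>{..<length as'}. t (Suc i) \<noteq> 0"
    proof (rule common_nonzero)
      show "L \<noteq> {}"
        by (auto simp: L_def intro!: exI[of _ "\<lambda>_. 0"])
      show "\<exists>t\<in>L. t (Suc i) \<noteq> 0" if i: "i \<in> {..<length as'}" for i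
      proof -
        have "\<not> free_vector (mat_of_cols d as') i"
          using assms(9) i by (simp add: non_pyramidal_def)
        then obtain u where u: "u \<in> mat_kernel (mat_of_cols d as')" "u $ i \<noteq> 0"
          by (auto simp: free_vector_def)
        then have dim: "dim_vec u = length as'" and 0: "mat_of_cols d as' *\<^sub>v u = 0\<^sub>v d"
          by (auto simp: mat_kernel_def)
        define t where "t l = (if l = 0 then 0 else u $ (l - 1))" for l
        have "(\<Sum>i<length as'. t (Suc i) * as' ! i $ r) = 0" if "r < d" for r
          using mat_of_cols_mult_vec[OF that dim] 0 that by (simp add: t_def mult.commute)
        then have "t \<in> L"
          by (simp add: L_tail t_def)
        then show ?thesis
          using u(2) by (intro bexI[of _ t]) (simp add: t_def)
      qed
      show "\<exists>t''\<in>L. \<forall>i\<in>{..<length as'}. t'' (Suc i) = t (Suc i) + int N * t' (Suc i)" if "t \<in> L" "t' \<in> L" for t t' N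
      proof (intro bexI[of _ "\<lambda>i. t i + int N * t' i"] ballI refl)
        have "(\<Sum>i<length cs. (t i + int N * t' i) * bs ! i $ r) = (\<Sum>i<length cs. t i * bs ! i $ r) + int N * (\<Sum>i<length cs. t' i * bs ! i $ r)" for r
          by (simp add: distrib_right sum.distrib sum_distrib_left mult.assoc)
        then show "(\<lambda>i. t i + int N * t' i) \<in> L"
          using that by (simp add: L_def)
      qed
    qed simp
    then show ?thesis
      using that by auto
  qed
  have kernel: "(\<forall>r<dim_row C. (\<Sum>q\<in>Sig. v q * column q $ r) = 0) \<longleftrightarrow> (\<exists>t\<in>L. \<forall>q\<in>Sig. v q = t (fst q) * cc q)" for v
  proof -
    define v' where "v' = vec n (\<lambda>l. v (ps ! l))"
    have v': "v' \<in> carrier_vec (dim_col C)"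
      by (simp add: v'_def assms(3))
    have bm: "block_multiples ts cs $ l = ts ! fst (ps ! l) * cc (ps ! l)" if "l < n" for ts l
      using that by (simp add: block_multiples_def vec_of_list_index cc_def split_def n ps_def)
    have "(C *\<^sub>v v') $ r = (\<Sum>q\<in>Sig. v q * column q $ r)" if "r < dim_row C" for r
      using that unfolding sum_Sig by (simp add: scalar_prod_def v'_def column_def idx assms(3) atLeast0LessThan mult.commute)
    then have "(\<forall>r<dim_row C. (\<Sum>q\<in>Sig. v q * column q $ r) = 0) \<longleftrightarrow> C *\<^sub>v v' = 0\<^sub>v (dim_row C)"
      by (auto simp del: index_mult_mat_vec intro!: eq_vecI)
    also have "\<dots> \<longleftrightarrow> (\<exists>ts. length ts = length cs \<and> v' = block_multiples ts cs \<and> (\<forall>r<d. (\<Sum>i<length cs. ts ! i * bs ! i $ r) = 0))"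
      by (rule GLM_kernel(2)[OF glm v'])
    also have "\<dots> \<longleftrightarrow> (\<exists>t\<in>L. \<forall>q\<in>Sig. v q = t (fst q) * cc q)"
    proof
      assume "\<exists>ts. length ts = length cs \<and> v' = block_multiples ts cs \<and> (\<forall>r<d. (\<Sum>i<length cs. ts ! i * bs ! i $ r) = 0)"
      then obtain ts where ts: "length ts = length cs" "v' = block_multiples ts cs" "\<forall>r<d. (\<Sum>i<length cs. ts ! i * bs ! i $ r) = 0"
        by blast
      have "v (ps ! l) = ts ! fst (ps ! l) * cc (ps ! l)" if "l < n" for l
        using arg_cong[OF ts(2), of "\<lambda>v. v $ l"] that by (simp add: v'_def bm)
      then have "\<forall>q\<in>Sig. v q = ts ! fst q * cc q"
        unfolding Sig_def n by (metis in_set_conv_nth)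
      then show "\<exists>t\<in>L. \<forall>q\<in>Sig. v q = t (fst q) * cc q"
        using ts(3) by (intro bexI[of _ "(!) ts"]) (auto simp: L_def)
    next
      assume "\<exists>t\<in>L. \<forall>q\<in>Sig. v q = t (fst q) * cc q"
      then obtain t where t: "t \<in> L" "\<forall>q\<in>Sig. v q = t (fst q) * cc q"
        by blast
      define ts where "ts = map t [0..<length cs]"
      have "v' = block_multiples ts cs"
      proof (rule eq_vecI)
        fix l assume "l < dim_vec (block_multiples ts cs)"
        then have l: "l < n"
          by (simp add: n ps_def)
        then have "ps ! l \<in> Sig"
          by (simp add: Sig_def n)
        then show "v' $ l = block_multiples ts cs $ l"
          using l t(2) by (auto simp: bm v'_def ts_def Sig)
      qed (simp add: v'_def n ps_def)
      then show "\<exists>ts. length ts = length cs \<and> v' = block_multiples ts cs \<and> (\<forall>r<d. (\<Sum>i<length cs. ts ! i * bs ! i $ r) = 0)"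
        using t(1) by (intro exI[of _ ts]) (auto simp: ts_def L_def)
    qed
    finally show ?thesis .
  qed
  interpret lawrence_configuration Sig column cc L "dim_row C" a t
  proof
    show "finite Sig"
      by (simp add: Sig_def)
    have "range a = set_mset A"
      using assms(12) by (metis finite_class.finite_UNIV finite_set_mset_mset_set set_image_mset)
    also have "\<dots> = col C ` {..<n}"
      using assms(3,11) by (simp add: cols_def atLeast0LessThan)
    also have "\<dots> = column ` (\<lambda>l. ps ! l) ` {..<n}"
      unfolding image_image column_def by (intro image_cong) (auto simp: idx)
    finally show "range a = column ` Sig"
      using bij_betw_imp_surj_on[OF bij] by simp
    have "{q \<in> Sig. fst q = 0} = Pair 0 ` {..<k}"
      using assms(4) by (auto simp: Sig cs_def)
    then have "card {q \<in> Sig. fst q = 0} = k"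
      by (simp add: card_image inj_on_def)
    moreover have "CARD('n) = n + k"
      using assms(10,12) by (metis size_image_mset size_mset_set)
    moreover have "card Sig = n"
      using bij_betw_same_card[OF bij] by simp
    ultimately show "CARD('n) = card Sig + card {q \<in> Sig. fst q = 0}"
      by simp
    show "cc q \<noteq> 0" if "q \<in> Sig" for q
      using that cs by (auto simp: Sig cc_def full_support_def)
    show "(\<Sum>q | q \<in> Sig \<and> fst q = i. cc q) = 0" if "i \<noteq> 0" for i
    proof (cases "i < length cs")
      case True
      then have "{q. q \<in> Sig \<and> fst q = i} = Pair i ` {..<dim_vec (cs ! i)}"
        by (auto simp: Sig)
      then have "(\<Sum>q | q \<in> Sig \<and> fst q = i. cc q) = (\<Sum>j<dim_vec (cs ! i). cs ! i $ j)"
        by (simp add: sum.reindex inj_on_def cc_def)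
      moreover have "cs ! i \<in> set cs'"
        using True that by (cases i) (auto simp: cs_def)
      ultimately show ?thesis
        using assms(8) by simp
    next
      case False
      then have "{q. q \<in> Sig \<and> fst q = i} = {}"
        by (auto simp: Sig)
      then show ?thesis
        by (simp only: sum.empty)
    qed
    show "t (fst q) \<noteq> 0" if "q \<in> Sig" "fst q \<noteq> 0" for q
      using that t(2) len by (cases "fst q") (auto simp: Sig cs_def bs_def)
  qed (use kernel L0 t(1) in auto)
  show ?thesis
    using projective self_dual_toric by blast
qed

end
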